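(* Let $\mu\in S$ and let $g:(0,\infty)\to[0,\infty)$ be a continuous nonincreasing function such that, for some constants $c_1,c_2,\gamma>0$, $c_1\le g(y)\,y^{\gamma}\le c_2$ for all $y>0$. Then there exists at most one solution $u$ of the equation $-Au=g(u)\cdot\mu$, $u>0$ (i.e. any two solutions coincide q.e.).
   Context: Let $E$ be a locally compact separable metric space, $m$ a positive Radon measure on $E$ with $\mathrm{Supp}[m]=E$, and $(\mathcal{E},D[\mathcal{E}])$ a symmetric Dirichlet form on $L^2(E;m)$ (densely defined, bilinear, symmetric, nonnegative, closed, Markovian), with generator $A$, i.e. $\mathcal{E}(u,v)=(-Au,v)$ for $u\in D(A)$, $v\in D[\mathcal{E}]$. Put $\mathcal{E}_1(u,v)=\mathcal{E}(u,v)+(u,v)_{L^2(E;m)}$. The form is assumed regular ($D[\mathcal{E}]\cap C_0(E)$ is dense in $D[\mathcal{E}]$ for the $\mathcal{E}_1$-norm and in $C_0(E)$, the continuous functions with compact support, for the supremum norm) and transient (there is a strictly positive function $g_0$ on $E$ with $\int_E|u|g_0\,dm\le\sqrt{\mathcal{E}(u,u)}$ for all $u\in D[\mathcal{E}]$). $\mathbb{X}=((X_t)_{t\ge0},(P_x)_{x\in E},(\mathcal{F}_t)_{t\ge0},\zeta)$ is the Hunt process with life time $\zeta$ associated with the form (its transition semigroup $E_xf(X_t)$ is an $m$-version of the $L^2$-semigroup of the form); functions on $E$ are extended by $0$ to the cemetery; $E_x$ is expectation under $P_x$. Capacity: fix a bounded Borel $\varphi>0$ with $\int_E\varphi\,dm=1$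 and put $h=G_1\varphi$ ($G_1$ the $1$-resolvent of the form). For open $U\subset E$, $\mathrm{Cap}(U)=\mathcal{E}_1(h_U,h_U)$, where $h_U$ is the reduced function of $h$ on $U$ (the minimizer of $\mathcal{E}_1(w,w)$ among $w\in D[\mathcal{E}]$ with $w\ge h$ $m$-a.e. on $U$); for $B\subset E$, $\mathrm{Cap}(B)=\inf\{\mathrm{Cap}(U):B\subset U,\ U\text{ open}\}$. A nest is an increasing sequence $\{F_n\}$ of closed sets with $\mathrm{Cap}(E\setminus F_n)\to0$. A property holds q.e. if it holds outside a set of zero Cap. A function is quasi-continuous if its restriction to each $F_n$ is continuous for some nest $\{F_n\}$. A Borel measure $\mu$ is smooth if it charges no set of zero Cap and $|\mu|(F_n)<\infty$, $n\ge1$, for some nest $\{F_n\}$; $S$ is the set of positive smooth measures. For $\mu\in S$, $A^\mu$ is the unique positive continuous additive functional of $\mathbb{X}$ in Revuz duality with $\mu$. Measurable means universally measurable. A solution of $-Au=g(u)\cdot\mu$, $u>0$, is a measurable $u:E\to[0,\infty)$ that is quasi-continuous, satisfies $0<u(x)<\infty$ for q.e. $x$, and $u(x)=E_x\int_0^\zeta g(u(X_t))\,dA^\mu_t$ for q.e. $x\in E$ (conventions $g(0)=+\infty$, $g(+\infty)=0$). *)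

theory Defs
  imports "HOL-Probability.Probability"
begin

section \<open>Dirichlet forms\<close>

text \<open>Elements of $L^2(m)$ and of the form domain are represented by Borel functions; the
  form domain is closed under, and the form invariant under, $m$-a.e. equality.\<close>

definition L2 :: "'a measure \<Rightarrow> ('a \<Rightarrow> real) set" where
  "L2 m = {f \<in> borel_measurable m. integrable m (\<lambda>x. (f x)\<^sup>2)}"

definition L2_inner :: "'a measure \<Rightarrow> ('a \<Rightarrow> real) \<Rightarrow> ('a \<Rightarrow> real) \<Rightarrow> real" where
  "L2_inner m f g = (\<integral>x. f x * g x \<partial>m)"

definition L2_norm :: "'a measure \<Rightarrow> ('a \<Rightarrow> real) \<Rightarrow> real" where
  "L2_norm m f = sqrt (L2_inner m f f)"

definition Cc :: "('a::topological_space \<Rightarrow> real) set" where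
  "Cc = {f. continuous_on UNIV f \<and> compact (closure {x. f x \<noteq> 0})}"

text \<open>Separability is expressed by \<open>second_countable_topology\<close>, to which it is equivalent for
  metric spaces. On such a locally compact space every Borel measure that is finite on compact
  sets is regular, hence Radon. The Markov property is the usual one for closed symmetric forms:
  the unit contraction operates.\<close>

locale dirichlet_form =
  fixes m :: "'a::{metric_space, second_countable_topology} measure"
    and D :: "('a \<Rightarrow> real) set"
    and \<E> :: "('a \<Rightarrow> real) \<Rightarrow> ('a \<Rightarrow> real) \<Rightarrow> real"
  assumes locally_compact_E: "locally compact (UNIV :: 'a set)"
    and sets_m: "sets m = sets borel"
    and m_compact: "\<And>K. compact K \<Longrightarrow> emeasure m K < \<infinity>"
    and m_support: "{x. \<forall>U. open U \<and> x \<in> U \<longrightarrow> emeasure m U > 0} = UNIV"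
    and D_L2: "D \<subseteq> L2 m"
    and D_cong: "\<And>u v. u \<in> D \<Longrightarrow> v \<in> borel_measurable m \<Longrightarrow> AE x in m. u x = v x \<Longrightarrow> v \<in> D"
    and form_cong: "\<And>u v w. u \<in> D \<Longrightarrow> v \<in> D \<Longrightarrow> w \<in> D \<Longrightarrow> AE x in m. u x = v x
                      \<Longrightarrow> \<E> u w = \<E> v w"
    and D_zero: "(\<lambda>x. 0) \<in> D"
    and D_add: "\<And>u v. u \<in> D \<Longrightarrow> v \<in> D \<Longrightarrow> (\<lambda>x. u x + v x) \<in> D"
    and D_scale: "\<And>c u. u \<in> D \<Longrightarrow> (\<lambda>x. c * u x) \<in> D"
    and form_add: "\<And>u v w. u \<in> D \<Longrightarrow> v \<in> D \<Longrightarrow> w \<in> D \<Longrightarrow> \<E> (\<lambda>x. u x + v x) w = \<E> u w + \<E> v w"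
    and form_scale: "\<And>c u w. u \<in> D \<Longrightarrow> w \<in> D \<Longrightarrow> \<E> (\<lambda>x. c * u x) w = c * \<E> u w"
    and form_sym: "\<And>u v. u \<in> D \<Longrightarrow> v \<in> D \<Longrightarrow> \<E> u v = \<E> v u"
    and form_nonneg: "\<And>u. u \<in> D \<Longrightarrow> 0 \<le> \<E> u u"
    and densely_defined:
      "\<And>f e. f \<in> L2 m \<Longrightarrow> 0 < e \<Longrightarrow> \<exists>u\<in>D. L2_norm m (\<lambda>x. f x - u x) < e"
    and closed_form:
      "\<And>u :: nat \<Rightarrow> 'a \<Rightarrow> real.
        (\<And>n. u n \<in> D) \<Longrightarrow>
        (\<And>e. 0 < e \<Longrightarrow> \<exists>N. \<forall>i\<ge>N. \<forall>j\<ge>N.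
           \<E> (\<lambda>x. u i x - u j x) (\<lambda>x. u i x - u j x)
           + L2_inner m (\<lambda>x. u i x - u j x) (\<lambda>x. u i x - u j x) < e) \<Longrightarrow>
        \<exists>v\<in>D. (\<lambda>n. \<E> (\<lambda>x. u n x - v x) (\<lambda>x. u n x - v x)
                   + L2_inner m (\<lambda>x. u n x - v x) (\<lambda>x. u n x - v x)) \<longlonglongrightarrow> 0"
    and markovian:
      "\<And>u. u \<in> D \<Longrightarrow> (\<lambda>x. min 1 (max 0 (u x))) \<in> D \<and>
        \<E> (\<lambda>x. min 1 (max 0 (u x))) (\<lambda>x. min 1 (max 0 (u x))) \<le> \<E> u u"
begin

definition form1 :: "('a \<Rightarrow> real) \<Rightarrow> ('a \<Rightarrow> real) \<Rightarrow> real" where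
  "form1 u v = \<E> u v + L2_inner m u v"

definition regular :: bool where
  "regular \<longleftrightarrow>
     (\<forall>u\<in>D. \<forall>e>0. \<exists>v\<in>D \<inter> Cc. sqrt (form1 (\<lambda>x. u x - v x) (\<lambda>x. u x - v x)) < e) \<and>
     (\<forall>f\<in>Cc. \<forall>e>0. \<exists>v\<in>D \<inter> Cc. \<forall>x. \<bar>f x - v x\<bar> < e)"

definition transient :: bool where
  "transient \<longleftrightarrow>
     (\<exists>g0\<in>borel_measurable m. (\<forall>x. 0 < g0 x) \<and>
        (\<forall>u\<in>D. (\<integral>\<^sup>+x. ennreal (\<bar>u x\<bar> * g0 x) \<partial>m) \<le> ennreal (sqrt (\<E> u u))))"

text \<open>\<open>generator u f\<close> says that $u \in D(A)$ and $Au = f$.\<close>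

definition generator :: "('a \<Rightarrow> real) \<Rightarrow> ('a \<Rightarrow> real) \<Rightarrow> bool" where
  "generator u f \<longleftrightarrow> u \<in> D \<and> f \<in> L2 m \<and> (\<forall>v\<in>D. \<E> u v = L2_inner m (\<lambda>x. - f x) v)"

text \<open>The strongly continuous contraction semigroup on $L^2(m)$ with infinitesimal generator
  $A$; by Hille--Yosida it exists and is unique up to $m$-a.e. equality.\<close>

definition form_semigroup :: "(real \<Rightarrow> ('a \<Rightarrow> real) \<Rightarrow> 'a \<Rightarrow> real) \<Rightarrow> bool" where
  "form_semigroup T \<longleftrightarrow>
     (\<forall>t>0. \<forall>f\<in>L2 m. T t f \<in> L2 m) \<and>
     (\<forall>t>0. \<forall>f\<in>L2 m. \<forall>g\<in>L2 m. (AE x in m. f x = g x) \<longrightarrow> (AE x in m. T t f x = T t g x)) \<and>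
     (\<forall>t>0. \<forall>f\<in>L2 m. \<forall>g\<in>L2 m. \<forall>a b.
        AE x in m. T t (\<lambda>y. a * f y + b * g y) x = a * T t f x + b * T t g x) \<and>
     (\<forall>s>0. \<forall>t>0. \<forall>f\<in>L2 m. AE x in m. T (s + t) f x = T s (T t f) x) \<and>
     (\<forall>t>0. \<forall>f\<in>L2 m. L2_norm m (T t f) \<le> L2_norm m f) \<and>
     (\<forall>f\<in>L2 m. ((\<lambda>t. L2_norm m (\<lambda>x. T t f x - f x)) \<longlongrightarrow> 0) (at_right 0)) \<and>
     (\<forall>u\<in>L2 m. \<forall>f\<in>L2 m.
        ((\<lambda>t. L2_norm m (\<lambda>x. (T t u x - u x) / t - f x)) \<longlongrightarrow> 0) (at_right 0)
          \<longleftrightarrow> generator u f)"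

text \<open>The resolvent $G_\alpha f$, determined up to $m$-a.e. equality.\<close>

definition resolvent :: "real \<Rightarrow> ('a \<Rightarrow> real) \<Rightarrow> 'a \<Rightarrow> real" where
  "resolvent \<alpha> f = (SOME u. u \<in> D \<and> (\<forall>v\<in>D. \<E> u v + \<alpha> * L2_inner m u v = L2_inner m f v))"

end

section \<open>Capacity, quasi-continuity and smooth measures\<close>

locale dirichlet_space = dirichlet_form m D \<E>
  for m :: "'a::{metric_space, second_countable_topology} measure"
    and D :: "('a \<Rightarrow> real) set"
    and \<E> :: "('a \<Rightarrow> real) \<Rightarrow> ('a \<Rightarrow> real) \<Rightarrow> real" +
  fixes \<phi> :: "'a \<Rightarrow> real"
  assumes regular: regular
    and transient: transient
    and phi_measurable: "\<phi> \<in> borel_measurable borel"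
    and phi_bounded: "bounded (range \<phi>)"
    and phi_pos: "\<And>x. 0 < \<phi> x"
    and phi_integral: "has_bochner_integral m \<phi> 1"
begin

definition h :: "'a \<Rightarrow> real" where
  "h = resolvent 1 \<phi>"

definition reduced :: "'a set \<Rightarrow> 'a \<Rightarrow> real" where
  "reduced U = (ARG_MIN (\<lambda>w. form1 w w) w. w \<in> D \<and> (AE x in m. x \<in> U \<longrightarrow> h x \<le> w x))"

definition Cap_open :: "'a set \<Rightarrow> real" where
  "Cap_open U = form1 (reduced U) (reduced U)"

definition Cap :: "'a set \<Rightarrow> real" where
  "Cap B = (INF U\<in>{U. open U \<and> B \<subseteq> U}. Cap_open U)"

definition nest :: "(nat \<Rightarrow> 'a set) \<Rightarrow> bool" where
  "nest F \<longleftrightarrow> incseq F \<and> (\<forall>n. closed (F n)) \<and> (\<lambda>n. Cap (- F n)) \<longlonglongrightarrow> 0"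

definition qe :: "('a \<Rightarrow> bool) \<Rightarrow> bool" where
  "qe Q \<longleftrightarrow> (\<exists>N. Cap N = 0 \<and> (\<forall>x. x \<notin> N \<longrightarrow> Q x))"

definition quasi_continuous :: "('a \<Rightarrow> real) \<Rightarrow> bool" where
  "quasi_continuous u \<longleftrightarrow> (\<exists>F. nest F \<and> (\<forall>n. continuous_on (F n) u))"

definition positive_smooth :: "'a measure \<Rightarrow> bool" where
  "positive_smooth \<mu> \<longleftrightarrow>
     sets \<mu> = sets borel \<and>
     (\<forall>B\<in>sets borel. Cap B = 0 \<longrightarrow> emeasure \<mu> B = 0) \<and>
     (\<exists>F. nest F \<and> (\<forall>n. emeasure \<mu> (F n) < \<infinity>))"

end

section \<open>Hunt processes\<close>

text \<open>The cemetery is \<open>None\<close>, adjoined to $E$ as the point at infinity (as an isolated point if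
  $E$ is compact). The time set is $[0,\infty]$ with $X_\infty = \partial$. The sample space is the
  whole type \<open>'w\<close>, and the laws $P_x$ live on $\mathcal{F}^0_\infty = \sigma(X_s; s \ge 0)$.\<close>

definition cemetery_topology :: "'a::topological_space option topology" where
  "cemetery_topology = Alexandroff_compactification euclidean"

definition cemetery_borel :: "'a::topological_space option measure" where
  "cemetery_borel = sigma UNIV {U. openin cemetery_topology U}"

definition natural_filtration ::
    "(ennreal \<Rightarrow> 'w \<Rightarrow> 'a::topological_space option) \<Rightarrow> ennreal \<Rightarrow> 'w measure" where
  "natural_filtration X t = sigma UNIV {X s -` B | s B. s \<le> t \<and> B \<in> sets cemetery_borel}"

text \<open>The minimum completed admissible filtration: $\mathcal{F}^0_t$ is augmented by the
  $P_\nu$-null sets of the $P_\nu$-completion of $\mathcal{F}^0_\infty$, and the result is intersected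
  over all initial laws $\nu$ on $E \cup \{\partial\}$. Here $P_\nu$ is \<open>\<nu> \<bind> P\<close>.\<close>

definition completed_filtration ::
    "(ennreal \<Rightarrow> 'w \<Rightarrow> 'a::topological_space option) \<Rightarrow> ('a option \<Rightarrow> 'w measure)
       \<Rightarrow> ennreal \<Rightarrow> 'w measure" where
  "completed_filtration X P t = sigma UNIV
     {\<Lambda>. \<forall>\<nu>\<in>space (prob_algebra cemetery_borel). \<exists>\<Lambda>'\<in>sets (natural_filtration X t).
           (\<Lambda> - \<Lambda>') \<union> (\<Lambda>' - \<Lambda>) \<in> null_sets (completion (\<nu> \<bind> P))}"

definition lifetime :: "(ennreal \<Rightarrow> 'w \<Rightarrow> 'a option) \<Rightarrow> 'w \<Rightarrow> ennreal" where
  "lifetime X \<omega> = Inf {t. X t \<omega> = None}"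

locale hunt_process =
  fixes X :: "ennreal \<Rightarrow> 'w \<Rightarrow> 'a::{metric_space, second_countable_topology} option"
    and \<theta> :: "ennreal \<Rightarrow> 'w \<Rightarrow> 'w"
    and P :: "'a option \<Rightarrow> 'w measure"
  assumes kernel: "P \<in> cemetery_borel \<rightarrow>\<^sub>M prob_algebra (natural_filtration X \<infinity>)"
    and normal: "\<And>x. AE \<omega> in P x. X 0 \<omega> = x"
    and X_infinity: "\<And>\<omega>. X \<infinity> \<omega> = None"
    and absorbing: "\<And>t \<omega>. lifetime X \<omega> \<le> t \<Longrightarrow> X t \<omega> = None"
    and shift: "\<And>s t \<omega>. X s (\<theta> t \<omega>) = X (t + s) \<omega>"
    and right_continuous:
      "\<And>t \<omega>. t < \<infinity> \<Longrightarrow> limitin cemetery_topology (\<lambda>s. X s \<omega>) (X t \<omega>) (at_right t)"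
    and left_limits:
      "\<And>t \<omega>. 0 < t \<Longrightarrow> t < \<infinity> \<Longrightarrow> \<exists>y. limitin cemetery_topology (\<lambda>s. X s \<omega>) y (at_left t)"
    and filtration_right_continuous:
      "\<And>t. t < \<infinity> \<Longrightarrow>
        sets (completed_filtration X P t) = (\<Inter>s\<in>{t<..}. sets (completed_filtration X P s))"
    and strong_markov:
      "\<And>\<nu> T s B. \<nu> \<in> space (prob_algebra cemetery_borel) \<Longrightarrow>
        stopping_time (completed_filtration X P) T \<Longrightarrow> B \<in> sets cemetery_borel \<Longrightarrow>
        AE \<omega> in completion (\<nu> \<bind> P).
          nn_cond_exp (completion (\<nu> \<bind> P)) (filtration.pre_sigma UNIV (completed_filtration X P) T)
            (indicator {\<omega>. X (T \<omega> + s) \<omega> \<in> B}) \<omega>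
          = emeasure (P (X (T \<omega>) \<omega>)) {\<omega>'. X s \<omega>' \<in> B}"
    and quasi_left_continuous:
      "\<And>\<nu> T S. \<nu> \<in> space (prob_algebra cemetery_borel) \<Longrightarrow>
        (\<And>n::nat. stopping_time (completed_filtration X P) (T n)) \<Longrightarrow>
        (\<And>\<omega>. incseq (\<lambda>n. T n \<omega>)) \<Longrightarrow> (\<And>\<omega>. S \<omega> = (SUP n. T n \<omega>)) \<Longrightarrow>
        AE \<omega> in completion (\<nu> \<bind> P). S \<omega> < \<infinity> \<longrightarrow>
          limitin cemetery_topology (\<lambda>n. X (T n \<omega>) \<omega>) (X (S \<omega>) \<omega>) sequentially"
begin

text \<open>The completion makes every $\mathcal{F}_\infty$-measurable function measurable under $P_x$.\<close>

definition expect :: "'a \<Rightarrow> ('w \<Rightarrow> ennreal) \<Rightarrow> ennreal" where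
  "expect x f = (\<integral>\<^sup>+\<omega>. f \<omega> \<partial>completion (P (Some x)))"

end

section \<open>Additive functionals and the equation\<close>

text \<open>$\int_0^z f(s)\,da_s$ for \<open>a\<close> continuous, nondecreasing, null at $0$ and finite on $[0,z)$,
  but possibly unbounded as $s$ increases to $z$; hence the truncation at \<open>r < z\<close>.\<close>

definition stieltjes :: "(ennreal \<Rightarrow> ennreal) \<Rightarrow> ennreal \<Rightarrow> (real \<Rightarrow> ennreal) \<Rightarrow> ennreal" where
  "stieltjes a z f =
     (SUP r\<in>{r. 0 \<le> r \<and> ennreal r < z}.
        \<integral>\<^sup>+s\<in>{0<..r}. f s \<partial>interval_measure (\<lambda>s. enn2real (a (ennreal (min s r)))))"

definition universal_borel :: "'a::topological_space measure" where
  "universal_borel = sigma UNIV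
     {B. \<forall>\<kappa>. sets \<kappa> = sets borel \<and> finite_measure \<kappa> \<longrightarrow> B \<in> sets (completion \<kappa>)}"

text \<open>The extension of $g : (0,\infty) \to [0,\infty)$ by $g(0) = \infty$ and $g(\infty) = 0$.\<close>

definition g_ext :: "(real \<Rightarrow> real) \<Rightarrow> ennreal \<Rightarrow> ennreal" where
  "g_ext g y = (if y = 0 then \<infinity> else if y = \<infinity> then 0 else ennreal (g (enn2real y)))"

locale dirichlet_hunt = dirichlet_space m D \<E> \<phi> + hunt_process X \<theta> P
  for m :: "'a::{metric_space, second_countable_topology} measure"
    and D :: "('a \<Rightarrow> real) set"
    and \<E> :: "('a \<Rightarrow> real) \<Rightarrow> ('a \<Rightarrow> real) \<Rightarrow> real"
    and \<phi> :: "'a \<Rightarrow> real"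
    and X :: "ennreal \<Rightarrow> 'w \<Rightarrow> 'a option"
    and \<theta> :: "ennreal \<Rightarrow> 'w \<Rightarrow> 'w"
    and P :: "'a option \<Rightarrow> 'w measure" +
  assumes associated:
    "\<exists>T. form_semigroup T \<and>
       (\<forall>t>0. \<forall>f\<in>L2 m. AE x in m.
          (\<integral>\<omega>. case_option 0 f (X (ennreal t) \<omega>) \<partial>P (Some x)) = T t f x)"
begin

definition pcaf :: "(ennreal \<Rightarrow> 'w \<Rightarrow> ennreal) \<Rightarrow> bool" where
  "pcaf A \<longleftrightarrow>
     (\<forall>t<\<infinity>. A t \<in> borel_measurable (completed_filtration X P t)) \<and>
     (\<exists>\<Lambda>\<in>sets (completed_filtration X P \<infinity>).
        qe (\<lambda>x. emeasure (completion (P (Some x))) \<Lambda> = 1) \<and>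
        (\<forall>t. 0 < t \<and> t < \<infinity> \<longrightarrow> \<theta> t ` \<Lambda> \<subseteq> \<Lambda>) \<and>
        (\<forall>\<omega>\<in>\<Lambda>.
           A 0 \<omega> = 0 \<and>
           continuous_on {..<\<infinity>} (\<lambda>t. A t \<omega>) \<and>
           (\<forall>t<lifetime X \<omega>. A t \<omega> < \<infinity>) \<and>
           (\<forall>t<\<infinity>. lifetime X \<omega> \<le> t \<longrightarrow> A t \<omega> = A (lifetime X \<omega>) \<omega>) \<and>
           (\<forall>s<\<infinity>. \<forall>t<\<infinity>. A (s + t) \<omega> = A s \<omega> + A t (\<theta> s \<omega>))))"

text \<open>The Revuz correspondence
  $\lim_{t \downarrow 0} \frac1t E_m \int_0^t f(X_s)\,dA_s = \int f\,d\mu$ for Borel $f \ge 0$.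
  Since $A$ is constant after the lifetime and functions vanish at the cemetery, $\int_0^t$ may be
  taken over $[0, t \wedge \zeta)$.\<close>

definition revuz :: "(ennreal \<Rightarrow> 'w \<Rightarrow> ennreal) \<Rightarrow> 'a measure \<Rightarrow> bool" where
  "revuz A \<mu> \<longleftrightarrow>
     (\<forall>f\<in>borel_measurable borel.
        ((\<lambda>t. (\<integral>\<^sup>+x. expect x (\<lambda>\<omega>. stieltjes (\<lambda>s. A s \<omega>) (min (ennreal t) (lifetime X \<omega>))
                        (\<lambda>s. case_option 0 f (X (ennreal s) \<omega>))) \<partial>m) / ennreal t)
          \<longlongrightarrow> (\<integral>\<^sup>+x. f x \<partial>\<mu>)) (at_right 0))"

text \<open>A solution of $-Au = g(u)\cdot\mu$, $u > 0$, where \<open>A\<close> is the functional $A^\mu$.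
  That $u < \infty$ is built into the type.\<close>

definition solution ::
    "(ennreal \<Rightarrow> 'w \<Rightarrow> ennreal) \<Rightarrow> (real \<Rightarrow> real) \<Rightarrow> ('a \<Rightarrow> real) \<Rightarrow> bool" where
  "solution A g u \<longleftrightarrow>
     u \<in> borel_measurable universal_borel \<and> (\<forall>x. 0 \<le> u x) \<and>
     quasi_continuous u \<and> qe (\<lambda>x. 0 < u x) \<and>
     qe (\<lambda>x. ennreal (u x) = expect x (\<lambda>\<omega>.
           stieltjes (\<lambda>s. A s \<omega>) (lifetime X \<omega>)
             (\<lambda>s. g_ext g (ennreal (case_option 0 u (X (ennreal s) \<omega>))))))"

end

end

theory Submission
  imports Defs
begin

text \<open>Write \<open>u(x) = E\<^sub>x \<integral>\<^sub>0\<^sup>\<zeta> g(u(X\<^sub>t)) dA\<^sub>t\<close> and the same for \<open>v\<close>, and cut both integrals at the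
  first visit of \<open>B = {u \<le> v}\<close>. Before that visit \<open>u(X\<^sub>t) \<ge> v(X\<^sub>t)\<close>, so \<open>g(u(X\<^sub>t)) \<le> g(v(X\<^sub>t))\<close> because
  \<open>g\<close> is nonincreasing. By the Markov property the part after the visit has expectation \<open>E\<^sub>x u(X\<^sub>\<sigma>)\<close>
  for \<open>u\<close> and \<open>E\<^sub>x v(X\<^sub>\<sigma>)\<close> for \<open>v\<close>, and \<open>u(X\<^sub>\<sigma>) \<le> v(X\<^sub>\<sigma>)\<close> by the choice of \<open>B\<close>. Adding the two
  inequalities gives \<open>u(x) \<le> v(x)\<close>; there is no subtraction, so infinite values do no harm. By symmetry
  \<open>u = v\<close>, first \<open>m\<close>-almost everywhere, and then quasi-everywhere by quasi-continuity
  (\<open>AE_eq_imp_qe_eq\<close>). The two inequalities are \<open>clock_integral_after_mono\<close> and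
  \<open>clock_integral_before_mono\<close>.

  Only \<open>m\<close>-almost every starting point is considered. This is consistent, since for \<open>t > 0\<close> the law of
  \<open>X\<^sub>t\<close> does not charge \<open>m\<close>-null sets (\<open>AE_law\<close>). Visits of \<open>B\<close> are recorded at rational times only: for
  finitely many times the Markov property at fixed times suffices, by induction on the set of times, and
  monotone convergence reaches all rational times. Before the first rational visit \<open>u(X\<^sub>t) \<ge> v(X\<^sub>t)\<close> then
  holds at all times, because \<open>t \<mapsto> u(X\<^sub>t)\<close> and \<open>t \<mapsto> v(X\<^sub>t)\<close> are right continuous on \<open>[0, \<zeta>)\<close>.

  This right continuity, for almost every path, is where potential theory enters. A quasi-continuous function is continuous off open
  sets \<open>U\<^sub>n\<close> whose capacity tends to \<open>0\<close>, so it is enough that almost every path stays off some \<open>U\<^sub>n\<close> up to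
  any time before \<open>\<zeta>\<close> (\<open>path_avoids\<close>). The reduced function \<open>h\<^sub>U\<close> of \<open>h = G\<^sub>1\<phi>\<close> has \<open>\<E>\<^sub>1(h\<^sub>U, w) \<ge> 0\<close> for
  \<open>w \<ge> 0\<close>, hence is excessive (\<open>superharmonic_excessive\<close>), and \<open>h\<^sub>U \<ge> h\<close> on \<open>U\<close>; so it dominates
  \<open>E\<^sub>x \<integral>\<^sub>\<sigma>\<^sup>\<infinity> e\<^sup>-\<^sup>s \<phi>(X\<^sub>s) ds\<close>, with \<open>\<sigma>\<close> the first visit of \<open>U\<close>. Along \<open>U\<^sub>n\<close> the reduced functions tend to
  \<open>0\<close> in \<open>L\<^sup>2\<close>, and \<open>\<phi> > 0\<close> forces the visits to exhaust the lifetime.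

  The process and the form are linked by \<open>rpot_form\<close>: the potentials \<open>E\<^sub>x \<integral>\<^sub>0\<^sup>\<infinity> e\<^sup>-\<^sup>\<beta>\<^sup>s f(X\<^sub>s) ds\<close> solve the
  resolvent equation of \<open>\<E>\<close>. Stieltjes integrals against \<open>A\<close> become Lebesgue integrals through the inverse of
  the clock \<open>t \<mapsto> A\<^sub>t\<close>, which makes measurability and the additivity of \<open>A\<close> transparent.\<close>

section \<open>The Markov property\<close>

context hunt_process
begin

abbreviation natural_events :: "'w measure" where
  "natural_events \<equiv> natural_filtration X \<top>"

lemma space_natural [simp]: "space (natural_filtration X t) = UNIV"
  by (simp add: natural_filtration_def)

lemma sets_natural:
  "sets (natural_filtration X t) = sigma_sets UNIV {X s -` B | s B. s \<le> t \<and> B \<in> sets cemetery_borel}"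
  by (simp add: natural_filtration_def)

lemma sets_natural_mono:
  assumes "s \<le> t"
  shows "sets (natural_filtration X s) \<subseteq> sets (natural_filtration X t)"
  unfolding sets_natural using assms by (intro sigma_sets_mono') (auto intro: order_trans)

lemma space_cemetery_borel [simp]: "space (cemetery_borel :: 'a option measure) = UNIV"
  by (simp add: cemetery_borel_def)

lemma measurable_X: "s \<le> t \<Longrightarrow> X s \<in> natural_filtration X t \<rightarrow>\<^sub>M cemetery_borel"
  by (rule measurableI) (auto simp: sets_natural)

lemma measurable_X_events [measurable]: "X s \<in> natural_events \<rightarrow>\<^sub>M cemetery_borel"
  by (rule measurable_X) simp

lemma sets_P [measurable_cong, simp]: "sets (P x) = sets natural_events"
  and prob_space_P: "prob_space (P x)"
  using measurable_space[OF kernel[simplified], of x] by (auto simp: space_prob_algebra)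

lemma space_P [simp]: "space (P x) = UNIV"
  using sets_eq_imp_space_eq[OF sets_P] by simp

lemma kernel_subprob [measurable]: "P \<in> cemetery_borel \<rightarrow>\<^sub>M subprob_algebra natural_events"
  by (rule measurable_prob_algebraD[OF kernel[simplified]])

lemma bind_point_mass: "return cemetery_borel x \<bind> P = P x"
  by (rule bind_return[OF kernel_subprob]) simp

lemma point_mass_law: "return cemetery_borel (x :: 'a option) \<in> space (prob_algebra cemetery_borel)"
  using prob_space_return[of x cemetery_borel] by (simp add: space_prob_algebra)

lemma sets_bind_P:
  assumes "\<nu> \<in> space (prob_algebra cemetery_borel)"
  shows "sets (\<nu> \<bind> P) = sets natural_events"
proof (rule sets_bind)
  show "sets (P x) = sets natural_events" if "x \<in> space \<nu>" for x by simp
  show "space \<nu> \<noteq> {}"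
    using assms by (auto simp: space_prob_algebra dest: prob_space.not_empty)
qed

lemma space_bind_P:
  assumes "\<nu> \<in> space (prob_algebra cemetery_borel)"
  shows "space (\<nu> \<bind> P) = UNIV"
  using sets_eq_imp_space_eq[OF sets_bind_P[OF assms]] by simp

text \<open>Every set of the completed filtration is measurable for the completion of every law \<open>\<nu> \<bind> P\<close>. This is how
  functionals adapted to the completed filtration, such as \<open>A\<close>, enter integrals with respect to \<open>P\<^sub>x\<close>.\<close>

lemma completed_le_completion:
  assumes \<nu>: "\<nu> \<in> space (prob_algebra cemetery_borel)"
  shows "sets (completed_filtration X P t) \<subseteq> sets (completion (\<nu> \<bind> P))"
proof -
  let ?C = "completion (\<nu> \<bind> P)"
  have "\<Lambda> \<in> sets ?C" if "\<Lambda>' \<in> sets (natural_filtration X t)"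
    "(\<Lambda> - \<Lambda>') \<union> (\<Lambda>' - \<Lambda>) \<in> null_sets ?C" for \<Lambda> \<Lambda>'
  proof -
    have 1: "\<Lambda>' \<in> sets ?C"
      using that(1) sets_natural_mono[of t \<top>] sets_bind_P[OF \<nu>] by (auto simp: sets_completionI_sets)
    have 2: "\<Lambda> - \<Lambda>' \<in> sets ?C" "\<Lambda>' - \<Lambda> \<in> sets ?C"
      using null_sets_completion_subset[OF _ that(2)] by auto
    have "\<Lambda> = (\<Lambda>' - (\<Lambda>' - \<Lambda>)) \<union> (\<Lambda> - \<Lambda>')" by auto
    then show ?thesis using 1 2 by (metis sets.Diff sets.Un)
  qed
  then have "{\<Lambda>. \<forall>\<nu>\<in>space (prob_algebra cemetery_borel). \<exists>\<Lambda>'\<in>sets (natural_filtration X t).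
           (\<Lambda> - \<Lambda>') \<union> (\<Lambda>' - \<Lambda>) \<in> null_sets (completion (\<nu> \<bind> P))} \<subseteq> sets ?C"
    using \<nu> by blast
  then have "sigma_sets UNIV {\<Lambda>. \<forall>\<nu>\<in>space (prob_algebra cemetery_borel). \<exists>\<Lambda>'\<in>sets (natural_filtration X t).
           (\<Lambda> - \<Lambda>') \<union> (\<Lambda>' - \<Lambda>) \<in> null_sets (completion (\<nu> \<bind> P))} \<subseteq> sets ?C"
    using sets.sigma_sets_subset[of _ ?C] by (simp add: space_bind_P[OF \<nu>])
  then show ?thesis by (simp add: completed_filtration_def)
qed

lemma space_completed [simp]: "space (completed_filtration X P t) = UNIV"
  by (simp add: completed_filtration_def)

lemma natural_le_completed: "sets (natural_filtration X t) \<subseteq> sets (completed_filtration X P t)"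
proof
  fix \<Lambda> assume "\<Lambda> \<in> sets (natural_filtration X t)"
  then have "\<exists>\<Lambda>'\<in>sets (natural_filtration X t). (\<Lambda> - \<Lambda>') \<union> (\<Lambda>' - \<Lambda>) \<in> null_sets (completion (\<nu> \<bind> P))" for \<nu>
    by (intro bexI[of _ \<Lambda>]) auto
  then show "\<Lambda> \<in> sets (completed_filtration X P t)"
    by (auto simp: completed_filtration_def intro!: sigma_sets.Basic)
qed

lemma completed_mono:
  assumes "s \<le> t"
  shows "sets (completed_filtration X P s) \<subseteq> sets (completed_filtration X P t)"
proof -
  have "{\<Lambda>. \<forall>\<nu>\<in>space (prob_algebra cemetery_borel). \<exists>\<Lambda>'\<in>sets (natural_filtration X s).
           (\<Lambda> - \<Lambda>') \<union> (\<Lambda>' - \<Lambda>) \<in> null_sets (completion (\<nu> \<bind> P))}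
      \<subseteq> {\<Lambda>. \<forall>\<nu>\<in>space (prob_algebra cemetery_borel). \<exists>\<Lambda>'\<in>sets (natural_filtration X t).
           (\<Lambda> - \<Lambda>') \<union> (\<Lambda>' - \<Lambda>) \<in> null_sets (completion (\<nu> \<bind> P))}"
    using sets_natural_mono[OF assms] by blast
  then show ?thesis
    unfolding completed_filtration_def by (simp add: sigma_sets_mono')
qed

lemma filtration_completed: "filtration UNIV (completed_filtration X P)"
  using completed_mono by (unfold_locales) auto

lemma markov_one_time:
  assumes \<Gamma>: "\<Gamma> \<in> sets (natural_filtration X t)" and B: "B \<in> sets cemetery_borel"
  shows "emeasure (P x) (\<Gamma> \<inter> X (t + s) -` B)
       = (\<integral>\<^sup>+\<omega>. indicator \<Gamma> \<omega> * emeasure (P (X t \<omega>)) (X s -` B) \<partial>P x)"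
proof -
  interpret filtration UNIV "completed_filtration X P" by (rule filtration_completed)
  let ?C = "completion (P x)" and ?G = "pre_sigma (\<lambda>_. t)"
  have st: "stopping_time (completed_filtration X P) (\<lambda>_. t)" by (rule stopping_time_const)
  have C: "sets (completed_filtration X P r) \<subseteq> sets ?C" for r
    using completed_le_completion[OF point_mass_law] by (simp add: bind_point_mass)
  have "sets ?G \<subseteq> sets ?C"
  proof
    fix A assume "A \<in> sets ?G"
    then have "{\<omega>\<in>A. t \<le> t} \<in> sets (completed_filtration X P t)"
      by (rule sets_pre_sigmaD[OF st])
    then show "A \<in> sets ?C" using C by auto
  qed
  then have sub: "subalgebra ?C ?G" by (simp add: subalgebra_def space_pre_sigma)
  interpret C: prob_space ?C using prob_space_P by (simp add: prob_space.prob_space_completion)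
  interpret finite_measure_subalgebra ?C ?G by unfold_locales (rule sub)
  have \<Gamma>G: "\<Gamma> \<in> sets ?G"
  proof (rule sets_pre_sigmaI[OF st])
    fix r show "{\<omega> \<in> \<Gamma>. t \<le> r} \<in> sets (completed_filtration X P r)"
      using \<Gamma> natural_le_completed[of t] completed_mono[of t r] by (cases "t \<le> r") auto
  qed
  have m1: "X (t + s) -` B \<in> sets natural_events" 
    using measurable_sets[OF measurable_X_events B] by simp
  have \<Gamma>': "\<Gamma> \<in> sets natural_events" using \<Gamma> sets_natural_mono[of t \<top>] by auto
  have [measurable]: "X (t + s) -` B \<in> sets ?C" "\<Gamma> \<in> sets ?C"
    using m1 \<Gamma>' by (auto intro: sets_completionI_sets)
  have sm: "AE \<omega> in ?C. nn_cond_exp ?C ?G (indicator {\<omega>. X (t + s) \<omega> \<in> B}) \<omega>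
          = emeasure (P (X t \<omega>)) {\<omega>'. X s \<omega>' \<in> B}"
    using strong_markov[OF point_mass_law st B, of x s] unfolding bind_point_mass .
  have ind_eq: "(indicator \<Gamma> \<omega> * indicator {\<omega>. X (t + s) \<omega> \<in> B} \<omega> :: ennreal) = indicator (\<Gamma> \<inter> X (t + s) -` B) \<omega>" for \<omega>
    by (simp add: indicator_def)
  have "emeasure (P x) (\<Gamma> \<inter> X (t + s) -` B) = emeasure ?C (\<Gamma> \<inter> X (t + s) -` B)"
    using m1 \<Gamma>' by simp
  also have "\<dots> = (\<integral>\<^sup>+\<omega>. indicator \<Gamma> \<omega> * indicator {\<omega>. X (t + s) \<omega> \<in> B} \<omega> \<partial>?C)"
    by (subst nn_integral_indicator[symmetric])
       (simp_all del: nn_integral_indicator add: ind_eq)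
  also have "\<dots> = (\<integral>\<^sup>+\<omega>. indicator \<Gamma> \<omega> * nn_cond_exp ?C ?G (indicator {\<omega>. X (t + s) \<omega> \<in> B}) \<omega> \<partial>?C)"
    using \<Gamma>G by (intro nn_cond_exp_intg[symmetric]) (auto simp: vimage_def[symmetric])
  also have "\<dots> = (\<integral>\<^sup>+\<omega>. indicator \<Gamma> \<omega> * emeasure (P (X t \<omega>)) (X s -` B) \<partial>?C)"
    using sm by (intro nn_integral_cong_AE) (auto simp: vimage_def)
  finally show ?thesis by (simp add: nn_integral_completion)
qed

lemma measurable_emeasure_P [measurable]:
  "A \<in> sets natural_events \<Longrightarrow> (\<lambda>y. emeasure (P y) A) \<in> borel_measurable cemetery_borel"
  by (rule measurable_emeasure_kernel[OF kernel_subprob])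

lemma markov_one_time_fun:
  assumes \<Gamma>: "\<Gamma> \<in> sets (natural_filtration X t)" and k: "k \<in> borel_measurable cemetery_borel"
  shows "(\<integral>\<^sup>+\<omega>. indicator \<Gamma> \<omega> * k (X (t + s) \<omega>) \<partial>P x)
       = (\<integral>\<^sup>+\<omega>. indicator \<Gamma> \<omega> * (\<integral>\<^sup>+\<omega>'. k (X s \<omega>') \<partial>P (X t \<omega>)) \<partial>P x)"
proof -
  have \<Gamma>'[measurable]: "\<Gamma> \<in> sets natural_events" using \<Gamma> sets_natural_mono[of t \<top>] by auto
  have [measurable]: "(\<lambda>\<omega>. \<integral>\<^sup>+\<omega>'. k (X s \<omega>') \<partial>P (X t \<omega>)) \<in> borel_measurable natural_events" 
     if [measurable]: "k \<in> borel_measurable cemetery_borel" for k :: "'a option \<Rightarrow> ennreal"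
    by (rule nn_integral_measurable_subprob_algebra2[where N=natural_events]) measurable
  show ?thesis using k
  proof (induction rule: borel_measurable_induct)
    case (cong f g)
    then show ?case by (simp cong: nn_integral_cong)
  next
    case (set B)
    then have [measurable]: "X r -` B \<in> sets natural_events" for r
      using measurable_sets[OF measurable_X_events, of B r] by simp
    have ind_eq: "(indicator \<Gamma> \<omega> * indicator B (X (t + s) \<omega>) :: ennreal) = indicator (\<Gamma> \<inter> X (t + s) -` B) \<omega>" for \<omega>
      by (simp add: indicator_def)
    have "\<Gamma> \<inter> X (t + s) -` B \<in> sets natural_events" by measurable
    then have "(\<integral>\<^sup>+\<omega>. indicator \<Gamma> \<omega> * indicator B (X (t + s) \<omega>) \<partial>P x) = emeasure (P x) (\<Gamma> \<inter> X (t + s) -` B)"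
      by (simp add: ind_eq)
    moreover have "(indicator B (X s \<omega>) :: ennreal) = indicator (X s -` B) \<omega>" for \<omega>
      by (simp add: indicator_def)
    then have "(\<integral>\<^sup>+\<omega>'. indicator B (X s \<omega>') \<partial>P y) = emeasure (P y) (X s -` B)" for y
      by simp
    ultimately show ?case using markov_one_time[OF \<Gamma> set] by simp
  next
    case (mult u c)
    note [measurable] = mult(2)
    show ?case using mult
      by (simp add: nn_integral_cmult mult.left_commute)
  next
    case (add u v)
    note [measurable] = add(1) add(4)
    show ?case using add
      by (simp add: nn_integral_add distrib_left)
  next
    case (seq U)
    note [measurable] = seq(1)
    have 1: "(\<integral>\<^sup>+\<omega>'. (SUP i. U i (X s \<omega>')) \<partial>P y) = (SUP i. \<integral>\<^sup>+\<omega>'. U i (X s \<omega>') \<partial>P y)" for y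
      using seq by (intro nn_integral_monotone_convergence_SUP) (auto simp: incseq_def le_fun_def)
    have inc: "incseq (\<lambda>i. \<integral>\<^sup>+\<omega>'. U i (X s \<omega>') \<partial>P y)" for y
      using seq by (auto simp: incseq_def le_fun_def intro!: nn_integral_mono)
    have "(\<integral>\<^sup>+\<omega>. indicator \<Gamma> \<omega> * (SUP i. U i) (X (t + s) \<omega>) \<partial>P x) =
       (SUP i. \<integral>\<^sup>+\<omega>. indicator \<Gamma> \<omega> * U i (X (t + s) \<omega>) \<partial>P x)"
      using seq
      by (subst nn_integral_monotone_convergence_SUP[symmetric])
         (auto simp: incseq_def le_fun_def SUP_mult_left_ennreal image_comp intro!: mult_left_mono)
    also have "\<dots> = (SUP i. \<integral>\<^sup>+\<omega>. indicator \<Gamma> \<omega> * (\<integral>\<^sup>+\<omega>'. U i (X s \<omega>') \<partial>P (X t \<omega>)) \<partial>P x)"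
      using seq by simp
    also have "\<dots> = (\<integral>\<^sup>+\<omega>. (SUP i. indicator \<Gamma> \<omega> * (\<integral>\<^sup>+\<omega>'. U i (X s \<omega>') \<partial>P (X t \<omega>))) \<partial>P x)"
      using inc
      by (subst nn_integral_monotone_convergence_SUP)
         (auto simp: incseq_def le_fun_def intro!: mult_left_mono)
    also have "\<dots> = (\<integral>\<^sup>+\<omega>. indicator \<Gamma> \<omega> * (\<integral>\<^sup>+\<omega>'. (SUP i. U i) (X s \<omega>') \<partial>P (X t \<omega>)) \<partial>P x)"
      using 1 by (simp add: SUP_mult_left_ennreal image_comp)
    finally show ?case .
  qed
qed


text \<open>Indexing by sets of times, and not by ordered lists, makes these events stable under intersection.\<close>

definition cylinder :: "ennreal set \<Rightarrow> (ennreal \<Rightarrow> 'a option set) \<Rightarrow> 'w set" where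
  "cylinder K B = {\<omega>. \<forall>s\<in>K. X s \<omega> \<in> B s}"

lemma sets_cylinder [measurable]:
  assumes "finite K" "\<And>s. B s \<in> sets cemetery_borel"
  shows "cylinder K B \<in> sets natural_events"
proof -
  have "cylinder K B = (\<Inter>s\<in>K. X s -` B s) \<inter> space natural_events" by (auto simp: cylinder_def)
  also have "\<dots> \<in> sets natural_events"
  proof -
    have "X s -` B s \<in> sets natural_events" for s
      using measurable_sets[OF measurable_X_events assms(2)] by simp
    then have "K \<noteq> {} \<Longrightarrow> (\<Inter>s\<in>K. X s -` B s) \<in> sets natural_events"
      using assms(1) by (intro sets.finite_INT) auto
    then show ?thesis by (cases "K = {}") (simp_all del: space_natural add: sets.Int)
  qed
  finally show ?thesis .
qed

text \<open>Induction on the number of times: condition at the smallest time \<open>s\<^sub>0\<close> of \<open>K\<close>, where the remaining times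
  become the cylinder over \<open>K - s\<^sub>0\<close>, and integrate out \<open>X\<close> at \<open>s\<^sub>0\<close> by the one-time Markov property.\<close>

lemma markov_cylinder:
  assumes "finite K" "\<And>s. B s \<in> sets cemetery_borel" "\<Gamma> \<in> sets (natural_filtration X t)"
  shows "emeasure (P x) (\<Gamma> \<inter> {\<omega>. \<forall>s\<in>K. X (t + s) \<omega> \<in> B s})
       = (\<integral>\<^sup>+\<omega>. indicator \<Gamma> \<omega> * emeasure (P (X t \<omega>)) (cylinder K B) \<partial>P x)"
  using assms
proof (induction "card K" arbitrary: K B \<Gamma> t x)
  case 0
  then have [simp]: "K = {}" by simp
  have [measurable]: "\<Gamma> \<in> sets natural_events" using 0(4) sets_natural_mono[of t \<top>] by auto
  have "emeasure (P y) UNIV = 1" for y using prob_space.emeasure_space_1[OF prob_space_P[of y]] by simp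
  then show ?case by (simp add: cylinder_def)
next
  case (Suc n)
  define s0 where "s0 = Min K"
  define K' where "K' = (\<lambda>s. s - s0) ` (K - {s0})"
  have fin: "finite K" and "K \<noteq> {}" using Suc by auto
  then have s0: "s0 \<in> K" and s0_le: "\<And>s. s \<in> K \<Longrightarrow> s0 \<le> s" by (auto simp: s0_def)
  have fin': "finite K'" using fin by (simp add: K'_def)
  have add: "s0 + (s - s0) = s" if "s \<in> K" for s
    using s0_le[OF that] by (metis add.commute diff_add_cancel_ennreal)
  have "inj_on (\<lambda>s. s - s0) (K - {s0})"
    by (rule inj_on_inverseI[where g="\<lambda>s. s0 + s"]) (auto simp: add)
  then have card: "n = card K'" using Suc(2) s0 fin by (simp add: K'_def card_image)
  define B' where "B' = (\<lambda>s. B (s0 + s))"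
  have B': "B' s \<in> sets cemetery_borel" for s using Suc by (simp add: B'_def)
  have K_iff: "(\<forall>s\<in>K. Q s) \<longleftrightarrow> Q s0 \<and> (\<forall>s\<in>K'. Q (s0 + s))" for Q
  proof -
    have "(\<forall>s\<in>K'. Q (s0 + s)) \<longleftrightarrow> (\<forall>s\<in>K - {s0}. Q s)" by (simp add: K'_def add)
    then show ?thesis using s0 by blast
  qed
  have split: "\<Gamma>' \<inter> {\<omega>. \<forall>s\<in>K. X (r + s) \<omega> \<in> B s}
     = (\<Gamma>' \<inter> X (r + s0) -` B s0) \<inter> {\<omega>. \<forall>s\<in>K'. X ((r + s0) + s) \<omega> \<in> B' s}" for r \<Gamma>'
    unfolding K_iff by (auto simp: B'_def add.assoc)
  define k where "k = (\<lambda>z. indicator (B s0) z * emeasure (P z) (cylinder K' B'))"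
  have cyl [measurable]: "cylinder K' B' \<in> sets natural_events" by (rule sets_cylinder[OF fin' B'])
  have [measurable]: "B s0 \<in> sets cemetery_borel" by (rule Suc)
  have k [measurable]: "k \<in> borel_measurable cemetery_borel" unfolding k_def by measurable
  have step: "emeasure (P y) (\<Gamma>' \<inter> {\<omega>. \<forall>s\<in>K. X (r + s) \<omega> \<in> B s})
      = (\<integral>\<^sup>+\<omega>. indicator \<Gamma>' \<omega> * k (X (r + s0) \<omega>) \<partial>P y)"
    if \<Gamma>': "\<Gamma>' \<in> sets (natural_filtration X r)" for \<Gamma>' r y
  proof -
    have 1: "X (r + s0) -` B s0 \<in> sets (natural_filtration X (r + s0))"
      using measurable_sets[OF measurable_X[of "r + s0" "r + s0"] Suc(4)[of s0]] by simp
    have 2: "\<Gamma>' \<inter> X (r + s0) -` B s0 \<in> sets (natural_filtration X (r + s0))"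
      using 1 \<Gamma>' sets_natural_mono[of r "r + s0"] by (intro sets.Int) auto
    show ?thesis unfolding split Suc(1)[OF card fin' B' 2]
      by (intro nn_integral_cong) (auto simp: k_def indicator_def)
  qed
  have "emeasure (P y) (cylinder K B) = (\<integral>\<^sup>+\<omega>. k (X s0 \<omega>) \<partial>P y)" for y
    using step[of UNIV 0 y] sets.top[of "natural_filtration X 0"] by (simp add: cylinder_def)
  then show ?case
    using step[OF Suc(5), where y=x] markov_one_time_fun[OF Suc(5) k, where s=s0 and x=x] by simp
qed

lemma sets_natural_events_cylinder:
  "sets natural_events = sigma_sets UNIV {cylinder K B | K B. finite K \<and> (\<forall>s. B s \<in> sets cemetery_borel)}"
  (is "_ = sigma_sets UNIV ?G")
proof
  have "?G \<subseteq> sets natural_events" using sets_cylinder by blast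
  then show "sigma_sets UNIV ?G \<subseteq> sets natural_events"
    using sets.sigma_sets_subset[of ?G natural_events] by simp
  have "X s -` B \<in> ?G" if "B \<in> sets cemetery_borel" for s B
    using that by (auto simp: cylinder_def intro!: exI[of _ "{s}"] exI[of _ "\<lambda>_. B"])
  then show "sets natural_events \<subseteq> sigma_sets UNIV ?G"
    unfolding sets_natural by (intro sigma_sets_mono') auto
qed

lemma Int_stable_cylinder:
  "Int_stable {cylinder K B | K B. finite K \<and> (\<forall>s. B s \<in> sets cemetery_borel)}"
proof (rule Int_stableI, clarsimp)
  fix K K' :: "ennreal set" and B B' :: "ennreal \<Rightarrow> 'a option set"
  assume fin: "finite K" "finite K'" and m: "\<forall>s. B s \<in> sets cemetery_borel" "\<forall>s. B' s \<in> sets cemetery_borel"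
  let ?B = "\<lambda>s. (if s \<in> K then B s else UNIV) \<inter> (if s \<in> K' then B' s else UNIV)"
  have "UNIV \<in> sets (cemetery_borel :: 'a option measure)"
    using sets.top[of "cemetery_borel :: 'a option measure"] by simp
  then have "\<forall>s. ?B s \<in> sets cemetery_borel" using m by auto
  moreover have "cylinder K B \<inter> cylinder K' B' = cylinder (K \<union> K') ?B"
    by (auto simp: cylinder_def split: if_splits)
  ultimately show "\<exists>K'' B''. cylinder K B \<inter> cylinder K' B' = cylinder K'' B'' \<and> finite K'' \<and> (\<forall>s. B'' s \<in> sets cemetery_borel)"
    using fin by blast
qed

lemma measurable_shift [measurable]: "\<theta> t \<in> natural_events \<rightarrow>\<^sub>M natural_events"
proof -
  have "\<theta> t -` cylinder K B \<inter> space natural_events \<in> sets natural_events"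
    if "finite K" "\<forall>s. B s \<in> sets cemetery_borel" for K B
  proof -
    have "\<theta> t -` cylinder K B = cylinder ((+) t ` K) (\<lambda>r. \<Inter>s\<in>K \<inter> {s. t + s = r}. B s)"
      by (auto simp: cylinder_def shift)
    also have "\<dots> \<in> sets natural_events"
    proof (rule sets_cylinder)
      fix r
      show "(\<Inter>s\<in>K \<inter> {s. t + s = r}. B s) \<in> sets cemetery_borel"
      proof (cases "K \<inter> {s. t + s = r} = {}")
        case True
        then show ?thesis using sets.top[of "cemetery_borel :: 'a option measure"] by auto
      qed (use that in \<open>auto intro!: sets.finite_INT\<close>)
    qed (use that in auto)
    finally show ?thesis by simp
  qed
  then show ?thesis
    by (intro measurable_sigma_sets[OF sets_natural_events_cylinder]) auto
qed

definition law :: "'a option \<Rightarrow> ennreal \<Rightarrow> 'a option measure" where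
  "law x t = distr (P x) cemetery_borel (X t)"

lemma law_space: "law x t \<in> space (prob_algebra cemetery_borel)"
  unfolding law_def space_prob_algebra
  by (auto intro!: prob_space.prob_space_distr[OF prob_space_P])

lemma sets_law [measurable_cong, simp]: "sets (law x t) = sets cemetery_borel"
  by (simp add: law_def)

text \<open>The Markov property: after time \<open>t\<close> the process starts afresh from the law of \<open>X\<^sub>t\<close>.\<close>

lemma distr_shift: "distr (P x) natural_events (\<theta> t) = law x t \<bind> P"
proof (rule measure_eqI_generator_eq[OF Int_stable_cylinder, where \<Omega>=UNIV and A="\<lambda>_. UNIV"])
  show "sets (distr (P x) natural_events (\<theta> t)) = sigma_sets UNIV {cylinder K B | K B. finite K \<and> (\<forall>s. B s \<in> sets cemetery_borel)}"
    unfolding sets_distr by (rule sets_natural_events_cylinder)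
  show "sets (law x t \<bind> P) = sigma_sets UNIV {cylinder K B | K B. finite K \<and> (\<forall>s. B s \<in> sets cemetery_borel)}"
    unfolding sets_bind_P[OF law_space] by (rule sets_natural_events_cylinder)
  fix C assume "C \<in> {cylinder K B | K B. finite K \<and> (\<forall>s. B s \<in> sets cemetery_borel)}"
  then obtain K B where C: "C = cylinder K B" "finite K" "\<And>s. B s \<in> sets cemetery_borel" by auto
  then have [measurable]: "C \<in> sets natural_events" by auto
  have "emeasure (distr (P x) natural_events (\<theta> t)) C = emeasure (P x) (\<theta> t -` C)"
    by (subst emeasure_distr) auto
  also have "\<theta> t -` C = UNIV \<inter> {\<omega>. \<forall>s\<in>K. X (t + s) \<omega> \<in> B s}"
    by (auto simp: C cylinder_def shift)
  also have "emeasure (P x) \<dots> = (\<integral>\<^sup>+\<omega>. emeasure (P (X t \<omega>)) C \<partial>P x)"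
    using markov_cylinder[OF C(2,3), of UNIV t x] sets.top[of "natural_filtration X t"] by (simp add: C)
  also have "\<dots> = (\<integral>\<^sup>+y. emeasure (P y) C \<partial>law x t)"
    unfolding law_def by (subst nn_integral_distr) auto
  also have "\<dots> = emeasure (law x t \<bind> P) C"
    by (subst emeasure_bind[where N=natural_events])
       (auto intro: measurable_cong_sets[THEN equalityD1, THEN subsetD, rotated 2, OF kernel_subprob] simp: law_def)
  finally show "emeasure (distr (P x) natural_events (\<theta> t)) C = emeasure (law x t \<bind> P) C" .
next
  show "range (\<lambda>_. UNIV) \<subseteq> {cylinder K B | K B. finite K \<and> (\<forall>s. B s \<in> sets cemetery_borel)}"
    using sets.top[of "cemetery_borel :: 'a option measure"]
    by (auto simp: cylinder_def intro!: exI[of _ "{}"] exI[of _ "\<lambda>_. UNIV"])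
  show "emeasure (distr (P x) natural_events (\<theta> t)) UNIV \<noteq> \<infinity>" for i :: nat
  proof -
    have "prob_space (distr (P x) natural_events (\<theta> t))"
      by (intro prob_space.prob_space_distr[OF prob_space_P]) simp
    then show ?thesis using prob_space.emeasure_space_1 by fastforce
  qed
qed auto

text \<open>A property that is almost sure under every initial law may be shifted, and expectations of
  shifted functionals are computed from the law of \<open>X\<^sub>t\<close>. The functional only has to be measurable
  for the completion, so additive functionals are covered.\<close>

lemma AE_shift:
  assumes "AE \<omega> in law x t \<bind> P. Q \<omega>"
  shows "AE \<omega> in P x. Q (\<theta> t \<omega>)"
proof -
  have "AE \<omega> in distr (P x) natural_events (\<theta> t). Q \<omega>" using assms unfolding distr_shift .
  then show ?thesis by (rule AE_distrD[rotated]) simp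
qed

lemma AE_bind_P:
  assumes "AE \<omega> in law x t \<bind> P. Q \<omega>"
  shows "AE y in law x t. AE \<omega> in P y. Q \<omega>"
proof -
  obtain N where N: "{\<omega>. \<not> Q \<omega>} \<subseteq> N" "emeasure (law x t \<bind> P) N = 0" "N \<in> sets natural_events"
    using AE_E[OF assms] by (auto simp: space_bind_P[OF law_space] sets_bind_P[OF law_space])
  have "(\<integral>\<^sup>+y. emeasure (P y) N \<partial>law x t) = 0"
    using N(2,3) by (subst (asm) emeasure_bind[where N=natural_events])
       (auto intro: measurable_cong_sets[THEN equalityD1, THEN subsetD, rotated 2, OF kernel_subprob] simp: law_def)
  moreover have "(\<lambda>y. emeasure (P y) N) \<in> borel_measurable (law x t)"
    using measurable_emeasure_P[OF N(3)] by (simp cong: measurable_cong_sets)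
  ultimately have "AE y in law x t. emeasure (P y) N = 0"
    by (simp add: nn_integral_0_iff_AE)
  then show ?thesis
    by eventually_elim (use N in \<open>auto intro!: AE_I'[of N]\<close>)
qed

lemma nn_integral_shift:
  assumes "\<Phi> \<in> borel_measurable (completion (law x t \<bind> P))"
  shows "(\<integral>\<^sup>+\<omega>. \<Phi> (\<theta> t \<omega>) \<partial>P x) = (\<integral>\<^sup>+y. (\<integral>\<^sup>+\<omega>. \<Phi> \<omega> \<partial>P y) \<partial>law x t)"
proof -
  obtain \<Phi>' where \<Phi>': "\<Phi>' \<in> borel_measurable (law x t \<bind> P)" "AE \<omega> in law x t \<bind> P. \<Phi> \<omega> = \<Phi>' \<omega>"
    using completion_ex_borel_measurable[OF assms] by blast
  have [measurable]: "\<Phi>' \<in> borel_measurable natural_events"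
    using \<Phi>'(1) sets_bind_P[OF law_space] by (simp cong: measurable_cong_sets)
  have "(\<integral>\<^sup>+\<omega>. \<Phi> (\<theta> t \<omega>) \<partial>P x) = (\<integral>\<^sup>+\<omega>. \<Phi>' (\<theta> t \<omega>) \<partial>P x)"
    by (intro nn_integral_cong_AE AE_shift \<Phi>')
  also have "\<dots> = (\<integral>\<^sup>+\<omega>. \<Phi>' \<omega> \<partial>distr (P x) natural_events (\<theta> t))"
    by (subst nn_integral_distr) measurable
  also have "\<dots> = (\<integral>\<^sup>+y. (\<integral>\<^sup>+\<omega>. \<Phi>' \<omega> \<partial>P y) \<partial>law x t)"
    unfolding distr_shift
    by (subst nn_integral_bind[where B=natural_events])
       (auto intro: measurable_cong_sets[THEN equalityD1, THEN subsetD, rotated 2, OF kernel_subprob] simp: law_def)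
  also have "\<dots> = (\<integral>\<^sup>+y. (\<integral>\<^sup>+\<omega>. \<Phi> \<omega> \<partial>P y) \<partial>law x t)"
    using AE_bind_P[OF \<Phi>'(2)]
    by (intro nn_integral_cong_AE) (auto elim!: eventually_mono intro!: nn_integral_cong_AE)
  finally show ?thesis .
qed

end

section \<open>Measurability along paths and potentials of functions\<close>

lemma Some_image_sets:
  fixes B :: "'a::topological_space set"
  assumes "B \<in> sets borel"
  shows "Some ` B \<in> sets cemetery_borel"
proof -
  have o: "Some ` V \<in> sets cemetery_borel" if "open V" for V :: "'a set"
    using that by (auto simp: cemetery_borel_def cemetery_topology_def intro!: sigma_sets.Basic)
  have "B \<in> sigma_sets UNIV {S. open S}" using assms by (simp add: borel_def)
  then show ?thesis
  proof (induction rule: sigma_sets.induct)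
    case (Compl a)
    have "Some ` (UNIV - a) = Some ` UNIV - Some ` a" by auto
    then show ?case using Compl o[OF open_UNIV] by auto
  next
    case (Union a)
    then show ?case by (simp add: image_UN)
  qed (auto intro: o)
qed

lemma measurable_Some_cemetery [measurable]: "Some \<in> borel \<rightarrow>\<^sub>M cemetery_borel"
  unfolding cemetery_borel_def
proof (rule measurable_measure_of)
  fix U :: "'a option set" assume "U \<in> {U. openin cemetery_topology U}"
  then consider V where "open V" "U = Some ` V" | C where "closed C" "U = insert None (Some ` (- C))"
    by (auto simp: cemetery_topology_def openin_Alexandroff_compactification Compl_eq_Diff_UNIV)
  then show "Some -` U \<inter> space borel \<in> sets borel"
    by cases (auto simp: vimage_def inj_image_mem_iff borel_open Compl_eq[symmetric] borel_closed)
qed auto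

lemma measurable_case_option_cemetery [measurable]:
  assumes f [measurable]: "f \<in> borel \<rightarrow>\<^sub>M N" and c: "c \<in> space N"
  shows "case_option c f \<in> cemetery_borel \<rightarrow>\<^sub>M N"
proof (rule measurableI)
  have sp: "space (cemetery_borel :: 'a option measure) = UNIV" by (simp add: cemetery_borel_def)
  fix x :: "'a option"
  show "case_option c f x \<in> space N" using c measurable_space[OF f] by (cases x) auto
  fix S assume S [measurable]: "S \<in> sets N"
  have 1: "f -` S \<in> sets borel" using measurable_sets[OF f S] by simp
  have 2: "{None} \<in> sets (cemetery_borel :: 'a option measure)"
  proof -
    have "UNIV - Some ` UNIV = {None :: 'a option}" by (auto simp: notin_range_Some)
    then show ?thesis
      using sets.Diff[OF sets.top Some_image_sets[of "UNIV :: 'a set"]] by (simp add: sp)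
  qed
  have "y \<in> case_option c f -` S \<longleftrightarrow> y \<in> Some ` (f -` S) \<union> (if c \<in> S then {None} else {})" for y
    by (cases y) auto
  then have "case_option c f -` S = Some ` (f -` S) \<union> (if c \<in> S then {None} else {})"
    by blast
  then show "case_option c f -` S \<inter> space cemetery_borel \<in> sets cemetery_borel"
    using sets.Un[OF Some_image_sets[OF 1] 2] Some_image_sets[OF 1] by (simp add: sp)
qed

lemma measurable_into_cemetery:
  assumes "\<And>V. open V \<Longrightarrow> {z \<in> space M. Y z \<in> Some ` V} \<in> sets M"
  shows "Y \<in> M \<rightarrow>\<^sub>M cemetery_borel"
  unfolding cemetery_borel_def
proof (rule measurable_measure_of)
  fix U :: "'a option set" assume "U \<in> {U. openin cemetery_topology U}"
  then consider V where "open V" "U = Some ` V" | C where "closed C" "U = insert None (Some ` (- C))"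
    by (auto simp: cemetery_topology_def openin_Alexandroff_compactification Compl_eq_Diff_UNIV)
  then show "Y -` U \<inter> space M \<in> sets M"
  proof cases
    case 1
    then show ?thesis using assms[of V] by (simp add: vimage_def Int_def conj_commute)
  next
    case 2
    have "{z \<in> space M. Y z \<in> Some ` UNIV} - {z \<in> space M. Y z \<in> Some ` (- C)} \<in> sets M"
      using assms[of UNIV] assms[of "- C"] 2 by (intro sets.Diff) (auto simp: open_Compl)
    then have "space M - ({z \<in> space M. Y z \<in> Some ` UNIV} - {z \<in> space M. Y z \<in> Some ` (- C)}) \<in> sets M"
      by auto
    also have "space M - ({z \<in> space M. Y z \<in> Some ` UNIV} - {z \<in> space M. Y z \<in> Some ` (- C)}) = Y -` U \<inter> space M"
      using 2 by (auto simp: image_iff)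
    finally show ?thesis .
  qed
qed auto

context dirichlet_hunt
begin

declare sets_m [measurable_cong]

lemma space_m [simp]: "space m = UNIV"
  using sets_eq_imp_space_eq[OF sets_m] by simp

text \<open>Local compactness in the form needed for paths: limits in the one-point compactification are only controlled
  through compact subsets of \<open>E\<close>.\<close>

lemma relatively_compact_basis:
  obtains \<B> :: "'a set set" where "countable \<B>" "\<And>b. b \<in> \<B> \<Longrightarrow> open b"
    "\<And>V x. open V \<Longrightarrow> x \<in> V \<Longrightarrow> \<exists>b\<in>\<B>. x \<in> b \<and> compact (closure b) \<and> closure b \<subseteq> V"
proof -
  obtain \<B> :: "'a set set" where B: "countable \<B>" "topological_basis \<B>"
    using ex_countable_basis by blast
  have "\<exists>b\<in>\<B>. x \<in> b \<and> compact (closure b) \<and> closure b \<subseteq> V" if V: "open V" "x \<in> V" for V and x :: 'a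
  proof -
    obtain u v where uv: "open u" "compact v" "x \<in> u" "u \<subseteq> v" "v \<subseteq> V"
      using locally_compact_E V unfolding locally_def by (simp add: open_openin[symmetric]) metis
    obtain b where b: "b \<in> \<B>" "x \<in> b" "b \<subseteq> u"
      using topological_basisE[OF B(2) uv(1,3)] by metis
    have "closure b \<subseteq> v" using b uv by (meson closure_minimal compact_imp_closed order_trans)
    moreover have "compact (closure b)"
      using compact_Int_closed[OF uv(2) closed_closure[of b]] calculation by (simp add: Int_absorb1)
    ultimately show ?thesis using b uv by blast
  qed
  then show ?thesis using that B topological_basis_open by metis
qed

lemma limitin_compose:
  assumes "limitin T f l F" "filterlim g F G"
  shows "limitin T (\<lambda>x. f (g x)) l G"
  using assms unfolding limitin_def by (auto intro: eventually_compose_filterlim)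

lemma limit_in_openI:
  assumes "limitin cemetery_topology Y y F" "y \<in> Some ` V" "open V"
  shows "\<forall>\<^sub>F s in F. Y s \<in> Some ` V"
  using assms unfolding limitin_def cemetery_topology_def by auto

lemma limit_in_compact:
  fixes K :: "'a set"
  assumes lim: "limitin cemetery_topology Y y F" and "F \<noteq> bot" and K: "compact K" and ev: "\<forall>\<^sub>F s in F. Y s \<in> Some ` K"
  shows "y \<in> Some ` K"
proof (rule ccontr)
  assume n: "y \<notin> Some ` K"
  have "openin cemetery_topology (insert None (Some ` (- K)))"
    unfolding cemetery_topology_def openin_Alexandroff_compactification
    using K compact_imp_closed by (auto simp: Compl_eq_Diff_UNIV)
  moreover have "y \<in> insert None (Some ` (- K))" using n by (cases y) auto
  ultimately have "\<forall>\<^sub>F s in F. Y s \<in> insert None (Some ` (- K))"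
    using lim unfolding limitin_def by blast
  with ev have "\<forall>\<^sub>F s in F. False" by eventually_elim auto
  then show False using \<open>F \<noteq> bot\<close> by simp
qed

lemma right_approx:
  fixes s :: real
  assumes "0 \<le> s"
  shows "filterlim (\<lambda>n. ennreal ((of_int \<lfloor>real (Suc n) * s\<rfloor> + 1) / real (Suc n))) (at_right (ennreal s)) sequentially"
proof -
  let ?s = "\<lambda>n. (of_int \<lfloor>real (Suc n) * s\<rfloor> + 1) / real (Suc n)"
  have gt: "s < ?s n" for n
    by (simp add: field_simps) linarith
  have le: "?s n \<le> s + 1 / real (Suc n)" for n
  proof -
    have "?s n \<le> (real (Suc n) * s + 1) / real (Suc n)"
      by (intro divide_right_mono add_right_mono of_int_floor_le) simp
    also have "\<dots> = s + 1 / real (Suc n)" by (simp add: add_divide_distrib del: of_nat_Suc)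
    finally show ?thesis .
  qed
  have "?s \<longlonglongrightarrow> s"
  proof (rule tendsto_sandwich[OF _ _ tendsto_const])
    show "\<forall>\<^sub>F n in sequentially. s \<le> ?s n" using gt by (intro always_eventually allI less_imp_le)
    show "\<forall>\<^sub>F n in sequentially. ?s n \<le> s + 1 / real (Suc n)" using le by simp
    show "(\<lambda>n. s + 1 / real (Suc n)) \<longlonglongrightarrow> s"
      using tendsto_add[OF tendsto_const LIMSEQ_Suc[OF lim_inverse_n']] by simp
  qed
  then have "(\<lambda>n. ennreal (?s n)) \<longlonglongrightarrow> ennreal s" by (rule tendsto_ennrealI)
  then show ?thesis
    unfolding filterlim_at using gt assms
    by (intro conjI always_eventually allI) (auto simp add: ennreal_less_iff less_imp_neq[OF gt, THEN not_sym] simp del: of_nat_Suc)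
qed

text \<open>Joint measurability in time and path. By right continuity \<open>X\<^sub>s\<close> lies in the open set \<open>V\<close> iff, for some
  relatively compact basic \<open>b\<close> with closure in \<open>V\<close>, the values at times decreasing to \<open>s\<close> on finer and finer
  grids are eventually in the closure of \<open>b\<close>.\<close>

lemma measurable_path [measurable]:
  "(\<lambda>(s::real, \<omega>). X (ennreal s) \<omega>) \<in> borel \<Otimes>\<^sub>M natural_events \<rightarrow>\<^sub>M cemetery_borel"
proof (rule measurable_into_cemetery)
  fix V :: "'a set" assume V: "open V"
  obtain \<B> :: "'a set set" where B: "countable \<B>" "\<And>b. b \<in> \<B> \<Longrightarrow> open b"
    "\<And>V x. open V \<Longrightarrow> x \<in> V \<Longrightarrow> \<exists>b\<in>\<B>. x \<in> b \<and> compact (closure b) \<and> closure b \<subseteq> V"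
    by (rule relatively_compact_basis) blast
  define C where "C = {b\<in>\<B>. compact (closure b) \<and> closure b \<subseteq> V}"
  have C: "countable C" using B(1) by (simp add: C_def)
  define r where "r = (\<lambda>n s. (of_int \<lfloor>real (Suc n) * max 0 s\<rfloor> + 1) / real (Suc n))"
  have r: "filterlim (\<lambda>n. ennreal (r n s)) (at_right (ennreal s)) sequentially" for s
    using right_approx[of "max 0 s"] unfolding r_def by (cases "0 \<le> s") (simp_all add: max_def ennreal_neg)
  have lim: "limitin cemetery_topology (\<lambda>n. X (ennreal (r n s)) \<omega>) (X (ennreal s) \<omega>) sequentially" for s \<omega>
    using right_continuous[of "ennreal s" \<omega>] r by (intro limitin_compose[OF _ r]) simp
  have mr: "(\<lambda>(s, \<omega>). X (ennreal (r n s)) \<omega>) \<in> borel \<Otimes>\<^sub>M natural_events \<rightarrow>\<^sub>M cemetery_borel" for n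
  proof -
    have "(\<lambda>z. (\<lambda>i z. X (ennreal ((of_int i + 1) / real (Suc n))) (snd z)) (\<lfloor>real (Suc n) * max 0 (fst z)\<rfloor>) z)
       \<in> borel \<Otimes>\<^sub>M natural_events \<rightarrow>\<^sub>M cemetery_borel"
      by (rule measurable_compose_countable[where f="\<lambda>i z. X (ennreal ((of_int i + 1) / real (Suc n))) (snd z)"]) measurable
    then show ?thesis by (simp add: r_def case_prod_unfold)
  qed
  have iff: "X (ennreal s) \<omega> \<in> Some ` V \<longleftrightarrow> (\<exists>b\<in>C. \<exists>N. \<forall>n\<ge>N. X (ennreal (r n s)) \<omega> \<in> Some ` closure b)" for s \<omega>
  proof
    assume "X (ennreal s) \<omega> \<in> Some ` V"
    then obtain x where x: "X (ennreal s) \<omega> = Some x" "x \<in> V" by auto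
    obtain b where b: "b \<in> C" "x \<in> b" using B(3)[OF V x(2)] by (auto simp: C_def)
    have "\<forall>\<^sub>F n in sequentially. X (ennreal (r n s)) \<omega> \<in> Some ` b"
      using limit_in_openI[OF lim, of s \<omega> b] b x B(2) by (auto simp: C_def)
    then have "\<forall>\<^sub>F n in sequentially. X (ennreal (r n s)) \<omega> \<in> Some ` closure b"
      by eventually_elim (use closure_subset in blast)
    then show "\<exists>b\<in>C. \<exists>N. \<forall>n\<ge>N. X (ennreal (r n s)) \<omega> \<in> Some ` closure b"
      using b by (auto simp: eventually_sequentially)
  next
    assume "\<exists>b\<in>C. \<exists>N. \<forall>n\<ge>N. X (ennreal (r n s)) \<omega> \<in> Some ` closure b"
    then obtain b where b: "b \<in> C" "\<forall>\<^sub>F n in sequentially. X (ennreal (r n s)) \<omega> \<in> Some ` closure b"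
      by (auto simp: eventually_sequentially)
    then have "X (ennreal s) \<omega> \<in> Some ` closure b"
      by (intro limit_in_compact[OF lim]) (auto simp: C_def)
    then show "X (ennreal s) \<omega> \<in> Some ` V" using b by (auto simp: C_def)
  qed
  define E where "E = (\<lambda>b n. (\<lambda>(s, \<omega>). X (ennreal (r n s)) \<omega>) -` (Some ` closure b) \<inter> space (borel \<Otimes>\<^sub>M natural_events))"
  have E: "E b n \<in> sets (borel \<Otimes>\<^sub>M natural_events)" for b n
    unfolding E_def by (intro measurable_sets[OF mr] Some_image_sets) simp
  have "{z \<in> space (borel \<Otimes>\<^sub>M natural_events). (case z of (s, \<omega>) \<Rightarrow> X (ennreal s) \<omega>) \<in> Some ` V}
     = (\<Union>b\<in>C. \<Union>N. \<Inter>n\<in>{N..}. E b n)"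
    using iff by (intro set_eqI, simp add: E_def space_pair_measure case_prod_unfold, simp add: Ball_def)
  moreover have "(\<Union>b\<in>C. \<Union>N. \<Inter>n\<in>{N..}. E b n) \<in> sets (borel \<Otimes>\<^sub>M natural_events)"
    using E by (intro sets.countable_UN'[OF C] sets.countable_UN sets.countable_INT') auto
  ultimately show "{z \<in> space (borel \<Otimes>\<^sub>M natural_events). (case z of (s, \<omega>) \<Rightarrow> X (ennreal s) \<omega>) \<in> Some ` V}
      \<in> sets (borel \<Otimes>\<^sub>M natural_events)"
    by simp
qed

definition transition :: "ennreal \<Rightarrow> ('a \<Rightarrow> ennreal) \<Rightarrow> 'a \<Rightarrow> ennreal" where
  "transition t f x = (\<integral>\<^sup>+\<omega>. case_option 0 f (X t \<omega>) \<partial>P (Some x))"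

lemma measurable_ext [measurable]:
  fixes f :: "'a \<Rightarrow> ennreal"
  assumes [measurable]: "f \<in> borel_measurable borel"
  shows "case_option 0 f \<in> borel_measurable cemetery_borel"
  by measurable

lemma measurable_transition_pair [measurable]:
  assumes [measurable]: "f \<in> borel_measurable borel"
  shows "(\<lambda>(s::real, x). transition (ennreal s) f x) \<in> borel_measurable (borel \<Otimes>\<^sub>M borel)"
proof -
  have 1: "(\<lambda>z :: (real \<times> 'a) \<times> 'w. (\<lambda>(s::real, \<omega>). X (ennreal s) \<omega>) (fst (fst z), snd z)) \<in> (borel \<Otimes>\<^sub>M borel) \<Otimes>\<^sub>M natural_events \<rightarrow>\<^sub>M cemetery_borel"
    by measurable
  have "(\<lambda>z. \<integral>\<^sup>+\<omega>. case_option 0 f (X (ennreal (fst z)) \<omega>) \<partial>P (Some (snd z))) \<in> borel_measurable (borel \<Otimes>\<^sub>M borel)"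
  proof (rule nn_integral_measurable_subprob_algebra2[where N=natural_events])
    show "(\<lambda>(z, \<omega>). case_option 0 f (X (ennreal (fst z)) \<omega>)) \<in> borel_measurable ((borel \<Otimes>\<^sub>M borel) \<Otimes>\<^sub>M natural_events)"
      using measurable_compose[OF 1 measurable_ext[OF assms]] by (simp add: case_prod_unfold)
    show "(\<lambda>z. P (Some (snd z))) \<in> borel \<Otimes>\<^sub>M borel \<rightarrow>\<^sub>M subprob_algebra natural_events" by measurable
  qed
  then show ?thesis by (simp add: transition_def case_prod_unfold)
qed

lemma measurable_transition [measurable]:
  assumes [measurable]: "f \<in> borel_measurable borel"
  shows "transition t f \<in> borel_measurable borel"
  unfolding transition_def
  by (rule nn_integral_measurable_subprob_algebra2[where N=natural_events]) measurable

lemma nn_integral_law: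
  assumes [measurable]: "f \<in> borel_measurable borel"
  shows "(\<integral>\<^sup>+y. case_option 0 f y \<partial>law (Some x) t) = transition t f x"
  unfolding law_def transition_def by (subst nn_integral_distr) auto


lemma AE_process_dead: "AE \<omega> in P None. \<forall>t. X t \<omega> = None"
proof -
  have "X t \<omega> = None" if "X 0 \<omega> = None" for t \<omega>
  proof (rule absorbing)
    have "lifetime X \<omega> \<le> 0" unfolding lifetime_def using that by (intro Inf_lower) simp
    then show "lifetime X \<omega> \<le> t" by (rule order_trans) simp
  qed
  with normal[of None] show ?thesis by (auto elim!: eventually_mono)
qed

lemma lifetime_pos: "X 0 \<omega> \<noteq> None \<Longrightarrow> 0 < lifetime X \<omega>"
  using absorbing[of \<omega> 0] by (metis not_le)

lemma dead_iff: "X t \<omega> = None \<longleftrightarrow> lifetime X \<omega> \<le> t"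
  unfolding lifetime_def using absorbing[of \<omega> t]
  by (auto simp: lifetime_def intro!: Inf_lower)

text \<open>The Markov property for functionals that vanish on dead paths.\<close>

lemma nn_integral_shift_alive:
  assumes "\<Phi> \<in> borel_measurable (completion (law (Some x) t \<bind> P))"
    and "\<And>\<omega>. (\<And>t. X t \<omega> = None) \<Longrightarrow> \<Phi> \<omega> = 0"
  shows "(\<integral>\<^sup>+\<omega>. \<Phi> (\<theta> t \<omega>) \<partial>P (Some x))
       = (\<integral>\<^sup>+y. case_option 0 (\<lambda>z. \<integral>\<^sup>+\<omega>. \<Phi> \<omega> \<partial>P (Some z)) y \<partial>law (Some x) t)"
proof -
  have "(\<integral>\<^sup>+\<omega>. \<Phi> \<omega> \<partial>P None) = 0"
  proof -
    have "(\<integral>\<^sup>+\<omega>. \<Phi> \<omega> \<partial>P None) = (\<integral>\<^sup>+\<omega>. 0 \<partial>P None)"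
      using AE_process_dead by (intro nn_integral_cong_AE) (auto elim!: eventually_mono intro!: assms(2))
    then show ?thesis by simp
  qed
  then have "(\<integral>\<^sup>+\<omega>. \<Phi> \<omega> \<partial>P y) = case_option 0 (\<lambda>z. \<integral>\<^sup>+\<omega>. \<Phi> \<omega> \<partial>P (Some z)) y" for y
    by (cases y) simp_all
  then show ?thesis using nn_integral_shift[OF assms(1)] by simp
qed

lemma measurable_completion_bind:
  assumes "\<Phi> \<in> natural_events \<rightarrow>\<^sub>M N" "\<nu> \<in> space (prob_algebra cemetery_borel)"
  shows "\<Phi> \<in> completion (\<nu> \<bind> P) \<rightarrow>\<^sub>M N"
  using assms(1) sets_bind_P[OF assms(2)] by (intro measurable_completion) (simp cong: measurable_cong_sets)

definition discounted :: "real \<Rightarrow> ('a \<Rightarrow> ennreal) \<Rightarrow> 'w \<Rightarrow> ennreal" where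
  "discounted \<beta> f \<omega> = (\<integral>\<^sup>+s\<in>{0..}. ennreal (exp (- \<beta> * s)) * case_option 0 f (X (ennreal s) \<omega>) \<partial>lborel)"

definition potential :: "real \<Rightarrow> ('a \<Rightarrow> ennreal) \<Rightarrow> 'a \<Rightarrow> ennreal" where
  "potential \<beta> f x = (\<integral>\<^sup>+\<omega>. discounted \<beta> f \<omega> \<partial>P (Some x))"

lemma measurable_path_at [measurable]:
  assumes [measurable]: "f \<in> borel_measurable borel"
  shows "(\<lambda>s::real. case_option (0::ennreal) f (X (ennreal s) \<omega>)) \<in> borel_measurable borel"
  using measurable_compose[OF measurable_Pair2'[of \<omega> natural_events borel], of "\<lambda>z. case_option 0 f (case z of (s::real, \<omega>) \<Rightarrow> X (ennreal s) \<omega>)" borel]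
  by simp

lemma measurable_path_pair [measurable]:
  assumes [measurable]: "f \<in> borel_measurable borel"
  shows "(\<lambda>z. case_option (0::ennreal) f (X (ennreal (snd z)) (fst z))) \<in> borel_measurable (natural_events \<Otimes>\<^sub>M lborel)"
proof -
  have 1: "(\<lambda>z. case_option 0 f (case z of (s::real, \<omega>) \<Rightarrow> X (ennreal s) \<omega>)) \<in> borel_measurable (borel \<Otimes>\<^sub>M natural_events)"
    by measurable
  have 2: "(\<lambda>z :: 'w \<times> real. (snd z, fst z)) \<in> natural_events \<Otimes>\<^sub>M lborel \<rightarrow>\<^sub>M borel \<Otimes>\<^sub>M natural_events"
    by measurable
  show ?thesis using measurable_compose[OF 2 1] by simp
qed

lemma measurable_discounted [measurable]:
  assumes [measurable]: "f \<in> borel_measurable borel"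
  shows "discounted \<beta> f \<in> borel_measurable natural_events"
  unfolding discounted_def
  by (intro lborel.borel_measurable_nn_integral) (simp add: case_prod_unfold, measurable)

lemma measurable_potential [measurable]:
  assumes [measurable]: "f \<in> borel_measurable borel"
  shows "potential \<beta> f \<in> borel_measurable borel"
  unfolding potential_def
  by (rule nn_integral_measurable_subprob_algebra2[where N=natural_events]) measurable

lemma expect_time_integral:
  assumes [measurable]: "f \<in> borel_measurable borel" "I \<in> sets borel"
  shows "(\<integral>\<^sup>+\<omega>. (\<integral>\<^sup>+s\<in>I. ennreal (exp (- \<beta> * s)) * case_option 0 f (X (ennreal s) \<omega>) \<partial>lborel) \<partial>P (Some x))
    = (\<integral>\<^sup>+s\<in>I. ennreal (exp (- \<beta> * s)) * transition (ennreal s) f x \<partial>lborel)"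
proof -
  interpret Px: prob_space "P (Some x)" by (rule prob_space_P)
  interpret pair_sigma_finite lborel "P (Some x)" by unfold_locales
  have 1: "(\<lambda>z. case_option 0 f (case z of (s::real, \<omega>) \<Rightarrow> X (ennreal s) \<omega>)) \<in> borel_measurable (lborel \<Otimes>\<^sub>M P (Some x))"
    by measurable
  then have [measurable]: "(\<lambda>z. case_option 0 f (X (ennreal (fst z)) (snd z))) \<in> borel_measurable (lborel \<Otimes>\<^sub>M P (Some x))"
    by (simp add: case_prod_unfold)
  have "(\<integral>\<^sup>+\<omega>. (\<integral>\<^sup>+s\<in>I. ennreal (exp (- \<beta> * s)) * case_option 0 f (X (ennreal s) \<omega>) \<partial>lborel) \<partial>P (Some x))
     = (\<integral>\<^sup>+s. \<integral>\<^sup>+\<omega>. ennreal (exp (- \<beta> * s)) * case_option 0 f (X (ennreal s) \<omega>) * indicator I s \<partial>P (Some x) \<partial>lborel)"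
    by (rule Fubini') (simp add: case_prod_unfold, measurable)
  also have "\<dots> = (\<integral>\<^sup>+s\<in>I. ennreal (exp (- \<beta> * s)) * transition (ennreal s) f x \<partial>lborel)"
    unfolding transition_def by (intro nn_integral_cong) (simp add: nn_integral_cmult nn_integral_multc)
  finally show ?thesis .
qed

lemma potential_eq_transition:
  assumes "f \<in> borel_measurable borel"
  shows "potential \<beta> f x = (\<integral>\<^sup>+s\<in>{0..}. ennreal (exp (- \<beta> * s)) * transition (ennreal s) f x \<partial>lborel)"
  unfolding potential_def discounted_def by (rule expect_time_integral[OF assms]) simp

lemma discounted_shift:
  assumes [measurable]: "f \<in> borel_measurable borel" and "0 \<le> t"
  shows "ennreal (exp (- \<beta> * t)) * discounted \<beta> f (\<theta> (ennreal t) \<omega>)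
    = (\<integral>\<^sup>+s\<in>{t..}. ennreal (exp (- \<beta> * s)) * case_option 0 f (X (ennreal s) \<omega>) \<partial>lborel)"
proof -
  have "(\<integral>\<^sup>+s\<in>{t..}. ennreal (exp (- \<beta> * s)) * case_option 0 f (X (ennreal s) \<omega>) \<partial>lborel)
     = (\<integral>\<^sup>+s. ennreal (exp (- \<beta> * (t + s))) * case_option 0 f (X (ennreal (t + s)) \<omega>) * indicator {t..} (t + s) \<partial>lborel)"
    by (subst nn_integral_real_affine[where c=1 and t=t]) auto
  also have "\<dots> = (\<integral>\<^sup>+s. ennreal (exp (- \<beta> * t)) * (ennreal (exp (- \<beta> * s)) * case_option 0 f (X (ennreal s) (\<theta> (ennreal t) \<omega>)) * indicator {0..} s) \<partial>lborel)"
    using \<open>0 \<le> t\<close>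
    by (intro nn_integral_cong)
       (auto simp: shift ennreal_plus[symmetric] exp_add[symmetric] distrib_left ennreal_mult[symmetric] mult.assoc[symmetric] indicator_def simp del: ennreal_plus)
  also have "\<dots> = ennreal (exp (- \<beta> * t)) * discounted \<beta> f (\<theta> (ennreal t) \<omega>)"
    unfolding discounted_def by (subst nn_integral_cmult) auto
  finally show ?thesis by simp
qed

text \<open>Shifting a discounted integral only removes the initial interval, so the Markov property gives the transition
  operators on potentials exactly, for every starting point.\<close>

lemma transition_potential:
  assumes f [measurable]: "f \<in> borel_measurable borel" and "0 \<le> t"
  shows "ennreal (exp (- \<beta> * t)) * transition (ennreal t) (potential \<beta> f) x
       = (\<integral>\<^sup>+s\<in>{t..}. ennreal (exp (- \<beta> * s)) * transition (ennreal s) f x \<partial>lborel)"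
proof -
  have "transition (ennreal t) (potential \<beta> f) x = (\<integral>\<^sup>+\<omega>. discounted \<beta> f (\<theta> (ennreal t) \<omega>) \<partial>P (Some x))"
    unfolding nn_integral_law[OF measurable_potential[OF f], symmetric] potential_def
    by (rule nn_integral_shift_alive[symmetric])
       (auto intro: measurable_completion_bind law_space simp: discounted_def)
  then have "ennreal (exp (- \<beta> * t)) * transition (ennreal t) (potential \<beta> f) x
     = (\<integral>\<^sup>+\<omega>. ennreal (exp (- \<beta> * t)) * discounted \<beta> f (\<theta> (ennreal t) \<omega>) \<partial>P (Some x))"
    by (simp add: nn_integral_cmult)
  also have "\<dots> = (\<integral>\<^sup>+s\<in>{t..}. ennreal (exp (- \<beta> * s)) * transition (ennreal s) f x \<partial>lborel)"
    unfolding discounted_shift[OF f \<open>0 \<le> t\<close>] by (rule expect_time_integral[OF f]) simp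
  finally show ?thesis .
qed

end

section \<open>Square-integrable functions and transition operators\<close>

lemma L2_measurable: "f \<in> L2 m \<Longrightarrow> f \<in> borel_measurable m"
  by (simp add: L2_def)

lemma L2_square_integrable: "f \<in> L2 m \<Longrightarrow> integrable m (\<lambda>x. (f x)\<^sup>2)"
  by (simp add: L2_def)

lemma L2_mult_integrable:
  assumes "f \<in> L2 m" "g \<in> L2 m"
  shows "integrable m (\<lambda>x. f x * g x)"
proof (rule Bochner_Integration.integrable_bound)
  show "integrable m (\<lambda>x. (f x)\<^sup>2 + (g x)\<^sup>2)"
    using assms by (simp add: L2_square_integrable)
  show "(\<lambda>x. f x * g x) \<in> borel_measurable m" using assms by (auto simp: L2_def)
  have "norm (a * b) \<le> norm (a\<^sup>2 + b\<^sup>2)" for a b :: real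
  proof -
    have "2 * (\<bar>a\<bar> * \<bar>b\<bar>) \<le> a\<^sup>2 + b\<^sup>2"
      using sum_squares_bound[of "\<bar>a\<bar>" "\<bar>b\<bar>"] by (simp add: mult.assoc)
    moreover have "0 \<le> \<bar>a\<bar> * \<bar>b\<bar>" by simp
    ultimately have "\<bar>a\<bar> * \<bar>b\<bar> \<le> a\<^sup>2 + b\<^sup>2" by linarith
    then show ?thesis by (simp only: real_norm_def abs_mult abs_of_nonneg[OF sum_power2_ge_zero])
  qed
  then show "AE x in m. norm (f x * g x) \<le> norm ((f x)\<^sup>2 + (g x)\<^sup>2)" by simp
qed

lemma L2_add: "f \<in> L2 m \<Longrightarrow> g \<in> L2 m \<Longrightarrow> (\<lambda>x. f x + g x) \<in> L2 m"
  using L2_mult_integrable[of f m g]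
  by (auto simp: L2_def power2_sum mult.assoc)

lemma L2_scale: "f \<in> L2 m \<Longrightarrow> (\<lambda>x. c * f x) \<in> L2 m"
  by (auto simp: L2_def power_mult_distrib)

lemma L2_diff: "f \<in> L2 m \<Longrightarrow> g \<in> L2 m \<Longrightarrow> (\<lambda>x. f x - g x) \<in> L2 m"
  using L2_add[of f m "\<lambda>x. (-1) * g x"] L2_scale[of g m "-1"] by simp

lemma L2_inner_commute: "L2_inner m f g = L2_inner m g f"
  by (simp add: L2_inner_def mult.commute)

lemma L2_inner_add:
  "f \<in> L2 m \<Longrightarrow> g \<in> L2 m \<Longrightarrow> k \<in> L2 m \<Longrightarrow> L2_inner m (\<lambda>x. f x + g x) k = L2_inner m f k + L2_inner m g k"
  by (simp add: L2_inner_def distrib_right L2_mult_integrable)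

lemma L2_inner_scale: "L2_inner m (\<lambda>x. c * f x) k = c * L2_inner m f k"
  by (simp add: L2_inner_def mult.assoc)

lemma L2_inner_diff:
  "f \<in> L2 m \<Longrightarrow> g \<in> L2 m \<Longrightarrow> k \<in> L2 m \<Longrightarrow> L2_inner m (\<lambda>x. f x - g x) k = L2_inner m f k - L2_inner m g k"
  by (simp add: L2_inner_def left_diff_distrib L2_mult_integrable)

lemma L2_inner_self: "L2_inner m f f = (\<integral>x. (f x)\<^sup>2 \<partial>m)"
  by (simp add: L2_inner_def power2_eq_square)

lemma L2_inner_self_nonneg: "0 \<le> L2_inner m f f"
  by (simp add: L2_inner_self)

lemma L2_norm_power2: "(L2_norm m f)\<^sup>2 = L2_inner m f f"
  by (simp add: L2_norm_def L2_inner_self_nonneg)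

lemma ennreal_L2_inner_self:
  assumes "f \<in> L2 m"
  shows "ennreal (L2_inner m f f) = (\<integral>\<^sup>+x. ennreal ((f x)\<^sup>2) \<partial>m)"
  unfolding L2_inner_self using nn_integral_eq_integral[OF L2_square_integrable[OF assms]] by simp

lemma L2_iff_nn_integral:
  assumes "f \<in> borel_measurable m"
  shows "f \<in> L2 m \<longleftrightarrow> (\<integral>\<^sup>+x. ennreal ((f x)\<^sup>2) \<partial>m) < \<infinity>"
  using assms by (auto simp: L2_def integrable_iff_bounded)

lemma L2_inner_cong_AE:
  assumes "AE x in m. f x = f' x" "AE x in m. g x = g' x"
    and "f \<in> borel_measurable m" "f' \<in> borel_measurable m" "g \<in> borel_measurable m" "g' \<in> borel_measurable m"
  shows "L2_inner m f g = L2_inner m f' g'"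
  unfolding L2_inner_def using assms by (intro integral_cong_AE) auto

lemma L2_self_zero_AE:
  assumes "f \<in> L2 m" "L2_inner m f f \<le> 0"
  shows "AE x in m. f x = 0"
proof -
  have "(\<integral>x. (f x)\<^sup>2 \<partial>m) = 0" using assms(2) by (intro antisym) (simp_all add: L2_inner_self)
  then have "AE x in m. (f x)\<^sup>2 = 0"
    using integral_nonneg_eq_0_iff_AE[OF L2_square_integrable[OF assms(1)]] by simp
  then show ?thesis by simp
qed

lemma ennreal_power2_le: "(ennreal a)\<^sup>2 \<le> ennreal (a\<^sup>2)"
  by (cases "0 \<le> a") (simp_all add: ennreal_power ennreal_neg)

lemma SUP_power2_ennreal:
  fixes u :: "nat \<Rightarrow> ennreal"
  assumes "incseq u"
  shows "(SUP n. u n)\<^sup>2 = (SUP n. (u n)\<^sup>2)"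
proof (rule antisym)
  have "u i * u j \<le> (SUP n. (u n)\<^sup>2)" for i j
  proof -
    have "u i * u j \<le> u (max i j) * u (max i j)"
      using assms by (intro mult_mono) (auto simp: incseq_def)
    also have "\<dots> = (u (max i j))\<^sup>2" by (simp add: power2_eq_square)
    also have "\<dots> \<le> (SUP n. (u n)\<^sup>2)" by (rule SUP_upper) simp
    finally show ?thesis .
  qed
  then show "(SUP n. u n)\<^sup>2 \<le> (SUP n. (u n)\<^sup>2)"
    unfolding power2_eq_square SUP_mult_left_ennreal SUP_mult_right_ennreal
    by (intro SUP_least) (simp add: power2_eq_square)
  show "(SUP n. (u n)\<^sup>2) \<le> (SUP n. u n)\<^sup>2"
    by (intro SUP_least power_mono SUP_upper) auto
qed

context dirichlet_hunt
begin

text \<open>The sets \<open>{\<phi> \<ge> 1/n}\<close> have finite measure and exhaust \<open>E\<close>.\<close>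

lemma sigma_finite_m: "sigma_finite_measure m"
proof
  let ?A = "\<lambda>n::nat. {x. 1 / real (Suc n) \<le> \<phi> x}"
  have [measurable]: "\<phi> \<in> borel_measurable m" using phi_integral by (rule borel_measurable_has_bochner_integral)
  have i: "integrable m \<phi>" using phi_integral by (rule integrable.intros)
  have "emeasure m (?A n) \<noteq> \<infinity>" for n
  proof -
    have "emeasure m (?A n) = (\<integral>\<^sup>+x. indicator (?A n) x \<partial>m)"
      by (subst nn_integral_indicator) auto
    also have "\<dots> \<le> (\<integral>\<^sup>+x. ennreal (real (Suc n)) * ennreal \<bar>\<phi> x\<bar> \<partial>m)"
    proof (intro nn_integral_mono)
      fix x
      show "indicator (?A n) x \<le> ennreal (real (Suc n)) * ennreal \<bar>\<phi> x\<bar>"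
      proof (cases "x \<in> ?A n")
        case True
        then have "1 \<le> real (Suc n) * \<bar>\<phi> x\<bar>" using phi_pos[of x] by (simp add: abs_of_pos field_simps del: of_nat_Suc)
        then show ?thesis using True by (simp add: ennreal_mult[symmetric] del: of_nat_Suc)
      qed simp
    qed
    also have "\<dots> = ennreal (real (Suc n)) * (\<integral>\<^sup>+x. ennreal \<bar>\<phi> x\<bar> \<partial>m)"
      by (subst nn_integral_cmult) auto
    also have "\<dots> < \<infinity>"
      using i unfolding integrable_iff_bounded by (auto intro: ennreal_mult_less_top[THEN iffD2])
    finally show ?thesis by simp
  qed
  moreover have "(\<Union>n. ?A n) = space m"
  proof -
    have "\<exists>n. 1 / real (Suc n) \<le> \<phi> x" for x
      using nat_approx_posE[OF phi_pos[of x]] by (meson less_imp_le)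
    then show ?thesis by auto
  qed
  ultimately show "\<exists>A. countable A \<and> A \<subseteq> sets m \<and> \<Union> A = space m \<and> (\<forall>a\<in>A. emeasure m a \<noteq> \<infinity>)"
    by (intro exI[of _ "range ?A"]) (auto simp del: of_nat_Suc)
qed

sublocale m: sigma_finite_measure m by (rule sigma_finite_m)

text \<open>The \<open>L\<^sup>2\<close>-semigroup is determined only up to \<open>m\<close>-a.e. equality; one version that is associated with the
  process is fixed.\<close>

definition sg :: "real \<Rightarrow> ('a \<Rightarrow> real) \<Rightarrow> 'a \<Rightarrow> real" where
  "sg = (SOME T. form_semigroup T \<and>
       (\<forall>t>0. \<forall>f\<in>L2 m. AE x in m.
          (\<integral>\<omega>. case_option 0 f (X (ennreal t) \<omega>) \<partial>P (Some x)) = T t f x))"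

lemma form_semigroup_sg: "form_semigroup sg"
  and sg_eq_expectation: "0 < t \<Longrightarrow> f \<in> L2 m \<Longrightarrow>
       AE x in m. (\<integral>\<omega>. case_option 0 f (X (ennreal t) \<omega>) \<partial>P (Some x)) = sg t f x"
  using someI_ex[OF associated] unfolding sg_def by auto

lemma sg_L2: "0 < t \<Longrightarrow> f \<in> L2 m \<Longrightarrow> sg t f \<in> L2 m"
  and sg_contraction: "0 < t \<Longrightarrow> f \<in> L2 m \<Longrightarrow> L2_norm m (sg t f) \<le> L2_norm m f"
  and sg_continuous: "f \<in> L2 m \<Longrightarrow> ((\<lambda>t. L2_norm m (\<lambda>x. sg t f x - f x)) \<longlongrightarrow> 0) (at_right 0)"
  and sg_generator: "u \<in> L2 m \<Longrightarrow> f \<in> L2 m \<Longrightarrow>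
     ((\<lambda>t. L2_norm m (\<lambda>x. (sg t u x - u x) / t - f x)) \<longlongrightarrow> 0) (at_right 0) \<Longrightarrow> generator u f"
proof -
  note * = form_semigroup_sg[unfolded form_semigroup_def]
  note c4 = *[THEN conjunct2, THEN conjunct2, THEN conjunct2, THEN conjunct2]
  show "0 < t \<Longrightarrow> f \<in> L2 m \<Longrightarrow> sg t f \<in> L2 m" using *[THEN conjunct1, rule_format] .
  show "0 < t \<Longrightarrow> f \<in> L2 m \<Longrightarrow> L2_norm m (sg t f) \<le> L2_norm m f" using c4[THEN conjunct1, rule_format] .
  show "f \<in> L2 m \<Longrightarrow> ((\<lambda>t. L2_norm m (\<lambda>x. sg t f x - f x)) \<longlongrightarrow> 0) (at_right 0)"
    using c4[THEN conjunct2, THEN conjunct1, rule_format] .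
  show "u \<in> L2 m \<Longrightarrow> f \<in> L2 m \<Longrightarrow>
     ((\<lambda>t. L2_norm m (\<lambda>x. (sg t u x - u x) / t - f x)) \<longlongrightarrow> 0) (at_right 0) \<Longrightarrow> generator u f"
    using c4[THEN conjunct2, THEN conjunct2, rule_format, THEN iffD1] .
qed

lemma measurable_ext_real [measurable]:
  fixes f :: "'a \<Rightarrow> real"
  assumes [measurable]: "f \<in> borel_measurable borel"
  shows "case_option 0 f \<in> borel_measurable cemetery_borel"
  by measurable

lemma transition_mono: "(\<And>x. f x \<le> g x) \<Longrightarrow> transition t f x \<le> transition t g x"
  unfolding transition_def by (intro nn_integral_mono) (auto split: option.split)

lemma transition_mono_AE_law:
  assumes "AE y in law (Some x) t. \<forall>z. y = Some z \<longrightarrow> f z \<le> g z"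
  shows "transition t f x \<le> transition t g x"
proof -
  have "AE \<omega> in P (Some x). \<forall>z. X t \<omega> = Some z \<longrightarrow> f z \<le> g z"
    using assms unfolding law_def by (rule AE_distrD[rotated]) simp
  then show ?thesis unfolding transition_def
    by (intro nn_integral_mono_AE) (auto elim!: eventually_mono split: option.split)
qed

lemma transition_SUP:
  assumes [measurable]: "\<And>n. f n \<in> borel_measurable borel" and inc: "\<And>x. incseq (\<lambda>n. f n x)"
  shows "transition t (\<lambda>x. SUP n. f n x) x = (SUP n. transition t (f n) x)"
proof -
  have "(case X t \<omega> of None \<Rightarrow> 0 | Some x \<Rightarrow> SUP n. f n x) = (SUP n::nat. case X t \<omega> of None \<Rightarrow> 0 | Some x \<Rightarrow> f n x)" for \<omega>
    by (cases "X t \<omega>") auto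
  then show ?thesis
    unfolding transition_def using inc
    by (subst nn_integral_monotone_convergence_SUP[symmetric])
       (auto simp: incseq_def le_fun_def split: option.split)
qed

lemma transition_eq_integral:
  fixes f :: "'a \<Rightarrow> real"
  assumes [measurable]: "f \<in> borel_measurable borel" and "\<And>x. 0 \<le> f x"
  shows "(\<integral>\<omega>. case_option 0 f (X t \<omega>) \<partial>P (Some x)) = enn2real (transition t (\<lambda>y. ennreal (f y)) x)"
proof -
  have "case_option 0 (\<lambda>y. ennreal (f y)) z = ennreal (case_option 0 f z)" for z by (cases z) auto
  then show ?thesis
    unfolding transition_def using assms(2)
    by (subst integral_eq_nn_integral) (auto split: option.split)
qed

lemma transition_finite:
  assumes "\<And>x. f x \<le> ennreal c"
  shows "transition t f x \<le> ennreal c"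
proof -
  interpret Px: prob_space "P (Some x)" by (rule prob_space_P)
  have "transition t f x \<le> (\<integral>\<^sup>+\<omega>. ennreal c \<partial>P (Some x))"
    unfolding transition_def using assms by (intro nn_integral_mono) (auto split: option.split)
  also have "\<dots> = ennreal c" using Px.emeasure_space_1 by simp
  finally show ?thesis .
qed

text \<open>The contraction property of the \<open>L\<^sup>2\<close>-semigroup passes to the transition operators on all nonnegative functions,
  with infinite values allowed: truncate, where the two agree, and let the truncation grow.\<close>

lemma transition_contraction:
  assumes [measurable]: "f \<in> borel_measurable borel" and "0 < t"
  shows "(\<integral>\<^sup>+x. (transition (ennreal t) f x)\<^sup>2 \<partial>m) \<le> (\<integral>\<^sup>+x. (f x)\<^sup>2 \<partial>m)"
proof (cases "(\<integral>\<^sup>+x. (f x)\<^sup>2 \<partial>m) < \<infinity>")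
  case True
  define F where "F = (\<lambda>n x. min (f x) (of_nat n))"
  define r where "r = (\<lambda>n x. enn2real (F n x))"
  have F_fin: "F n x < \<infinity>" for n x by (simp add: F_def min_less_iff_disj ennreal_of_nat_eq_real_of_nat)
  have Fr: "ennreal (r n x) = F n x" for n x using F_fin[of n x] by (simp add: r_def)
  have Frn: "(\<lambda>y. ennreal (r n y)) = F n" for n by (rule ext) (rule Fr)
  have r_nonneg: "0 \<le> r n x" for n x by (simp add: r_def)
  have [measurable]: "F n \<in> borel_measurable borel" "r n \<in> borel_measurable borel" for n
    unfolding F_def r_def by measurable
  have sq: "ennreal ((r n x)\<^sup>2) = (F n x)\<^sup>2" for n x
    unfolding Fr[symmetric] by (simp add: ennreal_power r_def)
  have Fle: "(\<integral>\<^sup>+x. (F n x)\<^sup>2 \<partial>m) \<le> (\<integral>\<^sup>+x. (f x)\<^sup>2 \<partial>m)" for n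
    by (intro nn_integral_mono power_mono) (auto simp: F_def)
  have rL2: "r n \<in> L2 m" for n
    using Fle[of n] True by (subst L2_iff_nn_integral) (auto simp: sq)
  have step: "(\<integral>\<^sup>+x. (transition (ennreal t) (F n) x)\<^sup>2 \<partial>m) \<le> (\<integral>\<^sup>+x. (f x)\<^sup>2 \<partial>m)" for n
  proof -
    have fin: "transition (ennreal t) (F n) x < \<infinity>" for x
      using transition_finite[where f="F n" and c="real n" and t="ennreal t" and x=x] by (simp add: F_def ennreal_of_nat_eq_real_of_nat le_less_trans)
    have "AE x in m. transition (ennreal t) (F n) x = ennreal (sg t (r n) x)"
      using sg_eq_expectation[OF \<open>0 < t\<close> rL2[of n]]
    proof eventually_elim
      case (elim x)
      then have "sg t (r n) x = enn2real (transition (ennreal t) (F n) x)"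
        using transition_eq_integral[where f="r n" and t="ennreal t" and x=x] unfolding Frn by (simp add: r_nonneg)
      then show ?case using fin[of x] by simp
    qed
    then have "AE x in m. (transition (ennreal t) (F n) x)\<^sup>2 \<le> ennreal ((sg t (r n) x)\<^sup>2)"
      by eventually_elim (simp add: ennreal_power2_le)
    then have "(\<integral>\<^sup>+x. (transition (ennreal t) (F n) x)\<^sup>2 \<partial>m) \<le> (\<integral>\<^sup>+x. ennreal ((sg t (r n) x)\<^sup>2) \<partial>m)"
      by (rule nn_integral_mono_AE)
    also have "\<dots> = ennreal ((L2_norm m (sg t (r n)))\<^sup>2)"
      using ennreal_L2_inner_self[OF sg_L2[OF \<open>0 < t\<close> rL2]] by (simp add: L2_norm_power2)
    also have "\<dots> \<le> ennreal ((L2_norm m (r n))\<^sup>2)"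
      by (intro ennreal_leI power_mono sg_contraction rL2 \<open>0 < t\<close>) (simp add: L2_norm_def L2_inner_self_nonneg)
    also have "\<dots> = (\<integral>\<^sup>+x. (F n x)\<^sup>2 \<partial>m)"
      using ennreal_L2_inner_self[OF rL2] by (simp add: L2_norm_power2 sq)
    finally show ?thesis using Fle[of n] by (rule order_trans)
  qed
  have f_SUP: "f x = (SUP n. F n x)" for x
    unfolding F_def inf_min[symmetric] inf_SUP[symmetric] ennreal_SUP_of_nat_eq_top by simp
  have incF: "incseq (\<lambda>n. F n x)" for x by (auto simp: F_def incseq_def min_le_iff_disj intro: of_nat_mono order_trans)
  have tr: "transition (ennreal t) f x = (SUP n. transition (ennreal t) (F n) x)" for x
    using transition_SUP[of F "ennreal t" x] incF by (simp add: f_SUP[symmetric])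
  have inct: "incseq (\<lambda>n. transition (ennreal t) (F n) x)" for x
    using incF by (auto simp: incseq_def intro!: transition_mono)
  have "(transition (ennreal t) f x)\<^sup>2 = (SUP n. (transition (ennreal t) (F n) x)\<^sup>2)" for x
    unfolding tr by (rule SUP_power2_ennreal[OF inct])
  then have "(\<integral>\<^sup>+x. (transition (ennreal t) f x)\<^sup>2 \<partial>m) = (\<integral>\<^sup>+x. (SUP n. (transition (ennreal t) (F n) x)\<^sup>2) \<partial>m)" by simp
  also have "\<dots> = (SUP n. \<integral>\<^sup>+x. (transition (ennreal t) (F n) x)\<^sup>2 \<partial>m)"
    using inct by (intro nn_integral_monotone_convergence_SUP) (auto simp: incseq_def le_fun_def intro!: power_mono)
  also have "\<dots> \<le> (\<integral>\<^sup>+x. (f x)\<^sup>2 \<partial>m)" using step by (intro SUP_least)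
  finally show ?thesis .
qed (simp add: less_top[symmetric])

lemma transition_finite_AE:
  assumes [measurable]: "f \<in> borel_measurable borel" and "(\<integral>\<^sup>+x. (f x)\<^sup>2 \<partial>m) < \<infinity>" "0 < t"
  shows "AE x in m. transition (ennreal t) f x < \<infinity>"
proof -
  have "(\<integral>\<^sup>+x. (transition (ennreal t) f x)\<^sup>2 \<partial>m) < \<infinity>"
    using transition_contraction[OF assms(1,3)] assms(2) by (rule le_less_trans)
  then have "AE x in m. (transition (ennreal t) f x)\<^sup>2 \<noteq> \<infinity>"
    by (intro nn_integral_PInf_AE) auto
  then show ?thesis
  proof eventually_elim
    case (elim x)
    then show ?case by (cases "transition (ennreal t) f x") (auto simp: power2_eq_square)
  qed
qed

lemma sg_eq_transition:
  assumes "f \<in> L2 m" "\<And>x. 0 \<le> f x" "0 < t"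
  shows "AE x in m. transition (ennreal t) (\<lambda>y. ennreal (f y)) x < \<infinity> \<and> sg t f x = enn2real (transition (ennreal t) (\<lambda>y. ennreal (f y)) x)"
proof -
  have [measurable]: "f \<in> borel_measurable borel"
    using L2_measurable[OF assms(1)] by simp
  have "(\<integral>\<^sup>+x. (ennreal (f x))\<^sup>2 \<partial>m) < \<infinity>"
    using assms L2_iff_nn_integral[of f m] by (simp add: ennreal_power)
  then show ?thesis
    using sg_eq_expectation[OF assms(3,1)] transition_finite_AE[of "\<lambda>x. ennreal (f x)" t] assms(3)
    by (auto simp: transition_eq_integral assms(2))
qed

text \<open>The law of \<open>X\<^sub>t\<close>, \<open>t > 0\<close>, started at \<open>m\<close>-almost every point does not charge \<open>m\<close>-null sets.\<close>

lemma AE_law: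
  assumes Q: "AE z in m. Q z" and "0 < t"
  shows "AE x in m. AE y in law (Some x) (ennreal t). \<forall>z. y = Some z \<longrightarrow> Q z"
proof -
  obtain N where N: "{z. \<not> Q z} \<subseteq> N" "emeasure m N = 0" "N \<in> sets m" using AE_E[OF Q] by auto
  have [measurable]: "N \<in> sets borel" using N(3) sets_m by simp
  have "(\<integral>\<^sup>+x. (transition (ennreal t) (indicator N) x)\<^sup>2 \<partial>m) \<le> (\<integral>\<^sup>+x. (indicator N x)\<^sup>2 \<partial>m)"
    by (rule transition_contraction[OF _ \<open>0 < t\<close>]) measurable
  also have "\<dots> = (\<integral>\<^sup>+x. indicator N x \<partial>m)"
    by (intro nn_integral_cong) (auto simp: indicator_def)
  also have "\<dots> = 0" using N by (simp add: nn_integral_indicator)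
  finally have "AE x in m. (transition (ennreal t) (indicator N) x)\<^sup>2 = 0"
    by (subst (asm) le_zero_eq, subst (asm) nn_integral_0_iff_AE) auto
  then show ?thesis
  proof eventually_elim
    case (elim x)
    then have "(\<integral>\<^sup>+y. case_option 0 (indicator N) y \<partial>law (Some x) (ennreal t)) = 0"
      by (subst nn_integral_law) auto
    then have "AE y in law (Some x) (ennreal t). case_option 0 (indicator N) y = (0::ennreal)"
      by (subst (asm) nn_integral_0_iff_AE) auto
    then show ?case by eventually_elim (use N(1) in \<open>auto simp: indicator_def split: if_splits\<close>)
  qed
qed

lemma transition_mono_AE:
  assumes "AE z in m. f z \<le> g z" "0 < t"
  shows "AE x in m. transition (ennreal t) f x \<le> transition (ennreal t) g x"
  using AE_law[OF assms] by eventually_elim (rule transition_mono_AE_law)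

lemma transition_cong_AE:
  assumes "AE z in m. f z = g z" "0 < t"
  shows "AE x in m. transition (ennreal t) f x = transition (ennreal t) g x"
proof -
  have "AE z in m. f z \<le> g z" "AE z in m. g z \<le> f z" using assms(1) by auto
  from this[THEN transition_mono_AE[OF _ assms(2)]] show ?thesis by eventually_elim (rule antisym)
qed

lemma transition_0: "f \<in> borel_measurable borel \<Longrightarrow> transition 0 f x = f x"
proof -
  interpret Px: prob_space "P (Some x)" by (rule prob_space_P)
  have "transition 0 f x = (\<integral>\<^sup>+\<omega>. f x \<partial>P (Some x))"
    unfolding transition_def using normal[of "Some x"] by (intro nn_integral_cong_AE) auto
  then show ?thesis using Px.emeasure_space_1 by simp
qed

end

section \<open>Potentials solve the resolvent equation of the form\<close>

lemma abs_diff_nn_integral_le: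
  fixes a b :: "real \<Rightarrow> real"
  assumes [measurable]: "a \<in> borel_measurable M" "b \<in> borel_measurable M"
    and "\<And>s. 0 \<le> a s" "\<And>s. 0 \<le> b s"
    and "(\<integral>\<^sup>+s. ennreal (a s) \<partial>M) = ennreal A" "(\<integral>\<^sup>+s. ennreal (b s) \<partial>M) = ennreal B" "0 \<le> A" "0 \<le> B"
  shows "ennreal \<bar>A - B\<bar> \<le> (\<integral>\<^sup>+s. ennreal \<bar>a s - b s\<bar> \<partial>M)"
proof -
  have 1: "has_bochner_integral M a A" "has_bochner_integral M b B"
    using assms by (auto intro!: has_bochner_integral_nn_integral)
  then have 2: "integrable M a" "integrable M b" "integral\<^sup>L M a = A" "integral\<^sup>L M b = B"
    by (auto simp: has_bochner_integral_iff)
  have "ennreal \<bar>A - B\<bar> = ennreal \<bar>integral\<^sup>L M (\<lambda>s. a s - b s)\<bar>" using 2 by simp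
  also have "\<dots> \<le> (\<integral>\<^sup>+s. ennreal \<bar>a s - b s\<bar> \<partial>M)"
    using integral_norm_bound_ennreal[of M "\<lambda>s. a s - b s"] 2 by simp
  finally show ?thesis .
qed

lemma nn_integral_exp_finite:
  assumes "0 < \<beta>"
  shows "(\<integral>\<^sup>+s\<in>{0..}. ennreal (exp (- \<beta> * s)) \<partial>lborel) = ennreal (1 / \<beta>)"
proof -
  interpret prob_space "density lborel (exponential_density \<beta>)"
    by (rule prob_space_exponential_density[OF assms])
  have "(\<integral>\<^sup>+s. ennreal (exponential_density \<beta> s) \<partial>lborel) = 1"
    using emeasure_space_1 by (subst (asm) emeasure_density) auto
  moreover have "ennreal (exp (- \<beta> * s)) * indicator {0..} s = ennreal (1 / \<beta>) * ennreal (exponential_density \<beta> s)" for s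
    using assms by (auto simp: exponential_density_def ennreal_mult[symmetric] mult.commute split: split_indicator)
  ultimately show ?thesis by (simp add: nn_integral_cmult)
qed

lemma sum_power2_le: "(a + b)\<^sup>2 \<le> 2 * a\<^sup>2 + 2 * (b::real)\<^sup>2"
  using sum_squares_bound[of a b] by (simp add: power2_sum)

context dirichlet_hunt
begin

text \<open>Cauchy--Schwarz in the time variable with weight \<open>e\<^sup>-\<^sup>\<beta>\<^sup>s\<close>, followed by the \<open>L\<^sup>2\<close>-contraction at each time.\<close>

lemma potential_square_integrable:
  assumes f [measurable]: "f \<in> borel_measurable borel" and fin: "(\<integral>\<^sup>+x. (f x)\<^sup>2 \<partial>m) < \<infinity>" and "0 < \<beta>"
  shows "(\<integral>\<^sup>+x. (potential \<beta> f x)\<^sup>2 \<partial>m) < \<infinity>"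
proof -
  interpret pair_sigma_finite lborel m by unfold_locales
  have [measurable]: "(\<lambda>(s, x). transition (ennreal s) f x) \<in> borel_measurable (lborel \<Otimes>\<^sub>M m)"
    using measurable_transition_pair[OF f] by (simp cong: measurable_cong_sets)
  let ?e = "\<lambda>s::real. ennreal (sqrt (exp (- \<beta> * s))) * indicator {0..} s"
  let ?K = "ennreal (1 / \<beta>)" and ?N = "\<integral>\<^sup>+x. (f x)\<^sup>2 \<partial>m"
  have sq: "ennreal (sqrt (exp r)) * ennreal (sqrt (exp r)) = ennreal (exp r)" for r
    by (simp add: ennreal_mult[symmetric])
  have [measurable]: "(\<lambda>s. transition (ennreal s) f x) \<in> borel_measurable lborel" for x by measurable
  have "(potential \<beta> f x)\<^sup>2 \<le> ?K * (\<integral>\<^sup>+s. ennreal (exp (- \<beta> * s)) * indicator {0..} s * (transition (ennreal s) f x)\<^sup>2 \<partial>lborel)" for x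
  proof -
    have "potential \<beta> f x = (\<integral>\<^sup>+s. ?e s * (?e s * transition (ennreal s) f x) \<partial>lborel)"
      unfolding potential_eq_transition[OF f]
      by (intro nn_integral_cong) (auto simp: sq mult.assoc[symmetric] split: split_indicator)
    also have "\<dots>\<^sup>2 \<le> (\<integral>\<^sup>+s. (?e s)\<^sup>2 \<partial>lborel) * (\<integral>\<^sup>+s. (?e s * transition (ennreal s) f x)\<^sup>2 \<partial>lborel)"
      by (rule Cauchy_Schwarz_nn_integral) measurable
    also have "(\<integral>\<^sup>+s. (?e s)\<^sup>2 \<partial>lborel) = (\<integral>\<^sup>+s\<in>{0..}. ennreal (exp (- \<beta> * s)) \<partial>lborel)"
      by (intro nn_integral_cong) (auto simp: power2_eq_square sq split: split_indicator)
    also have "\<dots> = ?K" by (rule nn_integral_exp_finite[OF \<open>0 < \<beta>\<close>])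
    also have "(\<integral>\<^sup>+s. (?e s * transition (ennreal s) f x)\<^sup>2 \<partial>lborel) =
        (\<integral>\<^sup>+s. ennreal (exp (- \<beta> * s)) * indicator {0..} s * (transition (ennreal s) f x)\<^sup>2 \<partial>lborel)"
    proof (intro nn_integral_cong)
      fix s
      have "(ennreal (sqrt (exp (- \<beta> * s))) * transition (ennreal s) f x)\<^sup>2 = ennreal (exp (- \<beta> * s)) * (transition (ennreal s) f x)\<^sup>2"
        unfolding power_mult_distrib by (simp add: power2_eq_square sq)
      then show "(?e s * transition (ennreal s) f x)\<^sup>2 = ennreal (exp (- \<beta> * s)) * indicator {0..} s * (transition (ennreal s) f x)\<^sup>2"
        by (simp split: split_indicator)
    qed
    finally show ?thesis .
  qed
  then have "(\<integral>\<^sup>+x. (potential \<beta> f x)\<^sup>2 \<partial>m) \<le>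
     (\<integral>\<^sup>+x. ?K * (\<integral>\<^sup>+s. ennreal (exp (- \<beta> * s)) * indicator {0..} s * (transition (ennreal s) f x)\<^sup>2 \<partial>lborel) \<partial>m)"
    by (intro nn_integral_mono)
  also have "\<dots> = ?K * (\<integral>\<^sup>+x. \<integral>\<^sup>+s. ennreal (exp (- \<beta> * s)) * indicator {0..} s * (transition (ennreal s) f x)\<^sup>2 \<partial>lborel \<partial>m)"
    by (rule nn_integral_cmult) measurable
  finally have outer: "(\<integral>\<^sup>+x. (potential \<beta> f x)\<^sup>2 \<partial>m) \<le> \<dots>" .
  have "(\<integral>\<^sup>+x. \<integral>\<^sup>+s. ennreal (exp (- \<beta> * s)) * indicator {0..} s * (transition (ennreal s) f x)\<^sup>2 \<partial>lborel \<partial>m)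
      = (\<integral>\<^sup>+s. \<integral>\<^sup>+x. ennreal (exp (- \<beta> * s)) * indicator {0..} s * (transition (ennreal s) f x)\<^sup>2 \<partial>m \<partial>lborel)"
    by (rule Fubini') measurable
  also have "\<dots> \<le> (\<integral>\<^sup>+s. ennreal (exp (- \<beta> * s)) * indicator {0..} s * ?N \<partial>lborel)"
  proof (intro nn_integral_mono)
    fix s :: real
    have "0 \<le> s \<Longrightarrow> (\<integral>\<^sup>+x. (transition (ennreal s) f x)\<^sup>2 \<partial>m) \<le> ?N"
      using transition_contraction[OF f, of s] by (cases "s = 0") (auto simp: transition_0[OF f])
    then show "(\<integral>\<^sup>+x. ennreal (exp (- \<beta> * s)) * indicator {0..} s * (transition (ennreal s) f x)\<^sup>2 \<partial>m)
        \<le> ennreal (exp (- \<beta> * s)) * indicator {0..} s * ?N"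
      by (subst nn_integral_cmult) (auto intro!: mult_left_mono split: split_indicator)
  qed
  also have "\<dots> = ?K * ?N"
    by (subst nn_integral_multc) (auto simp: nn_integral_exp_finite[OF \<open>0 < \<beta>\<close>, simplified])
  finally have "(\<integral>\<^sup>+x. (potential \<beta> f x)\<^sup>2 \<partial>m) \<le> ?K * (?K * ?N)"
    using order_trans[OF outer mult_left_mono] by simp
  also have "\<dots> < \<infinity>" using fin by (auto intro!: ennreal_mult_less_top[THEN iffD2])
  finally show ?thesis .
qed

definition rpot :: "real \<Rightarrow> ('a \<Rightarrow> real) \<Rightarrow> 'a \<Rightarrow> real" where
  "rpot \<beta> f x = enn2real (potential \<beta> (\<lambda>y. ennreal (f y)) x)"

lemma rpot_nonneg: "0 \<le> rpot \<beta> f x" by (simp add: rpot_def)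

lemma L2_borel: "f \<in> L2 m \<Longrightarrow> f \<in> borel_measurable borel"
  using L2_measurable[of f m] by simp

lemma rpot_L2:
  assumes "f \<in> L2 m" "\<And>x. 0 \<le> f x" "0 < \<beta>"
  shows "rpot \<beta> f \<in> L2 m" "AE x in m. potential \<beta> (\<lambda>y. ennreal (f y)) x = ennreal (rpot \<beta> f x)"
proof -
  have [measurable]: "f \<in> borel_measurable borel" by (rule L2_borel) fact
  have fin: "(\<integral>\<^sup>+x. (potential \<beta> (\<lambda>y. ennreal (f y)) x)\<^sup>2 \<partial>m) < \<infinity>"
    using assms L2_iff_nn_integral[of f m]
    by (intro potential_square_integrable) (auto simp: ennreal_power)
  then have "AE x in m. (potential \<beta> (\<lambda>y. ennreal (f y)) x)\<^sup>2 \<noteq> \<infinity>"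
    by (intro nn_integral_PInf_AE) auto
  then show *: "AE x in m. potential \<beta> (\<lambda>y. ennreal (f y)) x = ennreal (rpot \<beta> f x)"
  proof eventually_elim
    case (elim x)
    then show ?case by (cases "potential \<beta> (\<lambda>y. ennreal (f y)) x") (auto simp: rpot_def power2_eq_square)
  qed
  have [measurable]: "rpot \<beta> f \<in> borel_measurable m" unfolding rpot_def by measurable
  have "(\<integral>\<^sup>+x. ennreal ((rpot \<beta> f x)\<^sup>2) \<partial>m) = (\<integral>\<^sup>+x. (potential \<beta> (\<lambda>y. ennreal (f y)) x)\<^sup>2 \<partial>m)"
    using * by (intro nn_integral_cong_AE) (auto elim!: eventually_mono simp: ennreal_power rpot_nonneg)
  then show "rpot \<beta> f \<in> L2 m" using fin by (subst L2_iff_nn_integral) auto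
qed

text \<open>The estimate behind \<open>A G\<^sub>\<beta> f = \<beta> G\<^sub>\<beta> f - f\<close>. With \<open>S = G\<^sub>\<beta> f\<close> and \<open>R = \<integral>\<^sub>0\<^sup>r e\<^sup>-\<^sup>\<beta>\<^sup>s p\<^sub>s f ds\<close> the Markov property
  gives \<open>p\<^sub>r S = e\<^sup>\<beta>\<^sup>r (S - R)\<close>, hence
  \<open>(p\<^sub>r S - S)/r - (\<beta> S - f) = ((e\<^sup>\<beta>\<^sup>r - 1)/r - \<beta>) S - (e\<^sup>\<beta>\<^sup>r R - r f)/r\<close>,
  and the last term is the time average over \<open>[0,r)\<close> of \<open>exp (\<beta>(r - s)) p\<^sub>s f - f\<close>, whose \<open>L\<^sup>2\<close>-norm is controlled by strong
  continuity.\<close>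

lemma rpot_difference_quotient:
  assumes f: "f \<in> L2 m" and pos: "\<And>x. 0 \<le> f x" and "0 < \<beta>" "0 < r"
    and close: "\<And>s. 0 < s \<Longrightarrow> s < r \<Longrightarrow> (L2_norm m (\<lambda>x. sg s f x - f x))\<^sup>2 \<le> \<epsilon>"
  shows "(L2_norm m (\<lambda>x. (sg r (rpot \<beta> f) x - rpot \<beta> f x) / r - (\<beta> * rpot \<beta> f x - f x)))\<^sup>2
     \<le> 2 * ((exp (\<beta> * r) - 1) / r - \<beta>)\<^sup>2 * L2_inner m (rpot \<beta> f) (rpot \<beta> f)
        + 4 * (exp (\<beta> * r))\<^sup>2 * \<epsilon> + 4 * (exp (\<beta> * r) - 1)\<^sup>2 * L2_inner m f f"
proof -
  interpret pair_sigma_finite lborel m by unfold_locales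
  have fm [measurable]: "f \<in> borel_measurable borel" by (rule L2_borel) fact
  define F where "F = (\<lambda>y. ennreal (f y))"
  have Fm [measurable]: "F \<in> borel_measurable borel" unfolding F_def by measurable
  have [measurable]: "(\<lambda>(s, x). transition (ennreal s) F x) \<in> borel_measurable (lborel \<Otimes>\<^sub>M m)"
    using measurable_transition_pair[OF Fm] by (simp cong: measurable_cong_sets)
  have [measurable]: "(\<lambda>s. transition (ennreal s) F x) \<in> borel_measurable lborel" for x by measurable
  define S where "S = rpot \<beta> f"
  have S: "S \<in> L2 m" "AE x in m. potential \<beta> F x = ennreal (S x)" "\<And>x. 0 \<le> S x"
    using rpot_L2[OF f pos \<open>0 < \<beta>\<close>] rpot_nonneg by (auto simp: S_def F_def)
  have [measurable]: "S \<in> borel_measurable borel" by (rule L2_borel[OF S(1)])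
  define q where "q = (\<lambda>s x. enn2real (transition (ennreal s) F x))"
  have [measurable]: "(\<lambda>(s, x). q s x) \<in> borel_measurable (lborel \<Otimes>\<^sub>M m)"
    unfolding q_def case_prod_unfold by measurable
  have [measurable]: "(\<lambda>s. q s x) \<in> borel_measurable lborel" for x unfolding q_def by measurable
  have [measurable]: "q s \<in> borel_measurable borel" for s unfolding q_def by measurable
  have q_nonneg: "0 \<le> q s x" for s x by (simp add: q_def)
  define k where "k = (\<lambda>s x. \<bar>exp (\<beta> * (r - s)) * q s x - f x\<bar>)"
  have [measurable]: "(\<lambda>(s, x). k s x) \<in> borel_measurable (lborel \<Otimes>\<^sub>M m)"
    unfolding k_def case_prod_unfold by measurable
  have [measurable]: "(\<lambda>s. k s x) \<in> borel_measurable lborel" for x unfolding k_def by measurable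
  have k_nonneg: "0 \<le> k s x" for s x by (simp add: k_def)
  define c where "c = (exp (\<beta> * r) - 1) / r - \<beta>"
  define V where "V = (\<lambda>x. (sg r S x - S x) / r - (\<beta> * S x - f x))"
  define W where "W = (\<lambda>x. \<integral>\<^sup>+s\<in>{0..<r}. ennreal (k s x) \<partial>lborel)"
  have sgS: "sg r S \<in> L2 m" by (rule sg_L2[OF \<open>0 < r\<close> S(1)])
  have VL2: "V \<in> L2 m"
    unfolding V_def divide_inverse
    using L2_diff[OF L2_scale[OF L2_diff[OF sgS S(1)], of "inverse r"] L2_diff[OF L2_scale[OF S(1), of \<beta>] f]]
    by (simp add: mult.commute)
  have "AE x in m. ennreal ((V x)\<^sup>2) \<le> ennreal (2 * c\<^sup>2) * ennreal ((S x)\<^sup>2) + ennreal (2 / r\<^sup>2) * (W x)\<^sup>2"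
    using S(2) sg_eq_transition[OF S(1,3) \<open>0 < r\<close>] transition_cong_AE[OF S(2) \<open>0 < r\<close>]
  proof eventually_elim
    case (elim x)
    define R where "R = (\<integral>\<^sup>+s\<in>{0..<r}. ennreal (exp (- \<beta> * s)) * transition (ennreal s) F x \<partial>lborel)"
    define T where "T = (\<integral>\<^sup>+s\<in>{r..}. ennreal (exp (- \<beta> * s)) * transition (ennreal s) F x \<partial>lborel)"
    have "potential \<beta> F x = (\<integral>\<^sup>+s. (ennreal (exp (- \<beta> * s)) * transition (ennreal s) F x * indicator {0..<r} s
         + ennreal (exp (- \<beta> * s)) * transition (ennreal s) F x * indicator {r..} s) \<partial>lborel)"
      unfolding potential_eq_transition[OF Fm] using \<open>0 < r\<close>
      by (intro nn_integral_cong) (auto split: split_indicator)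
    also have "\<dots> = R + T" unfolding R_def T_def by (rule nn_integral_add) measurable
    finally have SRT: "ennreal (S x) = R + T" using elim by simp
    have fin: "R < \<top>" "T < \<top>" using SRT by (metis ennreal_less_top ennreal_add_eq_top less_top)+
    define R' where "R' = enn2real R"
    have R': "R = ennreal R'" "0 \<le> R'" using fin by (auto simp: R'_def)
    have tr: "transition (ennreal r) (potential \<beta> F) x = ennreal (sg r S x)" and sg_nonneg: "0 \<le> sg r S x"
      using elim by auto
    have T: "T = ennreal (exp (- \<beta> * r) * sg r S x)"
      using transition_potential[OF Fm, of r \<beta> x] \<open>0 < r\<close> by (simp add: T_def tr ennreal_mult sg_nonneg)
    have "S x = R' + exp (- \<beta> * r) * sg r S x"
      using SRT unfolding R'(1) T using R'(2) sg_nonneg S(3)[of x]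
      by (simp add: ennreal_plus[symmetric] del: ennreal_plus)
    then have sg_S: "sg r S x = exp (\<beta> * r) * (S x - R')"
      by (simp add: exp_minus field_simps)
    have Vx: "V x = c * S x - (exp (\<beta> * r) * R' - r * f x) / r"
      using \<open>0 < r\<close> unfolding V_def sg_S c_def by (simp add: field_simps)
    have R_AE: "AE s in lborel. ennreal (exp (- \<beta> * s)) * transition (ennreal s) F x * indicator {0..<r} s \<noteq> \<infinity>"
      using fin(1) unfolding R_def by (intro nn_integral_PInf_AE) auto
    have a: "(\<integral>\<^sup>+s. ennreal (exp (\<beta> * (r - s)) * q s x * indicator {0..<r} s) \<partial>lborel) = ennreal (exp (\<beta> * r) * R')"
    proof -
      have "(\<integral>\<^sup>+s. ennreal (exp (\<beta> * (r - s)) * q s x * indicator {0..<r} s) \<partial>lborel)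
         = (\<integral>\<^sup>+s. ennreal (exp (\<beta> * r)) * (ennreal (exp (- \<beta> * s)) * transition (ennreal s) F x * indicator {0..<r} s) \<partial>lborel)"
      proof (intro nn_integral_cong_AE, use R_AE in eventually_elim)
        fix s assume s: "ennreal (exp (- \<beta> * s)) * transition (ennreal s) F x * indicator {0..<r} s \<noteq> \<infinity>"
        show "ennreal (exp (\<beta> * (r - s)) * q s x * indicator {0..<r} s)
          = ennreal (exp (\<beta> * r)) * (ennreal (exp (- \<beta> * s)) * transition (ennreal s) F x * indicator {0..<r} s)"
        proof (cases "s \<in> {0..<r}")
          case True
          then have "transition (ennreal s) F x \<noteq> \<top>" using s by (auto simp: ennreal_mult_eq_top_iff)
          then have "transition (ennreal s) F x = ennreal (q s x)" by (simp add: q_def less_top)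
          then show ?thesis using True q_nonneg
            by (simp add: ennreal_mult[symmetric] exp_add[symmetric] right_diff_distrib mult.assoc[symmetric] exp_diff exp_minus divide_inverse)
        qed simp
      qed
      also have "\<dots> = ennreal (exp (\<beta> * r)) * R" unfolding R_def by (rule nn_integral_cmult) measurable
      finally show ?thesis by (simp add: R' ennreal_mult)
    qed
    have b: "(\<integral>\<^sup>+s. ennreal (f x * indicator {0..<r} s) \<partial>lborel) = ennreal (r * f x)"
    proof -
      have "(\<integral>\<^sup>+s. ennreal (f x * indicator {0..<r} s) \<partial>lborel) = (\<integral>\<^sup>+s. ennreal (f x) * indicator {0..<r} s \<partial>lborel)"
        by (intro nn_integral_cong) (auto split: split_indicator)
      also have "\<dots> = ennreal (f x) * ennreal r" using \<open>0 < r\<close> by (simp add: nn_integral_cmult)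
      finally show ?thesis using pos \<open>0 < r\<close> by (simp add: ennreal_mult[symmetric] mult.commute)
    qed
    have "ennreal \<bar>exp (\<beta> * r) * R' - r * f x\<bar>
       \<le> (\<integral>\<^sup>+s. ennreal \<bar>exp (\<beta> * (r - s)) * q s x * indicator {0..<r} s - f x * indicator {0..<r} s\<bar> \<partial>lborel)"
      using R'(2) pos \<open>0 < r\<close> q_nonneg by (intro abs_diff_nn_integral_le[OF _ _ _ _ a b]) auto
    also have "\<dots> = W x"
      unfolding W_def k_def by (intro nn_integral_cong) (auto split: split_indicator)
    finally have W: "ennreal \<bar>exp (\<beta> * r) * R' - r * f x\<bar> \<le> W x" .
    have "(V x)\<^sup>2 \<le> 2 * (c * S x)\<^sup>2 + 2 * ((exp (\<beta> * r) * R' - r * f x) / r)\<^sup>2"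
      unfolding Vx using sum_power2_le[of "c * S x" "- ((exp (\<beta> * r) * R' - r * f x) / r)"] by simp
    also have "\<dots> = (2 * c\<^sup>2) * (S x)\<^sup>2 + (2 / r\<^sup>2) * \<bar>exp (\<beta> * r) * R' - r * f x\<bar>\<^sup>2"
      by (simp add: power_mult_distrib power_divide)
    finally have "ennreal ((V x)\<^sup>2) \<le> ennreal (2 * c\<^sup>2) * ennreal ((S x)\<^sup>2) + ennreal (2 / r\<^sup>2) * (ennreal \<bar>exp (\<beta> * r) * R' - r * f x\<bar>)\<^sup>2"
      by (simp add: ennreal_mult[symmetric] ennreal_power ennreal_plus[symmetric] del: ennreal_plus power2_abs) 
    also have "\<dots> \<le> ennreal (2 * c\<^sup>2) * ennreal ((S x)\<^sup>2) + ennreal (2 / r\<^sup>2) * (W x)\<^sup>2"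
      by (intro add_left_mono mult_left_mono power_mono W) auto
    finally show ?case .
  qed
  then have "(\<integral>\<^sup>+x. ennreal ((V x)\<^sup>2) \<partial>m) \<le> (\<integral>\<^sup>+x. ennreal (2 * c\<^sup>2) * ennreal ((S x)\<^sup>2) + ennreal (2 / r\<^sup>2) * (W x)\<^sup>2 \<partial>m)"
    by (rule nn_integral_mono_AE)
  also have "\<dots> = ennreal (2 * c\<^sup>2) * (\<integral>\<^sup>+x. ennreal ((S x)\<^sup>2) \<partial>m) + ennreal (2 / r\<^sup>2) * (\<integral>\<^sup>+x. (W x)\<^sup>2 \<partial>m)"
    unfolding W_def by (subst nn_integral_add) (auto simp: nn_integral_cmult)
  also have "(\<integral>\<^sup>+x. ennreal ((S x)\<^sup>2) \<partial>m) = ennreal (L2_inner m S S)"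
    using ennreal_L2_inner_self[OF S(1)] by simp
  finally have 1: "(\<integral>\<^sup>+x. ennreal ((V x)\<^sup>2) \<partial>m) \<le> ennreal (2 * c\<^sup>2 * L2_inner m S S) + ennreal (2 / r\<^sup>2) * (\<integral>\<^sup>+x. (W x)\<^sup>2 \<partial>m)"
    by (simp add: ennreal_mult L2_inner_self_nonneg)
  define b where "b = 2 * (exp (\<beta> * r))\<^sup>2 * \<epsilon> + 2 * (exp (\<beta> * r) - 1)\<^sup>2 * L2_inner m f f"
  have W2: "(W x)\<^sup>2 \<le> ennreal r * (\<integral>\<^sup>+s. ennreal ((k s x)\<^sup>2) * indicator {0..<r} s \<partial>lborel)" for x
  proof -
    have "W x = (\<integral>\<^sup>+s. indicator {0..<r} s * (ennreal (k s x) * indicator {0..<r} s) \<partial>lborel)"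
      unfolding W_def by (intro nn_integral_cong) (auto split: split_indicator)
    also have "\<dots>\<^sup>2 \<le> (\<integral>\<^sup>+s. (indicator {0..<r} s)\<^sup>2 \<partial>lborel) * (\<integral>\<^sup>+s. (ennreal (k s x) * indicator {0..<r} s)\<^sup>2 \<partial>lborel)"
      by (rule Cauchy_Schwarz_nn_integral) measurable
    also have "(\<integral>\<^sup>+s. (indicator {0..<r} s)\<^sup>2 \<partial>lborel) = (\<integral>\<^sup>+s. indicator {0..<r} s \<partial>(lborel :: real measure))"
      by (intro nn_integral_cong) (auto split: split_indicator)
    also have "\<dots> = ennreal r" using \<open>0 < r\<close> by simp
    also have "(\<integral>\<^sup>+s. (ennreal (k s x) * indicator {0..<r} s)\<^sup>2 \<partial>lborel) = (\<integral>\<^sup>+s. ennreal ((k s x)\<^sup>2) * indicator {0..<r} s \<partial>lborel)"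
      by (intro nn_integral_cong) (auto simp: ennreal_power k_nonneg split: split_indicator)
    finally show ?thesis .
  qed
  have kb: "(\<integral>\<^sup>+x. ennreal ((k s x)\<^sup>2) \<partial>m) \<le> ennreal b" if s: "0 < s" "s < r" for s
  proof -
    have d: "(\<lambda>x. sg s f x - f x) \<in> L2 m" by (intro L2_diff sg_L2 f s)
    have e1: "1 \<le> exp (\<beta> * (r - s))" "exp (\<beta> * (r - s)) \<le> exp (\<beta> * r)" using s \<open>0 < \<beta>\<close> by auto
    have "AE x in m. ennreal ((k s x)\<^sup>2) \<le> ennreal (2 * (exp (\<beta> * r))\<^sup>2) * ennreal ((sg s f x - f x)\<^sup>2) + ennreal (2 * (exp (\<beta> * r) - 1)\<^sup>2) * ennreal ((f x)\<^sup>2)"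
      using sg_eq_transition[OF f pos s(1)]
    proof eventually_elim
      case (elim x)
      then have q: "q s x = sg s f x" by (simp add: q_def F_def)
      have "k s x = \<bar>exp (\<beta> * (r - s)) * (sg s f x - f x) + (exp (\<beta> * (r - s)) - 1) * f x\<bar>"
        unfolding k_def q by (simp add: algebra_simps)
      then have "(k s x)\<^sup>2 \<le> 2 * (exp (\<beta> * (r - s)) * (sg s f x - f x))\<^sup>2 + 2 * ((exp (\<beta> * (r - s)) - 1) * f x)\<^sup>2"
        using sum_power2_le[of "exp (\<beta> * (r - s)) * (sg s f x - f x)" "(exp (\<beta> * (r - s)) - 1) * f x"] by simp
      also have "\<dots> \<le> 2 * ((exp (\<beta> * r))\<^sup>2 * (sg s f x - f x)\<^sup>2) + 2 * ((exp (\<beta> * r) - 1)\<^sup>2 * (f x)\<^sup>2)"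
        unfolding power_mult_distrib using e1
        by (intro add_mono mult_left_mono mult_right_mono power_mono) auto
      finally show ?case
        by (simp add: ennreal_mult[symmetric] ennreal_plus[symmetric] mult.assoc del: ennreal_plus)
    qed
    then have "(\<integral>\<^sup>+x. ennreal ((k s x)\<^sup>2) \<partial>m) \<le> (\<integral>\<^sup>+x. ennreal (2 * (exp (\<beta> * r))\<^sup>2) * ennreal ((sg s f x - f x)\<^sup>2) + ennreal (2 * (exp (\<beta> * r) - 1)\<^sup>2) * ennreal ((f x)\<^sup>2) \<partial>m)"
      by (rule nn_integral_mono_AE)
    also have "\<dots> = ennreal (2 * (exp (\<beta> * r))\<^sup>2) * (\<integral>\<^sup>+x. ennreal ((sg s f x - f x)\<^sup>2) \<partial>m) + ennreal (2 * (exp (\<beta> * r) - 1)\<^sup>2) * (\<integral>\<^sup>+x. ennreal ((f x)\<^sup>2) \<partial>m)"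
      using L2_measurable[OF d] by (subst nn_integral_add) (auto simp: nn_integral_cmult)
    also have "\<dots> = ennreal (2 * (exp (\<beta> * r))\<^sup>2 * L2_inner m (\<lambda>x. sg s f x - f x) (\<lambda>x. sg s f x - f x) + 2 * (exp (\<beta> * r) - 1)\<^sup>2 * L2_inner m f f)"
      unfolding ennreal_L2_inner_self[OF d, symmetric] ennreal_L2_inner_self[OF f, symmetric]
      by (simp add: ennreal_mult L2_inner_self_nonneg)
    also have "\<dots> \<le> ennreal b"
      unfolding b_def using close[OF s] by (intro ennreal_leI add_right_mono mult_left_mono) (auto simp: L2_norm_power2)
    finally show ?thesis .
  qed
  have b_nonneg: "0 \<le> b"
  proof -
    have "0 \<le> (L2_norm m (\<lambda>x. sg (r/2) f x - f x))\<^sup>2" by simp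
    then have "0 \<le> \<epsilon>" using close[of "r/2"] \<open>0 < r\<close> by linarith
    then show ?thesis unfolding b_def by (simp add: L2_inner_self_nonneg)
  qed
  have "(\<integral>\<^sup>+x. (W x)\<^sup>2 \<partial>m) \<le> (\<integral>\<^sup>+x. ennreal r * (\<integral>\<^sup>+s. ennreal ((k s x)\<^sup>2) * indicator {0..<r} s \<partial>lborel) \<partial>m)"
    by (intro nn_integral_mono W2)
  also have "\<dots> = ennreal r * (\<integral>\<^sup>+x. \<integral>\<^sup>+s. ennreal ((k s x)\<^sup>2) * indicator {0..<r} s \<partial>lborel \<partial>m)"
    by (rule nn_integral_cmult) measurable
  also have "(\<integral>\<^sup>+x. \<integral>\<^sup>+s. ennreal ((k s x)\<^sup>2) * indicator {0..<r} s \<partial>lborel \<partial>m)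
     = (\<integral>\<^sup>+s. \<integral>\<^sup>+x. ennreal ((k s x)\<^sup>2) * indicator {0..<r} s \<partial>m \<partial>lborel)"
    by (rule Fubini') measurable
  also have "\<dots> \<le> (\<integral>\<^sup>+s. ennreal b * indicator {0..<r} s \<partial>lborel)"
  proof (intro nn_integral_mono_AE, use AE_lborel_singleton[of "0::real"] in eventually_elim)
    fix s :: real assume "s \<noteq> 0"
    then show "(\<integral>\<^sup>+x. ennreal ((k s x)\<^sup>2) * indicator {0..<r} s \<partial>m) \<le> ennreal b * indicator {0..<r} s"
      using kb[of s] by (auto split: split_indicator)
  qed
  also have "\<dots> = ennreal b * ennreal r" using \<open>0 < r\<close> by (simp add: nn_integral_cmult)
  finally have 2: "(\<integral>\<^sup>+x. (W x)\<^sup>2 \<partial>m) \<le> ennreal (r * (b * r))"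
    using b_nonneg \<open>0 < r\<close> by (simp add: ennreal_mult mult_left_mono)
  have "ennreal ((L2_norm m V)\<^sup>2) = (\<integral>\<^sup>+x. ennreal ((V x)\<^sup>2) \<partial>m)"
    by (simp add: L2_norm_power2 ennreal_L2_inner_self[OF VL2])
  also have "\<dots> \<le> ennreal (2 * c\<^sup>2 * L2_inner m S S) + ennreal (2 / r\<^sup>2) * ennreal (r * (b * r))"
    using 1 by (rule order_trans) (intro add_left_mono mult_left_mono 2, simp)
  also have "\<dots> = ennreal (2 * c\<^sup>2 * L2_inner m S S + (2 / r\<^sup>2) * (r * (b * r)))"
    using b_nonneg \<open>0 < r\<close> by (simp add: ennreal_mult[symmetric] L2_inner_self_nonneg ennreal_plus[symmetric] del: ennreal_plus)
  finally have "(L2_norm m V)\<^sup>2 \<le> 2 * c\<^sup>2 * L2_inner m S S + (2 / r\<^sup>2) * (r * (b * r))"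
    using b_nonneg \<open>0 < r\<close> by (subst (asm) ennreal_le_iff) (auto simp: L2_inner_self_nonneg)
  also have "(2 / r\<^sup>2) * (r * (b * r)) = 2 * b" using \<open>0 < r\<close> by (simp add: power2_eq_square)
  finally show ?thesis
    unfolding V_def S_def c_def b_def by (simp add: algebra_simps)
qed

lemma potential_generator:
  assumes f: "f \<in> L2 m" and pos: "\<And>x. 0 \<le> f x" and "0 < \<beta>"
  shows "generator (rpot \<beta> f) (\<lambda>x. \<beta> * rpot \<beta> f x - f x)"
proof (rule sg_generator)
  let ?S = "rpot \<beta> f"
  show S: "?S \<in> L2 m" by (rule rpot_L2[OF f pos \<open>0 < \<beta>\<close>])
  show "(\<lambda>x. \<beta> * ?S x - f x) \<in> L2 m" by (intro L2_diff L2_scale S f)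
  let ?N = "\<lambda>r. L2_norm m (\<lambda>x. (sg r ?S x - ?S x) / r - (\<beta> * ?S x - f x))"
  define A where "A = L2_inner m ?S ?S"
  define B where "B = L2_inner m f f"
  show "(?N \<longlongrightarrow> 0) (at_right 0)"
  proof (rule tendstoI)
    fix e :: real assume "0 < e"
    define \<epsilon> where "\<epsilon> = e\<^sup>2 / 8"
    have "0 < \<epsilon>" using \<open>0 < e\<close> by (simp add: \<epsilon>_def)
    have "((\<lambda>r. (exp (\<beta> * r) - 1) / r) \<longlongrightarrow> \<beta>) (at 0)"
    proof -
      have "((\<lambda>r. exp (\<beta> * r)) has_field_derivative \<beta>) (at 0)"
        by (auto intro!: derivative_eq_intros)
      then show ?thesis by (simp add: DERIV_def)
    qed
    then have c: "((\<lambda>r. (exp (\<beta> * r) - 1) / r) \<longlongrightarrow> \<beta>) (at_right 0)"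
      by (rule filterlim_mono) (auto simp: at_within_le_at)
    have id: "((\<lambda>r::real. r) \<longlongrightarrow> 0) (at_right 0)" by (rule tendsto_ident_at)
    have "((\<lambda>r. 2 * ((exp (\<beta> * r) - 1) / r - \<beta>)\<^sup>2 * A + 4 * (exp (\<beta> * r))\<^sup>2 * \<epsilon> + 4 * (exp (\<beta> * r) - 1)\<^sup>2 * B)
        \<longlongrightarrow> 2 * (\<beta> - \<beta>)\<^sup>2 * A + 4 * (exp (\<beta> * 0))\<^sup>2 * \<epsilon> + 4 * (exp (\<beta> * 0) - 1)\<^sup>2 * B) (at_right 0)"
      by (intro tendsto_intros c id)
    then have "((\<lambda>r. 2 * ((exp (\<beta> * r) - 1) / r - \<beta>)\<^sup>2 * A + 4 * (exp (\<beta> * r))\<^sup>2 * \<epsilon> + 4 * (exp (\<beta> * r) - 1)\<^sup>2 * B)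
        \<longlongrightarrow> 4 * \<epsilon>) (at_right 0)" by simp
    moreover have "4 * \<epsilon> < e\<^sup>2" using \<open>0 < e\<close> by (simp add: \<epsilon>_def)
    ultimately have ev1: "\<forall>\<^sub>F r in at_right 0. 2 * ((exp (\<beta> * r) - 1) / r - \<beta>)\<^sup>2 * A + 4 * (exp (\<beta> * r))\<^sup>2 * \<epsilon> + 4 * (exp (\<beta> * r) - 1)\<^sup>2 * B < e\<^sup>2"
      by (rule order_tendstoD(2))
    have "((\<lambda>s. (L2_norm m (\<lambda>x. sg s f x - f x))\<^sup>2) \<longlongrightarrow> 0\<^sup>2) (at_right 0)"
      by (intro tendsto_power sg_continuous f)
    then have "\<forall>\<^sub>F s in at_right 0. (L2_norm m (\<lambda>x. sg s f x - f x))\<^sup>2 < \<epsilon>"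
      using \<open>0 < \<epsilon>\<close> by (intro order_tendstoD(2)) auto
    then obtain d where d: "0 < d" "\<And>s. 0 < s \<Longrightarrow> s < d \<Longrightarrow> (L2_norm m (\<lambda>x. sg s f x - f x))\<^sup>2 < \<epsilon>"
      unfolding eventually_at_right_field by auto
    have ev2: "\<forall>\<^sub>F r in at_right 0. 0 < r \<and> r < d"
      unfolding eventually_at_right_field using d(1) by auto
    show "\<forall>\<^sub>F r in at_right 0. dist (?N r) 0 < e"
      using ev1 ev2
    proof eventually_elim
      case (elim r)
      have "(?N r)\<^sup>2 \<le> 2 * ((exp (\<beta> * r) - 1) / r - \<beta>)\<^sup>2 * A + 4 * (exp (\<beta> * r))\<^sup>2 * \<epsilon> + 4 * (exp (\<beta> * r) - 1)\<^sup>2 * B"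
        unfolding A_def B_def
        by (intro rpot_difference_quotient f pos \<open>0 < \<beta>\<close> less_imp_le d(2)) (use elim in auto)
      also have "\<dots> < e\<^sup>2" by (rule elim)
      finally have "?N r < e" by (rule power2_less_imp_less) (use \<open>0 < e\<close> in simp)
      moreover have "0 \<le> ?N r" by (simp add: L2_norm_def L2_inner_self_nonneg)
      ultimately show ?case by simp
    qed
  qed
qed

lemma rpot_D:
  assumes "f \<in> L2 m" "\<And>x. 0 \<le> f x" "0 < \<beta>"
  shows "rpot \<beta> f \<in> D"
  using potential_generator[OF assms] by (simp add: generator_def)

text \<open>The resolvent equation \<open>\<E>\<^sub>\<beta>(G\<^sub>\<beta> f, w) = (f, w)\<close> for the potential defined by the process.\<close>

lemma rpot_form:
  assumes f: "f \<in> L2 m" "\<And>x. 0 \<le> f x" and "0 < \<beta>" "w \<in> D"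
  shows "\<E> (rpot \<beta> f) w + \<beta> * L2_inner m (rpot \<beta> f) w = L2_inner m f w"
proof -
  have w: "w \<in> L2 m" using D_L2 \<open>w \<in> D\<close> by auto
  have S: "rpot \<beta> f \<in> L2 m" by (rule rpot_L2[OF f \<open>0 < \<beta>\<close>])
  have "\<E> (rpot \<beta> f) w = L2_inner m (\<lambda>x. - (\<beta> * rpot \<beta> f x - f x)) w"
    using potential_generator[OF f \<open>0 < \<beta>\<close>] \<open>w \<in> D\<close> by (simp add: generator_def)
  also have "\<dots> = L2_inner m (\<lambda>x. f x - \<beta> * rpot \<beta> f x) w" by simp
  also have "\<dots> = L2_inner m f w - \<beta> * L2_inner m (rpot \<beta> f) w"
    by (subst L2_inner_diff[OF f(1) L2_scale[OF S] w]) (simp add: L2_inner_scale)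
  finally show ?thesis by simp
qed

end

section \<open>Superharmonic functions are excessive\<close>

lemma L2_tendsto_AE_subseq:
  assumes L2: "\<And>n. u n \<in> L2 m" "v \<in> L2 m"
    and lim: "(\<lambda>n. L2_inner m (\<lambda>x. u n x - v x) (\<lambda>x. u n x - v x)) \<longlonglongrightarrow> 0"
  obtains r :: "nat \<Rightarrow> nat" where "strict_mono r" "AE x in m. (\<lambda>n. u (r n) x) \<longlonglongrightarrow> v x"
proof -
  have d: "(\<lambda>x. u n x - v x) \<in> L2 m" for n by (intro L2_diff L2)
  have "(\<lambda>n. \<integral>x. norm ((u n x - v x)\<^sup>2) \<partial>m) \<longlonglongrightarrow> 0"
    using lim by (simp add: L2_inner_self)
  then obtain r where r: "strict_mono r" "AE x in m. (\<lambda>n. (u (r n) x - v x)\<^sup>2) \<longlonglongrightarrow> 0"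
    using tendsto_L1_AE_subseq[of m "\<lambda>n x. (u n x - v x)\<^sup>2"] L2_square_integrable[OF d] by blast
  have "AE x in m. (\<lambda>n. u (r n) x) \<longlonglongrightarrow> v x"
    using r(2)
  proof eventually_elim
    case (elim x)
    then have "(\<lambda>n. sqrt ((u (r n) x - v x)\<^sup>2)) \<longlonglongrightarrow> sqrt 0" by (rule tendsto_real_sqrt)
    then have "(\<lambda>n. u (r n) x - v x) \<longlonglongrightarrow> 0" by (simp add: tendsto_rabs_zero_iff)
    then show ?case by (simp add: LIM_zero_iff)
  qed
  then show ?thesis using that r(1) by blast
qed

context dirichlet_form
begin

lemma D_in_L2: "u \<in> D \<Longrightarrow> u \<in> L2 m"
  using D_L2 by auto

lemma D_diff: "u \<in> D \<Longrightarrow> v \<in> D \<Longrightarrow> (\<lambda>x. u x - v x) \<in> D"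
  using D_add[of u "\<lambda>x. (-1) * v x"] D_scale[of v "-1"] by simp

lemma form1_add: "u \<in> D \<Longrightarrow> v \<in> D \<Longrightarrow> w \<in> D \<Longrightarrow> form1 (\<lambda>x. u x + v x) w = form1 u w + form1 v w"
  by (simp add: form1_def form_add L2_inner_add D_in_L2)

lemma form1_scale: "u \<in> D \<Longrightarrow> w \<in> D \<Longrightarrow> form1 (\<lambda>x. c * u x) w = c * form1 u w"
  by (simp add: form1_def form_scale L2_inner_scale distrib_left)

lemma form1_diff: "u \<in> D \<Longrightarrow> v \<in> D \<Longrightarrow> w \<in> D \<Longrightarrow> form1 (\<lambda>x. u x - v x) w = form1 u w - form1 v w"
  using form1_add[of u "\<lambda>x. (-1) * v x" w] form1_scale[of v w "-1"] D_scale[of v "-1"] by simp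

lemma form1_sym: "u \<in> D \<Longrightarrow> v \<in> D \<Longrightarrow> form1 u v = form1 v u"
  by (simp add: form1_def form_sym L2_inner_commute)

lemma form1_nonneg: "u \<in> D \<Longrightarrow> 0 \<le> form1 u u"
  by (simp add: form1_def form_nonneg L2_inner_self_nonneg)

lemma L2_inner_le_form1: "u \<in> D \<Longrightarrow> L2_inner m u u \<le> form1 u u"
  by (simp add: form1_def form_nonneg)

lemma form1_cong_AE:
  assumes "u \<in> D" "u' \<in> D" "w \<in> D" "AE x in m. u x = u' x"
  shows "form1 u w = form1 u' w"
proof -
  have "L2_inner m u w = L2_inner m u' w"
    using assms by (intro L2_inner_cong_AE) (auto dest: D_in_L2 L2_measurable)
  then show ?thesis using form_cong[OF assms] by (simp add: form1_def)
qed

lemma form1_quadratic: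
  assumes u: "u \<in> D" and v: "v \<in> D"
  shows "form1 (\<lambda>x. u x + c * v x) (\<lambda>x. u x + c * v x) = form1 u u + 2 * c * form1 u v + c\<^sup>2 * form1 v v"
proof -
  have cv: "(\<lambda>x. c * v x) \<in> D" and s: "(\<lambda>x. u x + c * v x) \<in> D" by (intro D_add D_scale u v)+
  have "form1 (\<lambda>x. u x + c * v x) (\<lambda>x. u x + c * v x)
      = form1 (\<lambda>x. u x + c * v x) u + c * form1 (\<lambda>x. u x + c * v x) v"
    by (simp add: form1_add[OF u cv s] form1_scale[OF v s] form1_sym[OF s u] form1_sym[OF s v])
  also have "\<dots> = form1 u u + c * form1 v u + c * (form1 u v + c * form1 v v)"
    by (simp add: form1_add[OF u cv] form1_scale[OF v] u v)
  finally show ?thesis by (simp add: form1_sym[OF v u] power2_eq_square algebra_simps)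
qed

lemma form1_eq_0_AE:
  assumes "u \<in> D" "form1 u u \<le> 0"
  shows "AE x in m. u x = 0"
  using L2_self_zero_AE[OF D_in_L2[OF assms(1)]] L2_inner_le_form1[OF assms(1)] assms(2) by simp

text \<open>Uniqueness in the Riesz representation.\<close>

lemma form1_unique_AE:
  assumes u: "u \<in> D" and v: "v \<in> D" and eq: "\<And>w. w \<in> D \<Longrightarrow> form1 u w = form1 v w"
  shows "AE x in m. u x = v x"
proof -
  have "(\<lambda>x. u x - v x) \<in> D" by (intro D_diff u v)
  then have "AE x in m. u x - v x = 0"
    using eq[of "\<lambda>x. u x - v x"] by (intro form1_eq_0_AE) (auto simp: form1_diff u v)
  then show ?thesis by simp
qed

end

context dirichlet_hunt
begin

lemma L2_pos_part:
  assumes "f \<in> L2 m"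
  shows "(\<lambda>x. max 0 (f x)) \<in> L2 m"
proof -
  have [measurable]: "f \<in> borel_measurable m" by (rule L2_measurable) fact
  have "(\<integral>\<^sup>+x. ennreal ((max 0 (f x))\<^sup>2) \<partial>m) \<le> (\<integral>\<^sup>+x. ennreal ((f x)\<^sup>2) \<partial>m)"
    by (intro nn_integral_mono ennreal_leI) (auto simp: max_def)
  then show ?thesis
    using assms by (subst (asm) L2_iff_nn_integral, simp, subst L2_iff_nn_integral) (auto intro: le_less_trans)
qed

text \<open>A function that pairs nonnegatively with every nonnegative function is nonnegative; test with
  its own negative part.\<close>

lemma nonneg_AE_by_testing:
  assumes z: "z \<in> L2 m" and test: "\<And>f. f \<in> L2 m \<Longrightarrow> (\<And>x. 0 \<le> f x) \<Longrightarrow> 0 \<le> L2_inner m f z"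
  shows "AE x in m. 0 \<le> z x"
proof -
  define f where "f = (\<lambda>x. max 0 (- z x))"
  have f: "f \<in> L2 m" unfolding f_def using L2_scale[OF z, of "-1"] by (intro L2_pos_part) simp
  have "L2_inner m f z = L2_inner m f (\<lambda>x. - f x)"
    unfolding L2_inner_def by (intro Bochner_Integration.integral_cong) (auto simp: f_def max_def)
  also have "\<dots> = - L2_inner m f f" by (simp add: L2_inner_def)
  finally have "L2_inner m f f \<le> 0" using test[OF f] by (simp add: f_def)
  then have "AE x in m. f x = 0" by (rule L2_self_zero_AE[OF f])
  then show ?thesis by eventually_elim (simp add: f_def max_def split: if_splits)
qed

lemma rpot_form1:
  assumes "f \<in> L2 m" "\<And>x. 0 \<le> f x" "w \<in> D"
  shows "form1 (rpot 1 f) w = L2_inner m f w"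
  using rpot_form[OF assms(1,2) _ assms(3), of 1] by (simp add: form1_def)

text \<open>Here and below, superharmonic means \<open>\<E>\<^sub>1(z, w) \<ge> 0\<close> for all \<open>w \<ge> 0\<close> in the form domain. Testing with
  \<open>w = G\<^sub>1 f\<close> turns this into \<open>(f, z) \<ge> 0\<close> for all \<open>f \<ge> 0\<close>.\<close>

lemma superharmonic_nonneg:
  assumes z: "z \<in> D" and sup: "\<And>w. w \<in> D \<Longrightarrow> AE x in m. 0 \<le> w x \<Longrightarrow> 0 \<le> form1 z w"
  shows "AE x in m. 0 \<le> z x"
proof (rule nonneg_AE_by_testing[OF D_in_L2[OF z]])
  fix f assume f: "f \<in> L2 m" "\<And>x. 0 \<le> f x"
  have "0 \<le> form1 z (rpot 1 f)" by (intro sup rpot_D f) (auto simp: rpot_nonneg)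
  then show "0 \<le> L2_inner m f z"
    using rpot_form1[OF f z] form1_sym[OF z rpot_D[OF f, of 1]] by simp
qed

lemma potential_excessive:
  assumes [measurable]: "f \<in> borel_measurable borel" and "0 \<le> t"
  shows "ennreal (exp (- t)) * transition (ennreal t) (potential 1 f) x \<le> potential 1 f x"
proof -
  have "ennreal (exp (- t)) * transition (ennreal t) (potential 1 f) x
      = (\<integral>\<^sup>+s\<in>{t..}. ennreal (exp (- 1 * s)) * transition (ennreal s) f x \<partial>lborel)"
    using transition_potential[OF assms, of 1 x] by simp
  also have "\<dots> \<le> potential 1 f x"
    unfolding potential_eq_transition[OF assms(1)] using \<open>0 \<le> t\<close>
    by (intro nn_integral_mono) (auto split: split_indicator)
  finally show ?thesis .
qed

text \<open>The resolvent approximation \<open>y = \<alpha>G\<^bsub>\<alpha>+1\<^esub>z\<close> of a superharmonic \<open>z\<close> lies below \<open>z\<close>, is the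
  potential of \<open>\<alpha>(z - y) \<ge> 0\<close>, hence excessive, and converges to \<open>z\<close>.\<close>

lemma superharmonic_approx:
  assumes z: "z \<in> D" and pos: "\<And>x. 0 \<le> z x"
    and sup: "\<And>w. w \<in> D \<Longrightarrow> AE x in m. 0 \<le> w x \<Longrightarrow> 0 \<le> form1 z w"
    and "0 < \<alpha>" "0 < t"
  defines "y \<equiv> \<lambda>x. \<alpha> * rpot (\<alpha> + 1) z x"
  shows "AE x in m. ennreal (exp (- t)) * transition (ennreal t) (\<lambda>x. ennreal (y x)) x \<le> ennreal (z x)"
    and "L2_inner m (\<lambda>x. y x - z x) (\<lambda>x. y x - z x) \<le> form1 z z / \<alpha>"
proof -
  let ?S = "rpot (\<alpha> + 1) z"
  have a1: "0 < \<alpha> + 1" using \<open>0 < \<alpha>\<close> by simp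
  have zL: "z \<in> L2 m" by (rule D_in_L2[OF z])
  have S: "?S \<in> D" by (rule rpot_D[OF zL pos a1])
  have y: "y \<in> D" unfolding y_def by (rule D_scale[OF S])
  have yL: "y \<in> L2 m" by (rule D_in_L2[OF y])
  have "AE x in m. 0 \<le> z x - y x"
  proof (rule nonneg_AE_by_testing[OF L2_diff[OF zL yL]])
    fix f assume f: "f \<in> L2 m" "\<And>x. 0 \<le> f x"
    let ?T = "rpot (\<alpha> + 1) f"
    have T: "?T \<in> D" by (rule rpot_D[OF f a1])
    have "0 \<le> form1 z ?T" by (intro sup T) (auto simp: rpot_nonneg)
    also have "\<dots> = form1 ?T z" by (rule form1_sym[OF z T])
    also have "\<dots> = L2_inner m f z - \<alpha> * L2_inner m ?T z"
      using rpot_form[OF f a1 z] by (simp add: form1_def algebra_simps)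
    also have "L2_inner m ?T z = L2_inner m f ?S"
      using rpot_form[OF f a1 S] rpot_form[OF zL pos a1 T]
      by (simp add: form_sym[OF S T] L2_inner_commute[of m ?S] L2_inner_commute[of m z])
    also have "L2_inner m f z - \<alpha> * L2_inner m f ?S = L2_inner m f (\<lambda>x. z x - y x)"
      using L2_inner_diff[OF zL yL f(1)]
      by (simp add: L2_inner_commute[of m f] y_def L2_inner_scale)
    finally show "0 \<le> L2_inner m f (\<lambda>x. z x - y x)" .
  qed
  then have yz: "AE x in m. y x \<le> z x" by simp
  define f where "f = (\<lambda>x. max 0 (\<alpha> * (z x - y x)))"
  have f: "f \<in> L2 m" "\<And>x. 0 \<le> f x"
    unfolding f_def by (intro L2_pos_part L2_scale L2_diff zL yL) simp
  have f_eq: "AE x in m. f x = \<alpha> * (z x - y x)"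
    using yz \<open>0 < \<alpha>\<close> by (auto simp: f_def max_def elim!: eventually_mono)
  have fy: "form1 y w = \<alpha> * (L2_inner m z w - L2_inner m y w)" if w: "w \<in> D" for w
  proof -
    have "form1 y w = \<alpha> * (\<E> ?S w + L2_inner m ?S w)"
      unfolding y_def form1_def form_scale[OF S w] L2_inner_scale by (simp add: distrib_left)
    also have "\<E> ?S w + L2_inner m ?S w = L2_inner m z w - \<alpha> * L2_inner m ?S w"
      using rpot_form[OF zL pos a1 w] by (simp only: distrib_right)
    also have "\<alpha> * L2_inner m ?S w = L2_inner m y w"
      unfolding y_def L2_inner_scale by (rule refl)
    finally show ?thesis .
  qed
  have "AE x in m. rpot 1 f x = y x"
  proof (rule form1_unique_AE[OF rpot_D[OF f] y])
    fix w assume w: "w \<in> D"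
    have wL: "w \<in> L2 m" by (rule D_in_L2[OF w])
    have "form1 (rpot 1 f) w = L2_inner m f w" by (rule rpot_form1[OF f w])
    also have "\<dots> = L2_inner m (\<lambda>x. \<alpha> * (z x - y x)) w"
      using f_eq by (intro L2_inner_cong_AE L2_measurable f(1) wL L2_scale L2_diff zL yL) simp_all
    also have "\<dots> = form1 y w"
      by (simp add: fy[OF w] L2_inner_scale L2_inner_diff[OF zL yL wL])
    finally show "form1 (rpot 1 f) w = form1 y w" .
  qed simp
  then have pot: "AE x in m. ennreal (y x) = potential 1 (\<lambda>y. ennreal (f y)) x"
    using rpot_L2(2)[OF f, of 1] by auto
  have [measurable]: "f \<in> borel_measurable borel" by (rule L2_borel[OF f(1)])
  show "AE x in m. ennreal (exp (- t)) * transition (ennreal t) (\<lambda>x. ennreal (y x)) x \<le> ennreal (z x)"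
    using transition_cong_AE[OF pot \<open>0 < t\<close>] pot yz
  proof eventually_elim
    case (elim x)
    have "ennreal (exp (- t)) * transition (ennreal t) (\<lambda>x. ennreal (y x)) x \<le> potential 1 (\<lambda>y. ennreal (f y)) x"
      unfolding elim(1) using \<open>0 < t\<close> by (intro potential_excessive) auto
    also have "\<dots> = ennreal (y x)" by (rule elim(2)[symmetric])
    also have "\<dots> \<le> ennreal (z x)" using elim(3) by (rule ennreal_leI)
    finally show ?case .
  qed
  let ?d = "\<lambda>x. y x - z x"
  have d: "?d \<in> D" by (intro D_diff y z)
  have "\<alpha> * L2_inner m ?d ?d = form1 y z - form1 y y"
  proof -
    have "form1 y z - form1 y y = \<alpha> * ((L2_inner m z z - L2_inner m y z) - (L2_inner m z y - L2_inner m y y))"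
      by (simp add: fy z y algebra_simps)
    also have "(L2_inner m z z - L2_inner m y z) - (L2_inner m z y - L2_inner m y y) = L2_inner m ?d ?d"
      using L2_inner_diff[OF yL zL L2_diff[OF yL zL]] L2_inner_diff[OF yL zL yL] L2_inner_diff[OF yL zL zL]
      by (simp add: L2_inner_commute[of m y ?d] L2_inner_commute[of m z ?d])
    finally show ?thesis by simp
  qed
  moreover have "0 \<le> form1 z z + 2 * (-1) * form1 z y + (-1)\<^sup>2 * form1 y y"
    unfolding form1_quadratic[OF z y, of "-1", symmetric] using D_diff[OF z y] by (intro form1_nonneg) simp
  ultimately have "\<alpha> * L2_inner m ?d ?d \<le> form1 z z"
    using form1_nonneg[OF y] form1_nonneg[OF z] form1_sym[OF z y] by simp
  then show "L2_inner m ?d ?d \<le> form1 z z / \<alpha>" using \<open>0 < \<alpha>\<close> by (simp add: field_simps)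
qed

text \<open>Let \<open>\<alpha> \<rightarrow> \<infinity>\<close> in the resolvent approximation, along a subsequence that converges almost everywhere; Fatou's
  lemma under \<open>P\<^sub>x\<close> carries the inequality to the limit.\<close>

lemma superharmonic_excessive_nonneg:
  assumes z: "z \<in> D" and pos: "\<And>x. 0 \<le> z x"
    and sup: "\<And>w. w \<in> D \<Longrightarrow> AE x in m. 0 \<le> w x \<Longrightarrow> 0 \<le> form1 z w" and "0 < t"
  shows "AE x in m. ennreal (exp (- t)) * transition (ennreal t) (\<lambda>x. ennreal (z x)) x \<le> ennreal (z x)"
proof -
  define y where "y = (\<lambda>(n::nat) x. real (Suc n) * rpot (real (Suc n) + 1) z x)"
  have yD: "y n \<in> D" for n
    unfolding y_def by (intro D_scale rpot_D D_in_L2 z pos) simp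
  have [measurable]: "y n \<in> borel_measurable borel" "z \<in> borel_measurable borel" for n
    by (intro L2_borel D_in_L2 yD z)+
  have a1: "AE x in m. ennreal (exp (- t)) * transition (ennreal t) (\<lambda>x. ennreal (y n x)) x \<le> ennreal (z x)"
    and a2: "L2_inner m (\<lambda>x. y n x - z x) (\<lambda>x. y n x - z x) \<le> form1 z z / real (Suc n)" for n
    unfolding y_def
  proof -
    have a: "0 < real (Suc n)" by simp
    note r = superharmonic_approx[where z = z and \<alpha> = "real (Suc n)" and t = t, OF z pos _ a \<open>0 < t\<close>]
    show "AE x in m. ennreal (exp (- t)) * transition (ennreal t) (\<lambda>x. ennreal (real (Suc n) * rpot (real (Suc n) + 1) z x)) x \<le> ennreal (z x)"
      by (rule r(1)) (erule (1) sup)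
    show "L2_inner m (\<lambda>x. real (Suc n) * rpot (real (Suc n) + 1) z x - z x) (\<lambda>x. real (Suc n) * rpot (real (Suc n) + 1) z x - z x) \<le> form1 z z / real (Suc n)"
      by (rule r(2)) (erule (1) sup)
  qed
  have "(\<lambda>n. L2_inner m (\<lambda>x. y n x - z x) (\<lambda>x. y n x - z x)) \<longlonglongrightarrow> 0"
  proof (rule tendsto_sandwich[OF _ _ tendsto_const])
    show "\<forall>\<^sub>F n in sequentially. L2_inner m (\<lambda>x. y n x - z x) (\<lambda>x. y n x - z x) \<le> form1 z z / real (Suc n)"
      by (intro always_eventually allI a2)
    show "(\<lambda>n. form1 z z / real (Suc n)) \<longlonglongrightarrow> 0" by (rule LIMSEQ_Suc[OF lim_const_over_n])
  qed (simp add: L2_inner_self_nonneg)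
  then obtain r :: "nat \<Rightarrow> nat" where r: "AE x in m. (\<lambda>n. y (r n) x) \<longlonglongrightarrow> z x"
    by (rule L2_tendsto_AE_subseq[OF D_in_L2[OF yD] D_in_L2[OF z]])
  have "AE x in m. \<forall>n. ennreal (exp (- t)) * transition (ennreal t) (\<lambda>x. ennreal (y (r n) x)) x \<le> ennreal (z x)"
    unfolding AE_all_countable by (intro allI a1)
  with AE_law[OF r \<open>0 < t\<close>] show ?thesis
  proof eventually_elim
    case (elim x)
    have "AE \<omega> in P (Some x). \<forall>z'. X (ennreal t) \<omega> = Some z' \<longrightarrow> (\<lambda>n. y (r n) z') \<longlonglongrightarrow> z z'"
      using elim(1) unfolding law_def by (rule AE_distrD[rotated]) simp
    then have "transition (ennreal t) (\<lambda>x. ennreal (z x)) x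
       = (\<integral>\<^sup>+\<omega>. liminf (\<lambda>n. case_option 0 (\<lambda>x. ennreal (y (r n) x)) (X (ennreal t) \<omega>)) \<partial>P (Some x))"
      unfolding transition_def
    proof (intro nn_integral_cong_AE, eventually_elim)
      fix \<omega> assume *: "\<forall>z'. X (ennreal t) \<omega> = Some z' \<longrightarrow> (\<lambda>n. y (r n) z') \<longlonglongrightarrow> z z'"
      show "case_option 0 (\<lambda>x. ennreal (z x)) (X (ennreal t) \<omega>) = liminf (\<lambda>n. case_option 0 (\<lambda>x. ennreal (y (r n) x)) (X (ennreal t) \<omega>))"
      proof (cases "X (ennreal t) \<omega>")
        case (Some z')
        then have "(\<lambda>n. ennreal (y (r n) z')) \<longlonglongrightarrow> ennreal (z z')" using * by (intro tendsto_ennrealI) auto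
        then have "liminf (\<lambda>n. ennreal (y (r n) z')) = ennreal (z z')" by (rule lim_imp_Liminf[OF sequentially_bot])
        then show ?thesis using Some by simp
      qed (simp add: Liminf_const)
    qed
    also have "\<dots> \<le> liminf (\<lambda>n. transition (ennreal t) (\<lambda>x. ennreal (y (r n) x)) x)"
      unfolding transition_def by (intro nn_integral_liminf) measurable
    finally have "transition (ennreal t) (\<lambda>x. ennreal (z x)) x \<le> liminf (\<lambda>n. transition (ennreal t) (\<lambda>x. ennreal (y (r n) x)) x)" .
    moreover have "transition (ennreal t) (\<lambda>x. ennreal (y (r n) x)) x \<le> ennreal (exp t) * ennreal (z x)" for n
    proof -
      have "ennreal (exp t) * (ennreal (exp (- t)) * transition (ennreal t) (\<lambda>x. ennreal (y (r n) x)) x) \<le> ennreal (exp t) * ennreal (z x)"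
        using elim(2) by (intro mult_left_mono) auto
      then show ?thesis by (simp add: mult.assoc[symmetric] ennreal_mult[symmetric] exp_add[symmetric])
    qed
    then have "liminf (\<lambda>n. transition (ennreal t) (\<lambda>x. ennreal (y (r n) x)) x) \<le> ennreal (exp t) * ennreal (z x)"
      by (intro order_trans[OF Liminf_le_Limsup Limsup_bounded]) auto
    ultimately have "transition (ennreal t) (\<lambda>x. ennreal (z x)) x \<le> ennreal (exp t) * ennreal (z x)" by (rule order_trans)
    then have "ennreal (exp (- t)) * transition (ennreal t) (\<lambda>x. ennreal (z x)) x \<le> ennreal (exp (- t)) * (ennreal (exp t) * ennreal (z x))"
      by (intro mult_left_mono) auto
    then show ?case by (simp add: mult.assoc[symmetric] ennreal_mult[symmetric] exp_add[symmetric])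
  qed
qed

text \<open>The positive part of \<open>z\<close> is another version of \<open>z\<close>, which reduces the claim to everywhere nonnegative
  functions.\<close>

lemma superharmonic_excessive:
  assumes z: "z \<in> D" and sup: "\<And>w. w \<in> D \<Longrightarrow> AE x in m. 0 \<le> w x \<Longrightarrow> 0 \<le> form1 z w" and "0 < t"
  shows "AE x in m. ennreal (exp (- t)) * transition (ennreal t) (\<lambda>x. ennreal (z x)) x \<le> ennreal (z x)"
proof -
  define z' where "z' = (\<lambda>x. max 0 (z x))"
  have ez: "ennreal (z x) = ennreal (z' x)" for x by (auto simp: z'_def max_def ennreal_neg)
  have eq: "AE x in m. z x = z' x"
    using superharmonic_nonneg[OF z sup] by (auto simp: z'_def max_def elim!: eventually_mono)
  have [measurable]: "z \<in> borel_measurable m" by (rule L2_measurable[OF D_in_L2[OF z]])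
  have z': "z' \<in> D" by (rule D_cong[OF z _ eq]) (simp add: z'_def)
  have "AE x in m. ennreal (exp (- t)) * transition (ennreal t) (\<lambda>x. ennreal (z' x)) x \<le> ennreal (z' x)"
  proof (rule superharmonic_excessive_nonneg[OF z' _ _ \<open>0 < t\<close>])
    fix w assume "w \<in> D" "AE x in m. 0 \<le> w x"
    then show "0 \<le> form1 z' w" using sup[of w] form1_cong_AE[OF z z' _ eq] by simp
  qed (simp add: z'_def)
  then show ?thesis unfolding ez .
qed


end

section \<open>Reduced functions and capacity\<close>

context dirichlet_hunt
begin

lemma phi_L2: "\<phi> \<in> L2 m"
proof -
  have i: "integrable m \<phi>" using phi_integral by (rule integrable.intros)
  obtain C where C: "\<And>x. \<bar>\<phi> x\<bar> \<le> C" using phi_bounded by (auto simp: bounded_iff)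
  have "integrable m (\<lambda>x. (\<phi> x)\<^sup>2)"
  proof (rule Bochner_Integration.integrable_bound)
    show "integrable m (\<lambda>x. C * \<phi> x)" using i by simp
    have "norm ((\<phi> x)\<^sup>2) \<le> norm (C * \<phi> x)" for x
      using C[of x] phi_pos[of x] by (simp add: power2_eq_square abs_mult mult_right_mono)
    then show "AE x in m. norm ((\<phi> x)\<^sup>2) \<le> norm (C * \<phi> x)" by simp
  qed (use i in auto)
  then show ?thesis using i by (simp add: L2_def)
qed

lemma h_D: "h \<in> D" and form1_h: "v \<in> D \<Longrightarrow> form1 h v = L2_inner m \<phi> v"
proof -
  have "rpot 1 \<phi> \<in> D \<and> (\<forall>v\<in>D. \<E> (rpot 1 \<phi>) v + 1 * L2_inner m (rpot 1 \<phi>) v = L2_inner m \<phi> v)"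
  proof -
    have pos: "0 \<le> \<phi> x" for x using phi_pos[of x] by simp
    show ?thesis using rpot_D[OF phi_L2 pos] rpot_form[OF phi_L2 pos zero_less_one] by simp
  qed
  then have "h \<in> D \<and> (\<forall>v\<in>D. \<E> h v + 1 * L2_inner m h v = L2_inner m \<phi> v)"
    unfolding h_def resolvent_def
    by (rule someI[where P="\<lambda>u. u \<in> D \<and> (\<forall>v\<in>D. \<E> u v + 1 * L2_inner m u v = L2_inner m \<phi> v)"])
  then show "h \<in> D" "v \<in> D \<Longrightarrow> form1 h v = L2_inner m \<phi> v" by (auto simp: form1_def)
qed

lemma potential_phi_eq_h: "AE x in m. potential 1 (\<lambda>y. ennreal (\<phi> y)) x = ennreal (h x)"
proof -
  have pos: "0 \<le> \<phi> x" for x using phi_pos[of x] by simp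
  have "AE x in m. rpot 1 \<phi> x = h x"
  proof (rule form1_unique_AE[OF _ h_D])
    show "rpot 1 \<phi> \<in> D" by (rule rpot_D[OF phi_L2 pos]) simp
    show "form1 (rpot 1 \<phi>) w = form1 h w" if "w \<in> D" for w
      using rpot_form1[OF phi_L2 pos that] form1_h[OF that] by simp
  qed
  then show ?thesis using rpot_L2(2)[OF phi_L2 pos, of 1] by auto
qed

definition admissible :: "'a set \<Rightarrow> ('a \<Rightarrow> real) \<Rightarrow> bool" where
  "admissible U w \<longleftrightarrow> w \<in> D \<and> (AE x in m. x \<in> U \<longrightarrow> h x \<le> w x)"

lemma h_admissible: "admissible U h"
  by (simp add: admissible_def h_D)

lemma admissible_D: "admissible U w \<Longrightarrow> w \<in> D"
  by (simp add: admissible_def)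

text \<open>The obstacle problem defining the reduced function has a solution: a minimizing sequence is
  Cauchy by the parallelogram identity, and the constraint passes to the limit along an almost
  everywhere convergent subsequence.\<close>

lemma minimizer_exists:
  "\<exists>v. admissible U v \<and> (\<forall>w. admissible U w \<longrightarrow> form1 v v \<le> form1 w w)"
proof -
  define d where "d = (INF w\<in>Collect (admissible U). form1 w w)"
  have bdd: "bdd_below ((\<lambda>w. form1 w w) ` Collect (admissible U))"
    by (intro bdd_belowI[of _ 0]) (auto intro: form1_nonneg admissible_D)
  have d_le: "d \<le> form1 w w" if "admissible U w" for w
    unfolding d_def using bdd that by (intro cINF_lower) auto
  have "\<exists>w. admissible U w \<and> form1 w w < d + 1 / real (Suc n)" for n
  proof (rule ccontr)
    assume "\<not> ?thesis"
    then have ge: "d + 1 / real (Suc n) \<le> form1 w w" if "admissible U w" for w using that not_less by blast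
    have "d + 1 / real (Suc n) \<le> (INF w\<in>Collect (admissible U). form1 w w)"
      using h_admissible by (intro cINF_greatest ge) auto
    then show False unfolding d_def[symmetric] by simp
  qed
  then obtain w where w: "\<And>n. admissible U (w n)" "\<And>n. form1 (w n) (w n) < d + 1 / real (Suc n)"
    by metis
  have wD: "w n \<in> D" for n using w(1) by (rule admissible_D)
  have cauchy: "form1 (\<lambda>x. w i x - w j x) (\<lambda>x. w i x - w j x) \<le> 2 / real (Suc i) + 2 / real (Suc j)" for i j
  proof -
    \<comment> \<open>The mean of two competitors is a competitor; the factor \<open>1\<close> matches \<open>form1_quadratic\<close>.\<close>
    let ?s = "\<lambda>x. (1/2) * (w i x + 1 * w j x)"
    have sD: "(\<lambda>x. w i x + 1 * w j x) \<in> D" by (intro D_add D_scale wD)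
    have "AE x in m. x \<in> U \<longrightarrow> h x \<le> w i x" "AE x in m. x \<in> U \<longrightarrow> h x \<le> w j x"
      using w(1) unfolding admissible_def by blast+
    then have "AE x in m. x \<in> U \<longrightarrow> h x \<le> ?s x" by eventually_elim auto
    then have "admissible U ?s" unfolding admissible_def by (intro conjI D_scale sD)
    then have "d \<le> form1 ?s ?s" by (rule d_le)
    also have "\<dots> = (1/4) * form1 (\<lambda>x. w i x + 1 * w j x) (\<lambda>x. w i x + 1 * w j x)"
    proof -
      have "form1 ?s ?s = (1/2) * form1 (\<lambda>x. w i x + 1 * w j x) ?s" by (rule form1_scale[OF sD D_scale[OF sD]])
      also have "form1 (\<lambda>x. w i x + 1 * w j x) ?s = form1 ?s (\<lambda>x. w i x + 1 * w j x)"
        by (rule form1_sym[OF sD D_scale[OF sD]])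
      also have "\<dots> = (1/2) * form1 (\<lambda>x. w i x + 1 * w j x) (\<lambda>x. w i x + 1 * w j x)"
        by (rule form1_scale[OF sD sD])
      finally show ?thesis by simp
    qed
    finally have "4 * d \<le> form1 (w i) (w i) + 2 * form1 (w i) (w j) + form1 (w j) (w j)"
      unfolding form1_quadratic[OF wD wD] by simp
    moreover have "form1 (\<lambda>x. w i x - w j x) (\<lambda>x. w i x - w j x) = form1 (w i) (w i) - 2 * form1 (w i) (w j) + form1 (w j) (w j)"
      using form1_quadratic[OF wD wD, of i "-1" j] by simp
    ultimately show ?thesis using w(2)[of i] w(2)[of j] by (simp add: divide_inverse)
  qed
  have "\<exists>v\<in>D. (\<lambda>n. form1 (\<lambda>x. w n x - v x) (\<lambda>x. w n x - v x)) \<longlonglongrightarrow> 0"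
    unfolding form1_def
  proof (rule closed_form[OF wD])
    fix e :: real assume "0 < e"
    obtain N where N: "1 / real (Suc N) < e / 4" using nat_approx_posE[of "e/4"] \<open>0 < e\<close> by auto
    have N': "1 / real (Suc i) < e / 4" if "N \<le> i" for i
      by (rule le_less_trans[OF _ N]) (use that in \<open>simp add: frac_le\<close>)
    show "\<exists>N. \<forall>i\<ge>N. \<forall>j\<ge>N. \<E> (\<lambda>x. w i x - w j x) (\<lambda>x. w i x - w j x) + L2_inner m (\<lambda>x. w i x - w j x) (\<lambda>x. w i x - w j x) < e"
    proof (intro exI allI impI)
      fix i j assume "N \<le> i" "N \<le> j"
      then show "\<E> (\<lambda>x. w i x - w j x) (\<lambda>x. w i x - w j x) + L2_inner m (\<lambda>x. w i x - w j x) (\<lambda>x. w i x - w j x) < e"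
        using cauchy[of i j] N'[of i] N'[of j] unfolding form1_def by simp
    qed
  qed
  then obtain v where v: "v \<in> D" "(\<lambda>n. form1 (\<lambda>x. w n x - v x) (\<lambda>x. w n x - v x)) \<longlonglongrightarrow> 0" by auto
  have "(\<lambda>n. L2_inner m (\<lambda>x. w n x - v x) (\<lambda>x. w n x - v x)) \<longlonglongrightarrow> 0"
    by (rule tendsto_sandwich[OF _ _ tendsto_const v(2)])
       (intro always_eventually allI L2_inner_self_nonneg L2_inner_le_form1 D_diff wD v(1))+
  then obtain r :: "nat \<Rightarrow> nat" where r: "AE x in m. (\<lambda>n. w (r n) x) \<longlonglongrightarrow> v x"
    by (rule L2_tendsto_AE_subseq[OF D_in_L2[OF wD] D_in_L2[OF v(1)]])
  have "AE x in m. \<forall>n. x \<in> U \<longrightarrow> h x \<le> w (r n) x"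
    unfolding AE_all_countable using w(1) unfolding admissible_def by blast
  with r have "AE x in m. x \<in> U \<longrightarrow> h x \<le> v x"
    by eventually_elim (auto intro: LIMSEQ_le_const)
  then have adm: "admissible U v" by (simp add: admissible_def v)
  \<comment> \<open>The value at the limit exceeds the infimum by an arbitrarily small factor: Young's inequality with weight
    \<open>c\<close> absorbs the mixed term into the vanishing energy of the error.\<close>
  have "form1 v v \<le> (1 + c) * d" if "0 < c" for c
  proof (rule LIMSEQ_le[OF tendsto_const])
    let ?e = "\<lambda>n. form1 (\<lambda>x. w n x - v x) (\<lambda>x. w n x - v x)"
    show "(\<lambda>n. (1 + c) * (d + 1 / real (Suc n)) + (1 / c + 1) * ?e n) \<longlonglongrightarrow> (1 + c) * d"
      using tendsto_add[OF tendsto_mult[OF tendsto_const tendsto_add[OF tendsto_const LIMSEQ_Suc[OF lim_inverse_n']]]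
          tendsto_mult[OF tendsto_const v(2)], of "1 + c" d "1 / c + 1"] by simp
    have "form1 v v \<le> (1 + c) * (d + 1 / real (Suc n)) + (1 / c + 1) * ?e n" for n
    proof -
      have dD: "(\<lambda>x. w n x - v x) \<in> D" by (intro D_diff wD v)
      have "form1 v v = form1 (\<lambda>x. w n x + (-1) * (w n x - v x)) (\<lambda>x. w n x + (-1) * (w n x - v x))" by simp
      also have "\<dots> = form1 (w n) (w n) - 2 * form1 (w n) (\<lambda>x. w n x - v x) + ?e n"
        by (subst form1_quadratic[OF wD dD]) simp
      finally have 1: "form1 v v = \<dots>" .
      have "0 \<le> form1 (w n) (w n) + 2 * (1 / c) * form1 (w n) (\<lambda>x. w n x - v x) + (1 / c)\<^sup>2 * ?e n"
        unfolding form1_quadratic[OF wD dD, symmetric] by (intro form1_nonneg D_add D_scale wD dD)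
      then have "0 \<le> c * (form1 (w n) (w n) + 2 * (1 / c) * form1 (w n) (\<lambda>x. w n x - v x) + (1 / c)\<^sup>2 * ?e n)"
        using that by simp
      also have "\<dots> = c * form1 (w n) (w n) + 2 * form1 (w n) (\<lambda>x. w n x - v x) + (1 / c) * ?e n"
        using that by (simp add: field_simps power2_eq_square)
      finally have "form1 v v \<le> (1 + c) * form1 (w n) (w n) + (1 / c + 1) * ?e n"
        unfolding 1 by (simp add: algebra_simps)
      also have "\<dots> \<le> (1 + c) * (d + 1 / real (Suc n)) + (1 / c + 1) * ?e n"
        using w(2)[of n] that by (intro add_right_mono mult_left_mono) auto
      finally show ?thesis .
    qed
    then show "\<exists>N. \<forall>n\<ge>N. form1 v v \<le> (1 + c) * (d + 1 / real (Suc n)) + (1 / c + 1) * ?e n" by blast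
  qed
  then have "form1 v v \<le> (1 + 1 / real (Suc n)) * d" for n by simp
  moreover have "(\<lambda>n. (1 + 1 / real (Suc n)) * d) \<longlonglongrightarrow> (1 + 0) * d"
    by (intro tendsto_intros LIMSEQ_Suc[OF lim_inverse_n'])
  ultimately have "form1 v v \<le> d" by (intro LIMSEQ_le_const) auto
  then have "form1 v v \<le> form1 w w" if "admissible U w" for w
    using d_le[OF that] by (rule order_trans)
  then show ?thesis using adm by blast
qed

lemma reduced_admissible: "admissible U (reduced U)"
  and reduced_minimal: "admissible U w \<Longrightarrow> form1 (reduced U) (reduced U) \<le> form1 w w"
proof -
  have "\<exists>v. is_arg_min (\<lambda>w. form1 w w) (admissible U) v"
    using minimizer_exists[of U] by (auto simp: is_arg_min_linorder)
  then have "is_arg_min (\<lambda>w. form1 w w) (admissible U) (reduced U)"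
    unfolding reduced_def arg_min_def admissible_def[symmetric] by (rule someI_ex)
  then show "admissible U (reduced U)" "admissible U w \<Longrightarrow> form1 (reduced U) (reduced U) \<le> form1 w w"
    by (auto simp: is_arg_min_linorder)
qed

lemma reduced_D: "reduced U \<in> D"
  using reduced_admissible by (rule admissible_D)

text \<open>The variational inequality: \<open>h\<^sub>U + \<epsilon> w\<close> is a competitor for every \<open>\<epsilon> > 0\<close>.\<close>

lemma reduced_superharmonic:
  assumes w: "w \<in> D" "AE x in m. 0 \<le> w x"
  shows "0 \<le> form1 (reduced U) w"
proof (rule ccontr)
  assume n: "\<not> ?thesis"
  have le: "0 \<le> 2 * form1 (reduced U) w + \<epsilon> * form1 w w" if "0 < \<epsilon>" for \<epsilon>
  proof -
    have "AE x in m. x \<in> U \<longrightarrow> h x \<le> reduced U x"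
      using reduced_admissible unfolding admissible_def by blast
    with w(2) have "AE x in m. x \<in> U \<longrightarrow> h x \<le> reduced U x + \<epsilon> * w x"
      by eventually_elim (use that in \<open>auto intro: add_increasing2\<close>)
    then have "admissible U (\<lambda>x. reduced U x + \<epsilon> * w x)"
      unfolding admissible_def by (intro conjI D_add D_scale reduced_D w(1))
    then have "0 \<le> 2 * \<epsilon> * form1 (reduced U) w + \<epsilon>\<^sup>2 * form1 w w"
      using reduced_minimal[of U "\<lambda>x. reduced U x + \<epsilon> * w x"] form1_quadratic[OF reduced_D w(1), of U \<epsilon>] by simp
    then have "0 \<le> \<epsilon> * (2 * form1 (reduced U) w + \<epsilon> * form1 w w)"
      by (simp add: power2_eq_square algebra_simps)
    then show ?thesis using that by (simp add: zero_le_mult_iff)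
  qed
  show False
  proof (cases "form1 w w = 0")
    case True
    then show False using le[of 1] n by simp
  next
    case False
    then have pos: "0 < form1 w w" using form1_nonneg[OF w(1)] by simp
    then show False using le[of "- form1 (reduced U) w / form1 w w"] n by (simp add: field_simps)
  qed
qed

lemma reduced_nonneg: "AE x in m. 0 \<le> reduced U x"
  by (rule superharmonic_nonneg[OF reduced_D reduced_superharmonic])

lemma reduced_ge_h: "AE x in m. x \<in> U \<longrightarrow> h x \<le> reduced U x"
  using reduced_admissible by (simp add: admissible_def)

lemma Cap_open_nonneg: "0 \<le> Cap_open U"
  unfolding Cap_open_def by (rule form1_nonneg[OF reduced_D])

text \<open>The obstacle condition is an almost everywhere condition, so \<open>m\<close>-null parts of \<open>U\<close> do not matter.\<close>

lemma Cap_open_mono_AE: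
  assumes "AE x in m. x \<in> U \<longrightarrow> x \<in> V"
  shows "Cap_open U \<le> Cap_open V"
  unfolding Cap_open_def
proof (rule reduced_minimal)
  have "AE x in m. x \<in> U \<longrightarrow> h x \<le> reduced V x"
    using reduced_ge_h[of V] assms by eventually_elim auto
  then show "admissible U (reduced V)" unfolding admissible_def by (intro conjI reduced_D)
qed

lemma Cap_open_mono: "U \<subseteq> V \<Longrightarrow> Cap_open U \<le> Cap_open V"
  by (rule Cap_open_mono_AE) auto

text \<open>The sum of the reduced functions of \<open>U\<close> and \<open>V\<close> competes on \<open>U \<union> V\<close>. The factor \<open>2\<close> comes from bounding the
  mixed term by the parallelogram identity, and is harmless for capacities that tend to \<open>0\<close>.\<close>

lemma Cap_open_Un: "Cap_open (U \<union> V) \<le> 2 * Cap_open U + 2 * Cap_open V"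
proof -
  let ?u = "reduced U" and ?v = "reduced V"
  have "AE x in m. x \<in> U \<union> V \<longrightarrow> h x \<le> ?u x + 1 * ?v x"
    using reduced_ge_h[of U] reduced_ge_h[of V] reduced_nonneg[of U] reduced_nonneg[of V]
    by eventually_elim auto
  then have "admissible (U \<union> V) (\<lambda>x. ?u x + 1 * ?v x)"
    unfolding admissible_def by (intro conjI D_add D_scale reduced_D)
  then have "Cap_open (U \<union> V) \<le> form1 (\<lambda>x. ?u x + 1 * ?v x) (\<lambda>x. ?u x + 1 * ?v x)"
    unfolding Cap_open_def by (rule reduced_minimal)
  also have "\<dots> = form1 ?u ?u + 2 * form1 ?u ?v + form1 ?v ?v"
    by (subst form1_quadratic[OF reduced_D reduced_D]) simp
  also have "\<dots> \<le> 2 * form1 ?u ?u + 2 * form1 ?v ?v"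
  proof -
    have "0 \<le> form1 ?u ?u + 2 * (-1) * form1 ?u ?v + (-1)\<^sup>2 * form1 ?v ?v"
      unfolding form1_quadratic[OF reduced_D reduced_D, of U "-1", symmetric]
      by (intro form1_nonneg D_add D_scale reduced_D)
    then show ?thesis by simp
  qed
  finally show ?thesis by (simp add: Cap_open_def)
qed

lemma Cap_nonneg: "0 \<le> Cap B"
  unfolding Cap_def by (rule cINF_greatest) (auto intro: Cap_open_nonneg)

lemma Cap_le: "open U \<Longrightarrow> B \<subseteq> U \<Longrightarrow> Cap B \<le> Cap_open U"
  unfolding Cap_def by (intro cINF_lower bdd_belowI[of _ 0]) (auto intro: Cap_open_nonneg)

lemma Cap_eq_Cap_open: "open U \<Longrightarrow> Cap U = Cap_open U"
  by (rule antisym[OF Cap_le]) (auto simp: Cap_def intro!: cINF_greatest Cap_open_mono)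

lemma Cap_less_open:
  assumes "Cap B < e"
  obtains U where "open U" "B \<subseteq> U" "Cap_open U < e"
proof -
  have "{U. open U \<and> B \<subseteq> U} \<noteq> {}" by auto
  then show ?thesis
    using assms that unfolding Cap_def
    by (subst (asm) cINF_less_iff) (auto intro!: bdd_belowI[of _ 0] Cap_open_nonneg)
qed

end

section \<open>Paths leave sets of vanishing capacity before they die\<close>

text \<open>Finite sets of times are built from the empty set by adding the present time \<open>0\<close> and by waiting for a time
  \<open>t > 0\<close>. These two steps match the two ways in which a visit at given times is analysed: look at the starting
  point, or apply the Markov property.\<close>

lemma finite_times_induct [consumes 2, case_names empty now shift]:
  fixes S :: "real set"
  assumes "finite S" "S \<subseteq> {0..}"
    and empty: "Q {}"
    and now: "\<And>S. finite S \<Longrightarrow> S \<subseteq> {0..} \<Longrightarrow> Q S \<Longrightarrow> Q (insert 0 S)"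
    and shift: "\<And>S t. finite S \<Longrightarrow> S \<subseteq> {0..} \<Longrightarrow> 0 < t \<Longrightarrow> Q S \<Longrightarrow> Q ((\<lambda>s. t + s) ` S)"
  shows "Q S"
  using assms(1,2)
proof (induction "card S" arbitrary: S rule: less_induct)
  case less
  show ?case
  proof (cases "S = {}")
    case False
    define t where "t = Min S"
    define S' where "S' = (\<lambda>s. s - t) ` S - {0}"
    have t: "t \<in> S" "\<And>s. s \<in> S \<Longrightarrow> t \<le> s" using less.prems(1) False by (auto simp: t_def)
    have S': "finite S'" "S' \<subseteq> {0..}" using less.prems t by (auto simp: S'_def)
    have "S' \<subset> (\<lambda>s. s - t) ` S" using t(1) by (auto simp: S'_def)
    then have "card S' < card ((\<lambda>s. s - t) ` S)" using less.prems(1) by (intro psubset_card_mono) auto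
    also have "\<dots> \<le> card S" by (rule card_image_le[OF less.prems(1)])
    finally have "Q S'" using less.hyps S' by blast
    then have Q: "Q (insert 0 S')" using now S' by blast
    have "insert 0 S' = (\<lambda>s. s - t) ` S" using t(1) by (force simp: S'_def)
    then have eq: "(\<lambda>s. t + s) ` insert 0 S' = S" by (simp only: image_image) simp
    show ?thesis
    proof (cases "t = 0")
      case True
      then show ?thesis using Q eq by simp
    next
      case False
      then have "0 < t" using t(1) less.prems(2) by force
      have "Q ((\<lambda>s. t + s) ` insert 0 S')" by (rule shift[OF _ _ \<open>0 < t\<close> Q]) (use S' in auto)
      then show ?thesis unfolding eq .
    qed
  qed (simp add: empty)
qed

lemma countable_finite_chain:
  assumes "countable Q"
  obtains S :: "nat \<Rightarrow> 'b set" where "\<And>n. finite (S n)" "incseq S" "(\<Union>n. S n) = Q"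
proof (cases "Q = {}")
  case True
  show ?thesis by (rule that[of "\<lambda>_. {}"]) (auto simp: True)
next
  case False
  have "(\<Union>n. from_nat_into Q ` {..<n}) = range (from_nat_into Q)" by auto
  then show ?thesis
    using that[of "\<lambda>n. from_nat_into Q ` {..<n}"] range_from_nat_into[OF False assms]
    by (auto simp: incseq_def image_mono)
qed

lemma pred_Bex_countable:
  assumes "countable S" "\<And>q. Measurable.pred M (P q)"
  shows "Measurable.pred M (\<lambda>z. \<exists>q\<in>S. P q z)"
proof -
  have "{z \<in> space M. \<exists>q\<in>S. P q z} = (\<Union>q\<in>S. {z \<in> space M. P q z})" by auto
  also have "\<dots> \<in> sets M" using assms by (intro sets.countable_UN') (auto simp: pred_def)
  finally show ?thesis by (simp add: pred_def)
qed

abbreviation rational_times :: "real set" where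
  "rational_times \<equiv> \<rat> \<inter> {0..}"

lemma countable_rational_times: "countable rational_times"
  by (simp add: countable_rat)

lemma rational_time_between:
  assumes "a < b" "0 \<le> a"
  obtains q where "q \<in> rational_times" "a < q" "q < b"
  using Rats_dense_in_real[OF assms(1)] assms(2) by force

context dirichlet_hunt
begin

text \<open>The inequality \<open>q < t\<close> is strict so that a level \<open>a\<close> of a clock counts as reached after time \<open>q\<close> exactly
  if \<open>A\<^sub>q < a\<close>; for Lebesgue time integrals the difference is a single instant.\<close>

definition visited :: "'a set \<Rightarrow> real set \<Rightarrow> ennreal \<Rightarrow> 'w \<Rightarrow> bool" where
  "visited U S t \<omega> \<longleftrightarrow> (\<exists>q\<in>S. ennreal q < t \<and> X (ennreal q) \<omega> \<in> Some ` U)"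

lemma visited_empty [simp]: "\<not> visited U {} t \<omega>"
  by (simp add: visited_def)

lemma visited_insert_0:
  "X 0 \<omega> = Some x \<Longrightarrow> visited U (insert 0 S) t \<omega> \<longleftrightarrow> x \<in> U \<and> 0 < t \<or> visited U S t \<omega>"
  by (auto simp: visited_def)

lemma visited_shift:
  assumes "S \<subseteq> {0..}" "0 \<le> r"
  shows "visited U ((\<lambda>s. r + s) ` S) (ennreal r + t) \<omega> \<longleftrightarrow> visited U S t (\<theta> (ennreal r) \<omega>)"
proof -
  have "ennreal (r + q) < ennreal r + t \<longleftrightarrow> ennreal q < t"
    and "X (ennreal (r + q)) \<omega> = X (ennreal q) (\<theta> (ennreal r) \<omega>)" if "q \<in> S" for q
    using assms that by (auto simp: subset_iff ennreal_add_left_cancel_less shift)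
  then show ?thesis by (simp add: visited_def cong: bex_cong)
qed

lemma not_visited_early:
  assumes "S \<subseteq> {0..}" "t \<le> ennreal r"
  shows "\<not> visited U ((\<lambda>s. r + s) ` S) t \<omega>"
proof -
  have "t \<le> ennreal (r + q)" if "q \<in> S" for q
    using assms that by (intro order_trans[OF assms(2)] ennreal_leI) auto
  then show ?thesis by (auto simp: visited_def not_less)
qed

lemma measurable_visited [measurable]:
  assumes "U \<in> sets borel" "countable S" and T: "T \<in> borel_measurable M" and W: "W \<in> M \<rightarrow>\<^sub>M natural_events"
  shows "Measurable.pred M (\<lambda>z. visited U S (T z) (W z))"
  unfolding visited_def
proof (intro pred_Bex_countable assms)
  fix q
  note [measurable] = T Some_image_sets[OF assms(1)] measurable_compose[OF W measurable_X_events]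
  show "Measurable.pred M (\<lambda>z. ennreal q < T z \<and> X (ennreal q) (W z) \<in> Some ` U)" by measurable
qed

lemma nn_integral_visited_SUP:
  fixes S :: "nat \<Rightarrow> real set" and k :: "real \<Rightarrow> 'w \<Rightarrow> ennreal"
  assumes S: "incseq S"
    and m1: "\<And>n \<omega>. (\<lambda>a. if visited U (S n) (T a \<omega>) \<omega> then k a \<omega> else 0) \<in> borel_measurable lborel"
    and m2: "\<And>n. (\<lambda>\<omega>. \<integral>\<^sup>+a. (if visited U (S n) (T a \<omega>) \<omega> then k a \<omega> else 0) \<partial>lborel) \<in> borel_measurable M"
  shows "(\<integral>\<^sup>+\<omega>. \<integral>\<^sup>+a. (if visited U (\<Union>n. S n) (T a \<omega>) \<omega> then k a \<omega> else 0) \<partial>lborel \<partial>M)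
    = (SUP n. \<integral>\<^sup>+\<omega>. \<integral>\<^sup>+a. (if visited U (S n) (T a \<omega>) \<omega> then k a \<omega> else 0) \<partial>lborel \<partial>M)"
proof -
  let ?g = "\<lambda>S \<omega> a. if visited U S (T a \<omega>) \<omega> then k a \<omega> else 0"
  have inc: "?g (S i) \<omega> a \<le> ?g (S j) \<omega> a" if "i \<le> j" for i j \<omega> a
    using incseqD[OF S that] by (auto simp: visited_def)
  have sup: "?g (\<Union>n. S n) \<omega> a = (SUP n. ?g (S n) \<omega> a)" for \<omega> a
  proof (rule antisym)
    show "?g (\<Union>n. S n) \<omega> a \<le> (SUP n. ?g (S n) \<omega> a)"
    proof (cases "\<exists>n. visited U (S n) (T a \<omega>) \<omega>")
      case True
      then obtain n where n: "visited U (S n) (T a \<omega>) \<omega>" ..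
      show ?thesis by (rule order_trans[OF _ SUP_upper[of n]]) (simp_all add: n)
    next
      case False
      then have "\<not> visited U (\<Union>n. S n) (T a \<omega>) \<omega>" by (auto simp: visited_def)
      then show ?thesis by simp
    qed
    have "visited U (\<Union>n. S n) (T a \<omega>) \<omega>" if "visited U (S n) (T a \<omega>) \<omega>" for n
      using that by (auto simp: visited_def)
    then show "(SUP n. ?g (S n) \<omega> a) \<le> ?g (\<Union>n. S n) \<omega> a" by (intro SUP_least) auto
  qed
  have "(\<integral>\<^sup>+a. ?g (\<Union>n. S n) \<omega> a \<partial>lborel) = (SUP n. \<integral>\<^sup>+a. ?g (S n) \<omega> a \<partial>lborel)" for \<omega>
    unfolding sup using m1
    by (rule nn_integral_monotone_convergence_SUP[rotated]) (unfold incseq_def le_fun_def, intro allI impI inc)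
  then show ?thesis
    by (simp only:, intro nn_integral_monotone_convergence_SUP m2)
       (unfold incseq_def le_fun_def, intro allI impI nn_integral_mono inc)
qed

definition discounted_after :: "'a set \<Rightarrow> real set \<Rightarrow> 'w \<Rightarrow> ennreal" where
  "discounted_after U S \<omega> = (\<integral>\<^sup>+s. (if visited U S (ennreal s) \<omega>
      then ennreal (exp (- s)) * case_option 0 (\<lambda>y. ennreal (\<phi> y)) (X (ennreal s) \<omega>) else 0) \<partial>lborel)"

lemma measurable_discounted_after_level:
  assumes [measurable]: "U \<in> sets borel" "countable S"
  shows "(\<lambda>s. if visited U S (ennreal s) \<omega> then ennreal (exp (- s)) * case_option 0 (\<lambda>y. ennreal (\<phi> y)) (X (ennreal s) \<omega>) else 0)
    \<in> borel_measurable borel"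
proof -
  note [measurable] = phi_measurable
  have [measurable]: "(\<lambda>_. \<omega>) \<in> borel \<rightarrow>\<^sub>M natural_events" by (rule measurable_const) simp
  show ?thesis by measurable
qed

lemma measurable_discounted_after [measurable]:
  assumes [measurable]: "U \<in> sets borel" "countable S"
  shows "discounted_after U S \<in> borel_measurable natural_events"
proof -
  note [measurable] = phi_measurable
  show ?thesis
    unfolding discounted_after_def
    by (intro lborel.borel_measurable_nn_integral) (simp add: case_prod_unfold, measurable)
qed

lemma discounted_after_shift:
  assumes "0 < t" and S: "S \<subseteq> {0..}" "countable S" and U: "U \<in> sets borel"
  shows "discounted_after U ((\<lambda>s. t + s) ` S) \<omega> = ennreal (exp (- t)) * discounted_after U S (\<theta> (ennreal t) \<omega>)"
proof -
  let ?p = "\<lambda>\<omega> s. case_option 0 (\<lambda>y. ennreal (\<phi> y)) (X (ennreal s) \<omega>)"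
  have "discounted_after U ((\<lambda>s. t + s) ` S) \<omega> = (\<integral>\<^sup>+s. (if visited U ((\<lambda>s. t + s) ` S) (ennreal (t + s)) \<omega>
      then ennreal (exp (- (t + s))) * ?p \<omega> (t + s) else 0) \<partial>lborel)"
    unfolding discounted_after_def
    using nn_integral_real_affine[OF measurable_discounted_after_level[OF U countable_image[OF S(2), of "\<lambda>s. t + s"], of \<omega>] one_neq_zero, of t]
    by (simp only: mult_1 abs_one ennreal_1)
  also have "\<dots> = (\<integral>\<^sup>+s. ennreal (exp (- t)) * (if visited U S (ennreal s) (\<theta> (ennreal t) \<omega>)
      then ennreal (exp (- s)) * ?p (\<theta> (ennreal t) \<omega>) s else 0) \<partial>lborel)"
  proof (intro nn_integral_cong)
    fix s
    show "(if visited U ((\<lambda>s. t + s) ` S) (ennreal (t + s)) \<omega> then ennreal (exp (- (t + s))) * ?p \<omega> (t + s) else 0)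
      = ennreal (exp (- t)) * (if visited U S (ennreal s) (\<theta> (ennreal t) \<omega>) then ennreal (exp (- s)) * ?p (\<theta> (ennreal t) \<omega>) s else 0)"
    proof (cases "0 \<le> s")
      case True
      have "ennreal (t + s) = ennreal t + ennreal s" using True \<open>0 < t\<close> by simp
      moreover have "ennreal (exp (- (t + s))) = ennreal (exp (- t)) * ennreal (exp (- s))"
        by (simp add: ennreal_mult[symmetric] exp_add[symmetric])
      ultimately show ?thesis
        using visited_shift[OF S(1), of t U "ennreal s" \<omega>] \<open>0 < t\<close> by (simp only: shift less_imp_le mult.assoc) simp
    next
      case False
      then have "ennreal (t + s) \<le> ennreal t" "\<not> visited U S (ennreal s) (\<theta> (ennreal t) \<omega>)"
        by (auto simp: visited_def ennreal_neg intro: ennreal_leI)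
      then show ?thesis using not_visited_early[OF S(1)] by simp
    qed
  qed
  also have "\<dots> = ennreal (exp (- t)) * discounted_after U S (\<theta> (ennreal t) \<omega>)"
    unfolding discounted_after_def by (rule nn_integral_cmult) (simp add: measurable_discounted_after_level U S(2))
  finally show ?thesis .
qed

lemma reduced_excessive:
  assumes "0 < t"
  shows "AE x in m. ennreal (exp (- t)) * transition (ennreal t) (\<lambda>x. ennreal (reduced U x)) x \<le> ennreal (reduced U x)"
  by (rule superharmonic_excessive[OF reduced_D reduced_superharmonic assms])

text \<open>The discounted supermartingale \<open>e\<^sup>-\<^sup>t h\<^sub>U(X\<^sub>t)\<close> stopped at the first visit, where it dominates
  \<open>h = G\<^sub>1\<phi>\<close>. At a starting point in \<open>U\<close> the obstacle condition applies; waiting costs nothing because \<open>h\<^sub>U\<close> is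
  excessive.\<close>

lemma expect_discounted_after_le_finite:
  assumes U: "U \<in> sets borel" and "finite S" "S \<subseteq> {0..}"
  shows "AE x in m. (\<integral>\<^sup>+\<omega>. discounted_after U S \<omega> \<partial>P (Some x)) \<le> ennreal (reduced U x)"
  using assms(2,3)
proof (induction rule: finite_times_induct)
  case empty
  then show ?case by (simp add: discounted_after_def)
next
  case (now S)
  note [measurable] = phi_measurable
  show ?case
    using now.IH reduced_ge_h[of U] potential_phi_eq_h
  proof eventually_elim
    case (elim x)
    show ?case
    proof (cases "x \<in> U")
      case True
      have "discounted_after U (insert 0 S) \<omega> \<le> discounted 1 (\<lambda>y. ennreal (\<phi> y)) \<omega>" for \<omega>
        unfolding discounted_after_def discounted_def
        by (intro nn_integral_mono) (auto simp: visited_def ennreal_neg split: split_indicator)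
      then have "(\<integral>\<^sup>+\<omega>. discounted_after U (insert 0 S) \<omega> \<partial>P (Some x)) \<le> potential 1 (\<lambda>y. ennreal (\<phi> y)) x"
        unfolding potential_def by (rule nn_integral_mono)
      also have "\<dots> = ennreal (h x)" by (rule elim(3))
      also have "\<dots> \<le> ennreal (reduced U x)" using elim(2) True by (intro ennreal_leI) simp
      finally show ?thesis .
    next
      case False
      have "(\<integral>\<^sup>+\<omega>. discounted_after U (insert 0 S) \<omega> \<partial>P (Some x)) = (\<integral>\<^sup>+\<omega>. discounted_after U S \<omega> \<partial>P (Some x))"
      proof (intro nn_integral_cong_AE, use normal[of "Some x"] in eventually_elim)
        fix \<omega> assume "X 0 \<omega> = Some x"
        then show "discounted_after U (insert 0 S) \<omega> = discounted_after U S \<omega>"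
          using False by (simp add: discounted_after_def visited_insert_0)
      qed
      then show ?thesis using elim(1) by simp
    qed
  qed
next
  case (shift S t)
  have c: "countable S" using shift(1) by (rule countable_finite)
  have [measurable]: "discounted_after U S \<in> borel_measurable natural_events"
    by (rule measurable_discounted_after[OF U c])
  define e where "e = (\<lambda>x. \<integral>\<^sup>+\<omega>. discounted_after U S \<omega> \<partial>P (Some x))"
  have e [measurable]: "e \<in> borel_measurable borel"
    unfolding e_def by (rule nn_integral_measurable_subprob_algebra2[where N=natural_events]) measurable
  have eq: "(\<integral>\<^sup>+\<omega>. discounted_after U ((\<lambda>s. t + s) ` S) \<omega> \<partial>P (Some x)) = ennreal (exp (- t)) * transition (ennreal t) e x" for x
  proof -
    have "(\<integral>\<^sup>+\<omega>. discounted_after U ((\<lambda>s. t + s) ` S) \<omega> \<partial>P (Some x))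
        = ennreal (exp (- t)) * (\<integral>\<^sup>+\<omega>. discounted_after U S (\<theta> (ennreal t) \<omega>) \<partial>P (Some x))"
      unfolding discounted_after_shift[OF shift(3,2) c U] by (rule nn_integral_cmult) measurable
    also have "(\<integral>\<^sup>+\<omega>. discounted_after U S (\<theta> (ennreal t) \<omega>) \<partial>P (Some x)) = transition (ennreal t) e x"
      unfolding nn_integral_law[OF e, symmetric] unfolding e_def
    proof (rule nn_integral_shift_alive)
      show "discounted_after U S \<in> borel_measurable (completion (law (Some x) (ennreal t) \<bind> P))"
        by (intro measurable_completion_bind law_space measurable_discounted_after U c)
      show "discounted_after U S \<omega> = 0" if "\<And>t. X t \<omega> = None" for \<omega>
        by (simp add: discounted_after_def visited_def that)
    qed
    finally show ?thesis .
  qed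
  show ?case
    using reduced_excessive[OF shift(3), of U] transition_mono_AE[OF shift.IH shift(3)]
  proof eventually_elim
    case (elim x)
    have "ennreal (exp (- t)) * transition (ennreal t) e x \<le> ennreal (exp (- t)) * transition (ennreal t) (\<lambda>x. ennreal (reduced U x)) x"
      using elim(2) unfolding e_def by (rule mult_left_mono) simp
    then show ?case unfolding eq using elim(1) by (rule order_trans)
  qed
qed

lemma expect_discounted_after_le:
  assumes U: "U \<in> sets borel"
  shows "AE x in m. (\<integral>\<^sup>+\<omega>. discounted_after U rational_times \<omega> \<partial>P (Some x)) \<le> ennreal (reduced U x)"
proof -
  obtain S :: "nat \<Rightarrow> real set" where S: "\<And>n. finite (S n)" "incseq S" "(\<Union>n. S n) = rational_times"
    using countable_finite_chain[OF countable_rational_times] by blast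
  have c: "countable (S n)" for n using S(1) by (rule countable_finite)
  have sup: "(\<integral>\<^sup>+\<omega>. discounted_after U rational_times \<omega> \<partial>P (Some x)) = (SUP n. \<integral>\<^sup>+\<omega>. discounted_after U (S n) \<omega> \<partial>P (Some x))" for x
    unfolding S(3)[symmetric] discounted_after_def
    using measurable_discounted_after_level[OF U c] measurable_discounted_after[OF U c, unfolded discounted_after_def]
    by (intro nn_integral_visited_SUP S(2)) (simp_all cong: measurable_cong_sets)
  have "S n \<subseteq> {0..}" for n using S(3) by blast
  then have "AE x in m. \<forall>n. (\<integral>\<^sup>+\<omega>. discounted_after U (S n) \<omega> \<partial>P (Some x)) \<le> ennreal (reduced U x)"
    unfolding AE_all_countable by (intro allI expect_discounted_after_le_finite U S)
  then show ?thesis unfolding sup by eventually_elim (auto intro: SUP_least)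
qed

text \<open>The expected discounted occupation after visits of all \<open>U\<^sub>n\<close> is bounded by \<open>h\<^bsub>U\<^sub>n\<^esub>\<close>, which tends to \<open>0\<close> almost
  everywhere along a subsequence. So on almost every path the occupation vanishes; as \<open>\<phi> > 0\<close>, at almost every
  time before the lifetime some \<open>U\<^sub>n\<close> has not been visited yet.\<close>

lemma path_avoids:
  fixes U :: "nat \<Rightarrow> 'a set"
  assumes U: "\<And>n. open (U n)" and dec: "decseq U" and cap: "(\<lambda>n. Cap_open (U n)) \<longlonglongrightarrow> 0"
  shows "AE x in m. AE \<omega> in P (Some x). \<forall>t<lifetime X \<omega>. \<exists>n. \<forall>s\<le>t. X s \<omega> \<notin> Some ` U n"
proof -
  note [measurable] = phi_measurable
  have "(\<lambda>n. L2_inner m (\<lambda>x. reduced (U n) x - 0) (\<lambda>x. reduced (U n) x - 0)) \<longlonglongrightarrow> 0"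
    by (rule tendsto_sandwich[OF _ _ tendsto_const cap], unfold Cap_open_def diff_zero)
       (intro always_eventually allI L2_inner_self_nonneg L2_inner_le_form1 reduced_D)+
  then obtain r where r: "strict_mono r" "AE x in m. (\<lambda>n. reduced (U (r n)) x) \<longlonglongrightarrow> 0"
    by (rule L2_tendsto_AE_subseq[OF D_in_L2[OF reduced_D] D_in_L2[OF D_zero]])
  have "AE x in m. \<forall>n. (\<integral>\<^sup>+\<omega>. discounted_after (U (r n)) rational_times \<omega> \<partial>P (Some x)) \<le> ennreal (reduced (U (r n)) x)"
    unfolding AE_all_countable using U by (intro allI expect_discounted_after_le) simp
  with r(2) show ?thesis
  proof eventually_elim
    case (elim x)
    let ?V = "\<lambda>n \<omega> s. visited (U (r n)) rational_times (ennreal s) \<omega>"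
    let ?g = "\<lambda>\<omega> s. if \<forall>n. ?V n \<omega> s
      then ennreal (exp (- s)) * case_option 0 (\<lambda>y. ennreal (\<phi> y)) (X (ennreal s) \<omega>) else 0"
    have [measurable]: "U (r n) \<in> sets borel" "countable rational_times" for n
      using U countable_rational_times by auto
    have mg: "(\<lambda>z. ?g (fst z) (snd z)) \<in> borel_measurable (natural_events \<Otimes>\<^sub>M lborel)"
      by measurable
    define W where "W = (\<lambda>\<omega>. \<integral>\<^sup>+s. ?g \<omega> s \<partial>lborel)"
    have W [measurable]: "W \<in> borel_measurable natural_events"
      unfolding W_def using mg by (intro lborel.borel_measurable_nn_integral) (simp add: case_prod_unfold)
    have "W \<omega> \<le> discounted_after (U (r n)) rational_times \<omega>" for n \<omega>
      unfolding W_def discounted_after_def by (intro nn_integral_mono) auto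
    then have "(\<integral>\<^sup>+\<omega>. W \<omega> \<partial>P (Some x)) \<le> ennreal (reduced (U (r n)) x)" for n
      using elim(2) by (meson nn_integral_mono order_trans)
    moreover have "(\<lambda>n. ennreal (reduced (U (r n)) x)) \<longlonglongrightarrow> ennreal 0" by (intro tendsto_ennrealI elim)
    ultimately have "(\<integral>\<^sup>+\<omega>. W \<omega> \<partial>P (Some x)) \<le> ennreal 0"
      by (intro LIMSEQ_le_const) auto
    then have "AE \<omega> in P (Some x). W \<omega> = 0" by (simp add: nn_integral_0_iff_AE)
    then show ?case
    proof eventually_elim
      case (elim \<omega>)
      have mg': "?g \<omega> \<in> borel_measurable lborel"
      proof -
        have "\<omega> \<in> space natural_events" by simp
        from measurable_compose[OF measurable_Pair1'[OF this] mg] show ?thesis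
          by (simp only: fst_conv snd_conv)
      qed
      then have ae: "AE s in lborel. ?g \<omega> s = 0"
        using elim unfolding W_def by (subst (asm) nn_integral_0_iff_AE) auto
      show ?case
      proof (intro allI impI)
        fix t assume t: "t < lifetime X \<omega>"
        define a where "a = enn2real t"
        have "t < \<top>" using t by (rule less_le_trans) simp
        then have a: "t = ennreal a" "0 \<le> a" by (auto simp: a_def)
        obtain b where b: "a < b" "ennreal b \<le> lifetime X \<omega>"
        proof (cases "lifetime X \<omega>")
          case (real l)
          then show ?thesis using that[of l] t a by (simp add: ennreal_less_iff)
        next
          case top
          then show ?thesis using that[of "a + 1"] by simp
        qed
        have "\<exists>s. a < s \<and> s < b \<and> ?g \<omega> s = 0"
        proof (rule ccontr)
          assume "\<not> ?thesis"
          then have "AE s in lborel. s \<notin> {a<..<b}" using ae by (auto elim!: eventually_mono)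
          then have "emeasure lborel {a<..<b} = 0"
            using AE_iff_null_sets[of "{a<..<b}" lborel] by (auto simp: null_sets_def)
          then show False using b(1) by simp
        qed
        then obtain s where s: "a < s" "s < b" "?g \<omega> s = 0" by blast
        have "\<not> lifetime X \<omega> \<le> ennreal s"
          using s a b by (metis ennreal_less_iff less_le_trans not_le order.trans less_imp_le)
        then obtain y where y: "X (ennreal s) \<omega> = Some y" using dead_iff[of "ennreal s" \<omega>] by auto
        have "\<not> (\<forall>n. ?V n \<omega> s)"
          using s(3) phi_pos[of y] by (auto simp: y split: if_splits)
        then obtain n where n: "\<And>q. q \<in> rational_times \<Longrightarrow> ennreal q < ennreal s \<Longrightarrow> X (ennreal q) \<omega> \<notin> Some ` U (r n)"
          by (auto simp: visited_def)
        have "X s' \<omega> \<notin> Some ` U (r n)" if "s' \<le> t" for s'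
        proof
          assume in_U: "X s' \<omega> \<in> Some ` U (r n)"
          define c where "c = enn2real s'"
          have "s' < \<top>" using that \<open>t < \<top>\<close> by (rule le_less_trans)
          then have c: "s' = ennreal c" "0 \<le> c" by (auto simp: c_def)
          have "c \<le> a" using that a c by simp
          have "\<forall>\<^sub>F p in at_right s'. X p \<omega> \<in> Some ` U (r n)"
            using right_continuous[of s' \<omega>] c(1) by (intro limit_in_openI[OF _ in_U U]) simp
          then obtain p where p: "s' < p" "\<And>q. s' < q \<Longrightarrow> q < p \<Longrightarrow> X q \<omega> \<in> Some ` U (r n)"
            unfolding eventually_at_right[OF \<open>s' < \<top>\<close>] by blast
          have "c < s" using \<open>c \<le> a\<close> s by simp
          have "\<exists>p'. c < p' \<and> p' \<le> s \<and> ennreal p' \<le> p"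
          proof (cases p)
            case (real l)
            then show ?thesis using p(1) c \<open>c < s\<close>
              by (intro exI[of _ "min l s"]) (auto simp: ennreal_less_iff min_def intro: ennreal_leI)
          next
            case top
            then show ?thesis using \<open>c < s\<close> by (intro exI[of _ s]) auto
          qed
          then obtain p' where p': "c < p'" "p' \<le> s" "ennreal p' \<le> p" by blast
          obtain q where q: "q \<in> rational_times" "c < q" "q < p'"
            by (rule rational_time_between[OF p'(1) c(2)])
          have "0 \<le> q" using q(2) c(2) by simp
          have "ennreal q < ennreal p'" using q(3) \<open>0 \<le> q\<close> by (simp add: ennreal_less_iff)
          also have "\<dots> \<le> p" by (rule p'(3))
          finally have "X (ennreal q) \<omega> \<in> Some ` U (r n)"
            using q(2) c by (intro p(2)) (simp_all add: ennreal_less_iff)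
          moreover have "ennreal q < ennreal s" using q p' \<open>0 \<le> q\<close> by (simp add: ennreal_less_iff)
          ultimately show False using n[OF q(1)] by simp
        qed
        then show "\<exists>n. \<forall>s\<le>t. X s \<omega> \<notin> Some ` U n" by blast
      qed
    qed
  qed
qed

end

section \<open>The clock of an additive functional and its inverse\<close>

lemma rational_time_between_ennreal:
  assumes "r < (y::ennreal)"
  obtains q where "q \<in> rational_times" "r < ennreal q" "ennreal q < y"
proof -
  obtain z where z: "r < z" "z < y" using dense[OF assms] by blast
  have fin: "r < \<top>" "z < \<top>" using z by (auto intro: less_le_trans[OF _ top_greatest])
  have "enn2real r < enn2real z" using z(1) fin by (simp add: enn2real_less_iff)
  then obtain q where q: "q \<in> rational_times" "enn2real r < q" "q < enn2real z"
    by (rule rational_time_between) simp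
  have "r < ennreal q" using q(2) fin(1) by (metis enn2real_nonneg ennreal_enn2real ennreal_less_iff)
  moreover have "ennreal q < z" using q fin(2) by (metis IntD2 atLeast_iff ennreal_enn2real ennreal_less_iff)
  ultimately show ?thesis using that q(1) z(2) by (meson less_trans)
qed

lemma ennreal_eqI_le:
  fixes x y :: ennreal
  assumes "\<And>r. r < \<top> \<Longrightarrow> x \<le> r \<longleftrightarrow> y \<le> r"
  shows "x = y"
proof (rule antisym)
  show "x \<le> y" using assms[of y] by (cases "y = \<top>") (auto simp: less_top)
  show "y \<le> x" using assms[of x] by (cases "x = \<top>") (auto simp: less_top)
qed

lemma exhaust_ennreal_from_below:
  fixes z :: ennreal
  assumes "0 < z"
  obtains r :: "nat \<Rightarrow> real" where "incseq r" "\<And>n. 0 \<le> r n" "\<And>n. ennreal (r n) < z" "\<And>x. x < z \<Longrightarrow> \<exists>n. x \<le> ennreal (r n)"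
proof (cases z)
  case (real l)
  then have l: "0 < l" using assms by simp
  have lim: "(\<lambda>n. l - l / real (Suc n)) \<longlonglongrightarrow> l - 0"
    by (intro tendsto_intros LIMSEQ_Suc[OF lim_const_over_n])
  show ?thesis
  proof (rule that[of "\<lambda>n. l - l / real (Suc n)"])
    show "incseq (\<lambda>n. l - l / real (Suc n))"
      using l by (auto simp: incseq_def intro!: diff_left_mono divide_left_mono)
    show "0 \<le> l - l / real (Suc n)" for n using l by (simp add: field_simps)
    show "ennreal (l - l / real (Suc n)) < z" for n using l by (simp add: real ennreal_less_iff field_simps)
    fix x assume "x < z"
    then obtain x' where x': "x = ennreal x'" "0 \<le> x'" "x' < l"
      using real by (cases x) (auto simp: ennreal_less_iff)
    have "\<forall>\<^sub>F n in sequentially. x' < l - l / real (Suc n)"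
      using order_tendstoD(1)[OF lim] x'(3) by simp
    then obtain n where "x' < l - l / real (Suc n)" by (auto simp: eventually_sequentially)
    then show "\<exists>n. x \<le> ennreal (l - l / real (Suc n))"
      unfolding x' by (intro exI[of _ n] ennreal_leI) simp
  qed
next
  case top
  show ?thesis
  proof (rule that[of real])
    fix x assume "x < z"
    then obtain x' where x': "x = ennreal x'" "0 \<le> x'" using top by (cases x) auto
    obtain n where "x' \<le> real n" using real_arch_simple by blast
    then show "\<exists>n. x \<le> ennreal (real n)" unfolding x' by (intro exI[of _ n] ennreal_leI)
  qed (auto simp: incseq_def top)
qed

locale additive_functional = dirichlet_hunt m D \<E> \<phi> X \<theta> P
  for m :: "'a::{metric_space, second_countable_topology} measure"
    and D :: "('a \<Rightarrow> real) set"
    and \<E> :: "('a \<Rightarrow> real) \<Rightarrow> ('a \<Rightarrow> real) \<Rightarrow> real"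
    and \<phi> :: "'a \<Rightarrow> real"
    and X :: "ennreal \<Rightarrow> 'w \<Rightarrow> 'a option"
    and \<theta> :: "ennreal \<Rightarrow> 'w \<Rightarrow> 'w"
    and P :: "'a option \<Rightarrow> 'w measure" +
  fixes A :: "ennreal \<Rightarrow> 'w \<Rightarrow> ennreal" and \<Lambda> :: "'w set"
  assumes measurable_A: "t < \<top> \<Longrightarrow> A t \<in> borel_measurable (completed_filtration X P t)"
    and sets_\<Lambda>: "\<Lambda> \<in> sets (completed_filtration X P \<top>)"
    and full_\<Lambda>: "qe (\<lambda>x. emeasure (completion (P (Some x))) \<Lambda> = 1)"
    and shift_\<Lambda>: "0 < t \<Longrightarrow> t < \<top> \<Longrightarrow> \<omega> \<in> \<Lambda> \<Longrightarrow> \<theta> t \<omega> \<in> \<Lambda>"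
    and A_zero: "\<omega> \<in> \<Lambda> \<Longrightarrow> A 0 \<omega> = 0"
    and A_continuous: "\<omega> \<in> \<Lambda> \<Longrightarrow> continuous_on {..<\<top>} (\<lambda>t. A t \<omega>)"
    and A_finite: "\<omega> \<in> \<Lambda> \<Longrightarrow> t < lifetime X \<omega> \<Longrightarrow> A t \<omega> < \<top>"
    and A_add: "\<omega> \<in> \<Lambda> \<Longrightarrow> s < \<top> \<Longrightarrow> t < \<top> \<Longrightarrow> A (s + t) \<omega> = A s \<omega> + A t (\<theta> s \<omega>)"

lemma (in dirichlet_hunt) pcaf_additive_functional:
  assumes "pcaf A"
  obtains \<Lambda> where "additive_functional m D \<E> \<phi> X \<theta> P A \<Lambda>"
proof -
  obtain \<Lambda> where \<Lambda>: "\<Lambda>\<in>sets (completed_filtration X P \<infinity>)"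
     "qe (\<lambda>x. emeasure (completion (P (Some x))) \<Lambda> = 1)"
     "\<forall>t. 0 < t \<and> t < \<infinity> \<longrightarrow> \<theta> t ` \<Lambda> \<subseteq> \<Lambda>"
     "\<forall>\<omega>\<in>\<Lambda>. A 0 \<omega> = 0 \<and> continuous_on {..<\<infinity>} (\<lambda>t. A t \<omega>) \<and> (\<forall>t<lifetime X \<omega>. A t \<omega> < \<infinity>) \<and>
           (\<forall>t<\<infinity>. lifetime X \<omega> \<le> t \<longrightarrow> A t \<omega> = A (lifetime X \<omega>) \<omega>) \<and>
           (\<forall>s<\<infinity>. \<forall>t<\<infinity>. A (s + t) \<omega> = A s \<omega> + A t (\<theta> s \<omega>))"
    and m: "\<forall>t<\<infinity>. A t \<in> borel_measurable (completed_filtration X P t)"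
    using assms unfolding pcaf_def by blast
  note path = \<Lambda>(4)[rule_format, unfolded infinity_ennreal_def]
  have "additive_functional m D \<E> \<phi> X \<theta> P A \<Lambda>"
  proof (intro additive_functional.intro[OF dirichlet_hunt_axioms] additive_functional_axioms.intro)
    fix \<omega> s t assume \<omega>: "\<omega> \<in> \<Lambda>"
    note p = path[OF \<omega>]
    show "A 0 \<omega> = 0" by (rule p[THEN conjunct1])
    show "continuous_on {..<\<top>} (\<lambda>t. A t \<omega>)" by (rule p[THEN conjunct2, THEN conjunct1])
    show "A t \<omega> < \<top>" if "t < lifetime X \<omega>"
      using p[THEN conjunct2, THEN conjunct2, THEN conjunct1] that by blast
    show "A (s + t) \<omega> = A s \<omega> + A t (\<theta> s \<omega>)" if "s < \<top>" "t < \<top>"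
      using p[THEN conjunct2, THEN conjunct2, THEN conjunct2, THEN conjunct2] that by blast
    show "\<theta> t \<omega> \<in> \<Lambda>" if "0 < t" "t < \<top>"
      using \<Lambda>(3) \<omega> that by (auto simp: image_subset_iff)
  next
    show "A t \<in> borel_measurable (completed_filtration X P t)" if "t < \<top>" for t
      using m that by (simp only: infinity_ennreal_def)
  qed (use \<Lambda>(1,2) in \<open>simp_all only: infinity_ennreal_def\<close>)
  then show ?thesis by (rule that)
qed

context additive_functional
begin

lemma A_mono:
  assumes "\<omega> \<in> \<Lambda>" "s \<le> t" "t < \<top>"
  shows "A s \<omega> \<le> A t \<omega>"
proof -
  have t: "t = s + (t - s)" using assms(2) by (metis add.commute diff_add_cancel_ennreal)
  have "s < \<top>" "t - s < \<top>" using assms le_less_trans[OF diff_le_self_ennreal assms(3)] by (auto intro: le_less_trans)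
  then show ?thesis using A_add[OF assms(1), of s "t - s"] t by simp
qed

text \<open>The right inverse of \<open>t \<mapsto> A\<^sub>t\<close>. The infimum runs over rational times to be measurable in the path, also
  where \<open>A\<close> is not regular. A level that is never reached gets the time \<open>\<infinity>\<close>, at which the path is dead.\<close>

definition inverse_clock :: "real \<Rightarrow> 'w \<Rightarrow> ennreal" where
  "inverse_clock a \<omega> = (INF q\<in>rational_times. if ennreal a \<le> A (ennreal q) \<omega> then ennreal q else \<top>)"

text \<open>The defining Galois connection between the clock and its inverse. Everything about the inverse follows from it;
  it expresses both the monotonicity and the right continuity of \<open>A\<close>.\<close>

lemma inverse_clock_le_iff:
  assumes \<omega>: "\<omega> \<in> \<Lambda>" and r: "r < \<top>"
  shows "inverse_clock a \<omega> \<le> r \<longleftrightarrow> ennreal a \<le> A r \<omega>"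
proof
  assume le: "ennreal a \<le> A r \<omega>"
  show "inverse_clock a \<omega> \<le> r"
  proof (rule dense_ge)
    fix y assume "r < y"
    then obtain q where q: "q \<in> rational_times" "r < ennreal q" "ennreal q < y"
      by (rule rational_time_between_ennreal)
    have "ennreal a \<le> A (ennreal q) \<omega>" using le A_mono[OF \<omega> less_imp_le[OF q(2)] ennreal_less_top] by (rule order_trans)
    then have "inverse_clock a \<omega> \<le> ennreal q"
      unfolding inverse_clock_def using q(1) by (intro INF_lower2[of q]) auto
    then show "inverse_clock a \<omega> \<le> y" using q(3) by simp
  qed
next
  assume le: "inverse_clock a \<omega> \<le> r"
  show "ennreal a \<le> A r \<omega>"
  proof (rule ccontr)
    assume "\<not> ?thesis"
    then have lt: "A r \<omega> < ennreal a" by simp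
    have "isCont (\<lambda>t. A t \<omega>) r"
      using A_continuous[OF \<omega>] r by (simp add: continuous_on_eq_continuous_at)
    then have "((\<lambda>t. A t \<omega>) \<longlongrightarrow> A r \<omega>) (at_right r)"
      unfolding isCont_def by (rule tendsto_mono[OF at_le[OF subset_UNIV]])
    then have "\<forall>\<^sub>F t in at_right r. A t \<omega> < ennreal a" using lt by (rule order_tendstoD(2))
    then obtain y where y: "r < y" "\<And>t. r < t \<Longrightarrow> t < y \<Longrightarrow> A t \<omega> < ennreal a"
      unfolding eventually_at_right[OF r] by blast
    have "y \<le> inverse_clock a \<omega>"
      unfolding inverse_clock_def
    proof (rule INF_greatest)
      fix q assume "q \<in> rational_times"
      have "\<not> ennreal a \<le> A (ennreal q) \<omega>" if "ennreal q < y"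
      proof (cases "r < ennreal q")
        case True
        then show ?thesis using y(2)[OF True that] by simp
      next
        case False
        then show ?thesis using A_mono[OF \<omega>, of "ennreal q" r] r lt by (meson le_less_trans not_le)
      qed
      then show "y \<le> (if ennreal a \<le> A (ennreal q) \<omega> then ennreal q else \<top>)" by force
    qed
    then show False using le y(1) by simp
  qed
qed

lemma inverse_clock_pos: "\<omega> \<in> \<Lambda> \<Longrightarrow> 0 < a \<Longrightarrow> 0 < inverse_clock a \<omega>"
proof (rule ccontr)
  assume \<omega>: "\<omega> \<in> \<Lambda>" and "0 < a" "\<not> 0 < inverse_clock a \<omega>"
  then have "inverse_clock a \<omega> \<le> 0" by simp
  then have "ennreal a \<le> A 0 \<omega>" using inverse_clock_le_iff[OF \<omega>, of 0 a] by simp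
  then show False using A_zero[OF \<omega>] \<open>0 < a\<close> by simp
qed

text \<open>The clock has no jumps, so it shows exactly \<open>a\<close> when level \<open>a\<close> is reached.\<close>

lemma A_inverse_clock:
  assumes \<omega>: "\<omega> \<in> \<Lambda>" and "0 < a" and fin: "inverse_clock a \<omega> < \<top>"
  shows "A (inverse_clock a \<omega>) \<omega> = ennreal a"
proof (rule antisym)
  let ?T = "inverse_clock a \<omega>"
  show "ennreal a \<le> A ?T \<omega>" using inverse_clock_le_iff[OF \<omega> fin, of a] by simp
  have "isCont (\<lambda>t. A t \<omega>) ?T"
    using A_continuous[OF \<omega>] fin by (simp add: continuous_on_eq_continuous_at)
  then have lim: "((\<lambda>t. A t \<omega>) \<longlongrightarrow> A ?T \<omega>) (at_left ?T)"
    unfolding isCont_def by (rule tendsto_mono[OF at_le[OF subset_UNIV]])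
  have pos: "0 < ?T" by (rule inverse_clock_pos[OF \<omega> \<open>0 < a\<close>])
  show "A ?T \<omega> \<le> ennreal a"
  proof (rule tendsto_upperbound[OF lim])
    have "A t \<omega> \<le> ennreal a" if "t < ?T" for t
    proof -
      have "t < \<top>" using that fin by (rule less_trans)
      then have "\<not> ennreal a \<le> A t \<omega>" using inverse_clock_le_iff[OF \<omega>, of t a] that not_le by blast
      then show ?thesis by simp
    qed
    then show "\<forall>\<^sub>F t in at_left ?T. A t \<omega> \<le> ennreal a"
      unfolding eventually_at_left[OF pos] using pos by blast
    show "at_left ?T \<noteq> bot"
      unfolding trivial_limit_def eventually_at_left[OF pos] using dense by metis
  qed
qed

text \<open>On \<open>[0, r]\<close> with \<open>r < \<zeta>\<close>, the Stieltjes measure of the clock is the image of Lebesgue measure on \<open>(0, A\<^sub>r]\<close>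
  under the inverse clock, since the levels reached in \<open>(x, y]\<close> form the interval \<open>(A\<^sub>x, A\<^sub>y]\<close>.\<close>

lemma interval_measure_clock:
  assumes \<omega>: "\<omega> \<in> \<Lambda>" and r: "0 \<le> r" "ennreal r < lifetime X \<omega>"
  shows "interval_measure (\<lambda>s. enn2real (A (ennreal (min s r)) \<omega>))
       = distr (density lborel (indicator {0<..enn2real (A (ennreal r) \<omega>)})) borel (\<lambda>a. enn2real (inverse_clock a \<omega>))"
    (is "interval_measure ?F = distr ?M borel ?T")
proof (rule measure_eqI_generator_eq[where \<Omega>=UNIV and E="range (\<lambda>(a, b). {a<..b::real})" and A="\<lambda>i::nat. {- real i<..real i}"])
  have fin: "A (ennreal (min s r)) \<omega> < \<top>" for s
    using r(2) by (intro A_finite[OF \<omega>]) (auto simp: min_def intro: le_less_trans[rotated] ennreal_leI)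
  have AF: "A (ennreal (min s r)) \<omega> = ennreal (?F s)" for s using fin[of s] by simp
  have mono: "?F x \<le> ?F y" if "x \<le> y" for x y
    using that fin by (intro enn2real_mono A_mono[OF \<omega>]) (auto intro!: ennreal_leI min.mono)
  have F0: "0 \<le> ?F x" for x by simp
  have Fr: "?F x \<le> enn2real (A (ennreal r) \<omega>)" for x
    using mono[of x r] by (cases "x \<le> r") (simp_all add: min_def)
  have cont: "continuous (at_right s) ?F" for s
  proof -
    have "continuous_on UNIV (\<lambda>s. A (ennreal (min s r)) \<omega>)"
      by (rule continuous_on_compose2[OF A_continuous[OF \<omega>]])
         (auto intro!: continuous_on_ennreal continuous_on_min continuous_on_id continuous_on_const)
    then have "isCont (\<lambda>s. A (ennreal (min s r)) \<omega>) s" by (simp add: continuous_on_eq_continuous_at)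
    then have "((\<lambda>s. A (ennreal (min s r)) \<omega>) \<longlongrightarrow> A (ennreal (min s r)) \<omega>) (at_right s)"
      unfolding isCont_def by (rule tendsto_mono[OF at_le[OF subset_UNIV]])
    then show ?thesis unfolding continuous_within
      using fin[of s] by (intro tendsto_enn2real) auto
  qed
  have T_le: "?T a \<le> y \<longleftrightarrow> a \<le> ?F y" if a: "a \<in> {0<..enn2real (A (ennreal r) \<omega>)}" for a y
  proof -
    have "ennreal a \<le> ennreal (enn2real (A (ennreal r) \<omega>))" using a by (intro ennreal_leI) simp
    also have "\<dots> = A (ennreal r) \<omega>" using AF[of r] by simp
    finally have "ennreal a \<le> A (ennreal r) \<omega>" .
    then have Tr: "inverse_clock a \<omega> \<le> ennreal r" using inverse_clock_le_iff[OF \<omega>] by simp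
    show ?thesis
    proof (cases "0 \<le> y")
      case True
      have "?T a \<le> y \<longleftrightarrow> inverse_clock a \<omega> \<le> ennreal y"
      proof -
        have "inverse_clock a \<omega> < \<top>" using Tr by (rule le_less_trans) simp
        then have "inverse_clock a \<omega> = ennreal (?T a)" by simp
        then have "inverse_clock a \<omega> \<le> ennreal y \<longleftrightarrow> ennreal (?T a) \<le> ennreal y"
          by (rule arg_cong[where f="\<lambda>z. z \<le> ennreal y"])
        then show ?thesis using True by (simp only: ennreal_le_iff)
      qed
      also have "\<dots> \<longleftrightarrow> inverse_clock a \<omega> \<le> ennreal (min y r)"
        using Tr by (auto simp: min_def ennreal_leI intro: order_trans)
      also have "\<dots> \<longleftrightarrow> ennreal a \<le> ennreal (?F y)"
        unfolding AF[symmetric] by (rule inverse_clock_le_iff[OF \<omega>]) simp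
      also have "\<dots> \<longleftrightarrow> a \<le> ?F y" by (rule ennreal_le_iff) simp
      finally show ?thesis .
    next
      case False
      then have "?F y = 0" using r(1) A_zero[OF \<omega>] by (simp add: ennreal_neg)
      then have "\<not> a \<le> ?F y" using a by simp
      moreover have "\<not> ?T a \<le> y"
        using False enn2real_nonneg[of "inverse_clock a \<omega>"] by linarith
      ultimately show ?thesis by blast
    qed
  qed
  have mT [measurable]: "?T \<in> borel_measurable borel"
    unfolding inverse_clock_def
    by (intro borel_measurable_enn2real borel_measurable_INF countable_rational_times) measurable
  have [simp]: "emeasure (interval_measure ?F) {x<..y} = emeasure (distr ?M borel ?T) {x<..y}" if "x \<le> y" for x y
  proof -
    have "emeasure (distr ?M borel ?T) {x<..y} = emeasure ?M (?T -` {x<..y})"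
      by (subst emeasure_distr) auto
    also have "\<dots> = (\<integral>\<^sup>+a. indicator {0<..enn2real (A (ennreal r) \<omega>)} a * indicator (?T -` {x<..y}) a \<partial>lborel)"
      using measurable_sets[OF mT, of "{x<..y}"] by (intro emeasure_density) auto
    also have "\<dots> = (\<integral>\<^sup>+a. indicator {?F x<..?F y} a \<partial>lborel)"
    proof (intro nn_integral_cong)
      fix a
      have "a \<in> {0<..enn2real (A (ennreal r) \<omega>)} \<and> x < ?T a \<and> ?T a \<le> y \<longleftrightarrow> ?F x < a \<and> a \<le> ?F y"
      proof
        assume "a \<in> {0<..enn2real (A (ennreal r) \<omega>)} \<and> x < ?T a \<and> ?T a \<le> y"
        then show "?F x < a \<and> a \<le> ?F y" using T_le[of a x] T_le[of a y] by linarith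
      next
        assume a: "?F x < a \<and> a \<le> ?F y"
        then have "0 < a" "a \<le> enn2real (A (ennreal r) \<omega>)" using F0[of x] Fr[of y] by linarith+
        then have "a \<in> {0<..enn2real (A (ennreal r) \<omega>)}" by simp
        then show "a \<in> {0<..enn2real (A (ennreal r) \<omega>)} \<and> x < ?T a \<and> ?T a \<le> y"
          using T_le[of a x] T_le[of a y] a by linarith
      qed
      then show "indicator {0<..enn2real (A (ennreal r) \<omega>)} a * indicator (?T -` {x<..y}) a = (indicator {?F x<..?F y} a :: ennreal)"
        by (auto simp: indicator_def)
    qed
    also have "\<dots> = ennreal (?F y - ?F x)" using mono[OF that] by simp
    also have "\<dots> = emeasure (interval_measure ?F) {x<..y}"
      by (rule emeasure_interval_measure_Ioc[symmetric]) (use that mono cont in auto)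
    finally show ?thesis by simp
  qed
  show "emeasure (interval_measure ?F) I = emeasure (distr ?M borel ?T) I"
    if I: "I \<in> range (\<lambda>(a, b). {a<..b::real})" for I
  proof -
    obtain x y where "I = {x<..y}" using I by auto
    then show ?thesis by (cases "x \<le> y") auto
  qed
  show "emeasure (interval_measure ?F) {- real i<..real i} \<noteq> \<infinity>" for i :: nat
    by (subst emeasure_interval_measure_Ioc) (use mono cont in auto)
qed (auto simp: Int_stable_def borel_sigma_sets_Ioc UN_Ioc_eq_UNIV)

end

section \<open>Integrals against the clock\<close>

context additive_functional
begin

lemma measurable_inverse_clock_level [measurable]: "(\<lambda>a. inverse_clock a \<omega>) \<in> borel_measurable borel"
  unfolding inverse_clock_def
  by (intro borel_measurable_INF countable_rational_times) measurable

lemma measurable_A_completion: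
  assumes "\<nu> \<in> space (prob_algebra cemetery_borel)"
  shows "A (ennreal q) \<in> borel_measurable (completion (\<nu> \<bind> P))"
proof (rule measurable_from_subalg)
  show "subalgebra (completion (\<nu> \<bind> P)) (completed_filtration X P (ennreal q))"
    using completed_le_completion[OF assms] by (simp add: subalgebra_def space_bind_P[OF assms])
  show "A (ennreal q) \<in> borel_measurable (completed_filtration X P (ennreal q))"
    by (rule measurable_A) simp
qed

lemma measurable_X_inverse_clock:
  assumes \<nu>: "\<nu> \<in> space (prob_algebra cemetery_borel)"
  shows "(\<lambda>z. inverse_clock (snd z) (fst z)) \<in> borel_measurable (completion (\<nu> \<bind> P) \<Otimes>\<^sub>M lborel)"
    and "(\<lambda>z. X (inverse_clock (snd z) (fst z)) (fst z)) \<in> completion (\<nu> \<bind> P) \<Otimes>\<^sub>M lborel \<rightarrow>\<^sub>M cemetery_borel"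
proof -
  let ?M = "completion (\<nu> \<bind> P) \<Otimes>\<^sub>M lborel"
  note [measurable] = measurable_A_completion[OF \<nu>]
  show inv [measurable]: "(\<lambda>z. inverse_clock (snd z) (fst z)) \<in> borel_measurable ?M"
    unfolding inverse_clock_def
    by (intro borel_measurable_INF countable_rational_times) measurable
  have [measurable]: "(\<lambda>\<omega>. \<omega>) \<in> completion (\<nu> \<bind> P) \<rightarrow>\<^sub>M natural_events"
    by (rule measurable_completion_bind[OF _ \<nu>]) simp
  have 1: "(\<lambda>z. (enn2real (inverse_clock (snd z) (fst z)), fst z)) \<in> ?M \<rightarrow>\<^sub>M borel \<Otimes>\<^sub>M natural_events"
    by measurable
  have "(\<lambda>z. if inverse_clock (snd z) (fst z) = \<top> then None
      else (case (enn2real (inverse_clock (snd z) (fst z)), fst z) of (s, \<omega>) \<Rightarrow> X (ennreal s) \<omega>))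
     \<in> ?M \<rightarrow>\<^sub>M cemetery_borel"
  proof (intro measurable_If measurable_compose[OF 1 measurable_path] measurable_const)
    show "{z \<in> space ?M. inverse_clock (snd z) (fst z) = \<top>} \<in> sets ?M"
      using measurable_sets[OF inv, of "{\<top>}"] by (simp add: vimage_def Int_def conj_commute)
  qed simp
  also have "(\<lambda>z. if inverse_clock (snd z) (fst z) = \<top> then None
      else (case (enn2real (inverse_clock (snd z) (fst z)), fst z) of (s, \<omega>) \<Rightarrow> X (ennreal s) \<omega>))
     = (\<lambda>z. X (inverse_clock (snd z) (fst z)) (fst z))"
    using X_infinity by (auto simp: fun_eq_iff less_top)
  finally show "(\<lambda>z. X (inverse_clock (snd z) (fst z)) (fst z)) \<in> ?M \<rightarrow>\<^sub>M cemetery_borel" .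
qed

lemma measurable_X_inverse_clock_level [measurable]:
  "(\<lambda>a. X (inverse_clock a \<omega>) \<omega>) \<in> borel \<rightarrow>\<^sub>M cemetery_borel"
proof -
  let ?\<nu> = "return cemetery_borel None :: 'a option measure"
  have "\<omega> \<in> space (completion (?\<nu> \<bind> P))" by (simp add: space_bind_P[OF point_mass_law])
  from measurable_compose[OF measurable_Pair1'[OF this, of lborel] measurable_X_inverse_clock(2)[OF point_mass_law]]
  show ?thesis by simp
qed

text \<open>The integral of \<open>f(X)\<close> against the clock, written over levels \<open>a > 0\<close>.\<close>

definition clock_integrand :: "('a \<Rightarrow> ennreal) \<Rightarrow> real \<Rightarrow> 'w \<Rightarrow> ennreal" where
  "clock_integrand f a \<omega> = case_option 0 f (X (inverse_clock a \<omega>) \<omega>) * indicator {0<..} a"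

definition clock_integral :: "('a \<Rightarrow> ennreal) \<Rightarrow> 'w \<Rightarrow> ennreal" where
  "clock_integral f \<omega> = (\<integral>\<^sup>+a. clock_integrand f a \<omega> \<partial>lborel)"

definition clock_integral_after :: "'a set \<Rightarrow> real set \<Rightarrow> ('a \<Rightarrow> ennreal) \<Rightarrow> 'w \<Rightarrow> ennreal" where
  "clock_integral_after B S f \<omega> =
     (\<integral>\<^sup>+a. (if visited B S (inverse_clock a \<omega>) \<omega> then clock_integrand f a \<omega> else 0) \<partial>lborel)"

definition clock_integral_before :: "'a set \<Rightarrow> real set \<Rightarrow> ('a \<Rightarrow> ennreal) \<Rightarrow> 'w \<Rightarrow> ennreal" where
  "clock_integral_before B S f \<omega> =
     (\<integral>\<^sup>+a. (if visited B S (inverse_clock a \<omega>) \<omega> then 0 else clock_integrand f a \<omega>) \<partial>lborel)"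

lemma measurable_clock_integral_parts:
  assumes \<nu>: "\<nu> \<in> space (prob_algebra cemetery_borel)" and [measurable]: "f \<in> borel_measurable borel"
    and [measurable]: "B \<in> sets borel" "countable S"
  shows "clock_integral_after B S f \<in> borel_measurable (completion (\<nu> \<bind> P))"
    and "clock_integral_before B S f \<in> borel_measurable (completion (\<nu> \<bind> P))"
proof -
  note [measurable] = measurable_X_inverse_clock[OF \<nu>]
  have [measurable]: "(\<lambda>\<omega>. \<omega>) \<in> completion (\<nu> \<bind> P) \<rightarrow>\<^sub>M natural_events"
    by (rule measurable_completion_bind[OF _ \<nu>]) simp
  show "clock_integral_after B S f \<in> borel_measurable (completion (\<nu> \<bind> P))"
    and "clock_integral_before B S f \<in> borel_measurable (completion (\<nu> \<bind> P))"
    unfolding clock_integral_after_def clock_integral_before_def clock_integrand_def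
    by (intro lborel.borel_measurable_nn_integral, simp add: case_prod_unfold, measurable)+
qed

lemma measurable_clock_integrand [measurable]:
  assumes [measurable]: "f \<in> borel_measurable borel"
  shows "(\<lambda>a. clock_integrand f a \<omega>) \<in> borel_measurable borel"
  unfolding clock_integrand_def by measurable

lemma measurable_visited_level [measurable]:
  assumes [measurable]: "B \<in> sets borel" "countable S"
  shows "Measurable.pred borel (\<lambda>a. visited B S (inverse_clock a \<omega>) \<omega>)"
  by (intro measurable_visited assms measurable_inverse_clock_level measurable_const) simp

lemma nn_integral_clock:
  assumes \<omega>: "\<omega> \<in> \<Lambda>" and [measurable]: "f \<in> borel_measurable borel" and r: "0 \<le> r" "ennreal r < lifetime X \<omega>"
  shows "(\<integral>\<^sup>+s\<in>{0<..r}. case_option 0 f (X (ennreal s) \<omega>) \<partial>interval_measure (\<lambda>s. enn2real (A (ennreal (min s r)) \<omega>)))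
       = (\<integral>\<^sup>+a\<in>{0<..}. (if inverse_clock a \<omega> \<le> ennreal r then case_option 0 f (X (inverse_clock a \<omega>) \<omega>) else 0) \<partial>lborel)"
proof -
  let ?T = "\<lambda>a. enn2real (inverse_clock a \<omega>)" and ?\<alpha> = "enn2real (A (ennreal r) \<omega>)"
  have "(\<integral>\<^sup>+s\<in>{0<..r}. case_option 0 f (X (ennreal s) \<omega>) \<partial>interval_measure (\<lambda>s. enn2real (A (ennreal (min s r)) \<omega>)))
     = (\<integral>\<^sup>+a. indicator {0<..?\<alpha>} a * (case_option 0 f (X (ennreal (?T a)) \<omega>) * indicator {0<..r} (?T a)) \<partial>lborel)"
    unfolding interval_measure_clock[OF \<omega> r]
    by (subst nn_integral_distr) (auto simp: nn_integral_density)
  also have "\<dots> = (\<integral>\<^sup>+a\<in>{0<..}. (if inverse_clock a \<omega> \<le> ennreal r then case_option 0 f (X (inverse_clock a \<omega>) \<omega>) else 0) \<partial>lborel)"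
  proof (intro nn_integral_cong)
    fix a
    show "indicator {0<..?\<alpha>} a * (case_option 0 f (X (ennreal (?T a)) \<omega>) * indicator {0<..r} (?T a))
      = (if inverse_clock a \<omega> \<le> ennreal r then case_option 0 f (X (inverse_clock a \<omega>) \<omega>) else 0) * indicator {0<..} a"
    proof (cases "0 < a")
      case True
      have "A (ennreal r) \<omega> = ennreal ?\<alpha>" using A_finite[OF \<omega> r(2)] by simp
      then have iff: "inverse_clock a \<omega> \<le> ennreal r \<longleftrightarrow> a \<le> ?\<alpha>"
        using inverse_clock_le_iff[OF \<omega>, of "ennreal r" a] by (metis enn2real_nonneg ennreal_le_iff ennreal_less_top)
      show ?thesis
      proof (cases "inverse_clock a \<omega> \<le> ennreal r")
        case le: True
        then have "inverse_clock a \<omega> < \<top>" by (rule le_less_trans) simp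
        then have inv: "ennreal (?T a) = inverse_clock a \<omega>" by simp
        have "ennreal (?T a) \<le> ennreal r" using le unfolding inv .
        then have "?T a \<le> r" using r(1) by simp
        moreover have "0 < ?T a"
          using inverse_clock_pos[OF \<omega> True] \<open>inverse_clock a \<omega> < \<top>\<close> by (simp add: enn2real_positive_iff)
        ultimately show ?thesis using True le iff unfolding inv by simp
      next
        case False
        then show ?thesis using iff by simp
      qed
    qed simp
  qed
  finally show ?thesis .
qed

text \<open>Exhaust \<open>[0, \<zeta>)\<close> by \<open>[0, r]\<close>. Levels reached only at the lifetime or never contribute nothing, because
  \<open>f\<close> vanishes at the cemetery.\<close>

lemma stieltjes_eq_clock_integral:
  assumes \<omega>: "\<omega> \<in> \<Lambda>" and f [measurable]: "f \<in> borel_measurable borel"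
  shows "stieltjes (\<lambda>s. A s \<omega>) (lifetime X \<omega>) (\<lambda>s. case_option 0 f (X (ennreal s) \<omega>)) = clock_integral f \<omega>"
proof -
  let ?R = "{r. 0 \<le> r \<and> ennreal r < lifetime X \<omega>}"
  let ?g = "\<lambda>r a. (if inverse_clock a \<omega> \<le> ennreal r then case_option 0 f (X (inverse_clock a \<omega>) \<omega>) else 0) * indicator {0<..} a"
  let ?G = "\<lambda>r. \<integral>\<^sup>+a. ?g r a \<partial>lborel"
  have "stieltjes (\<lambda>s. A s \<omega>) (lifetime X \<omega>) (\<lambda>s. case_option 0 f (X (ennreal s) \<omega>)) = (SUP r\<in>?R. ?G r)"
    unfolding stieltjes_def by (intro SUP_cong refl) (simp add: nn_integral_clock[OF \<omega> f])
  also have "\<dots> = clock_integral f \<omega>"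
  proof (rule antisym)
    show "(SUP r\<in>?R. ?G r) \<le> clock_integral f \<omega>"
      unfolding clock_integral_def clock_integrand_def by (intro SUP_least nn_integral_mono) (auto split: split_indicator)
    show "clock_integral f \<omega> \<le> (SUP r\<in>?R. ?G r)"
    proof (cases "lifetime X \<omega> = 0")
      case True
      then have "X t \<omega> = None" for t using dead_iff[of t \<omega>] by simp
      then show ?thesis by (simp add: clock_integral_def clock_integrand_def)
    next
      case False
      then have "0 < lifetime X \<omega>" by (simp add: zero_less_iff_neq_zero)
      then obtain r :: "nat \<Rightarrow> real" where r: "incseq r" "\<And>n. 0 \<le> r n" "\<And>n. ennreal (r n) < lifetime X \<omega>"
        "\<And>x. x < lifetime X \<omega> \<Longrightarrow> \<exists>n. x \<le> ennreal (r n)"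
        by (rule exhaust_ennreal_from_below) blast
      have mono: "ennreal (r i) \<le> ennreal (r j)" if "i \<le> j" for i j
        using r(1) that by (intro ennreal_leI) (auto simp: incseq_def)
      have "case_option 0 f (X (inverse_clock a \<omega>) \<omega>) * indicator {0<..} a \<le> (SUP n. ?g (r n) a)" for a
      proof (cases "inverse_clock a \<omega> < lifetime X \<omega>")
        case True
        then obtain n where n: "inverse_clock a \<omega> \<le> ennreal (r n)" using r(4) by blast
        have "case_option 0 f (X (inverse_clock a \<omega>) \<omega>) * indicator {0<..} a = ?g (r n) a" using n by simp
        also have "\<dots> \<le> (SUP n. ?g (r n) a)" by (rule SUP_upper) simp
        finally show ?thesis .
      next
        case False
        then have "X (inverse_clock a \<omega>) \<omega> = None" by (simp add: dead_iff)
        then show ?thesis by simp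
      qed
      then have "clock_integral f \<omega> \<le> (\<integral>\<^sup>+a. (SUP n. ?g (r n) a) \<partial>lborel)"
        unfolding clock_integral_def clock_integrand_def by (intro nn_integral_mono)
      also have "\<dots> = (SUP n. ?G (r n))"
        using mono by (intro nn_integral_monotone_convergence_SUP)
          (auto simp: incseq_def le_fun_def split: split_indicator intro: order_trans)
      also have "\<dots> \<le> (SUP r\<in>?R. ?G r)"
        using r(2,3) by (intro SUP_mono) auto
      finally show ?thesis .
    qed
  qed
  finally show ?thesis .
qed

text \<open>Additivity of \<open>A\<close> in terms of the inverse: after time \<open>t\<close> the shifted path still has to gain \<open>a\<close> to reach level
  \<open>A\<^sub>t + a\<close>.\<close>

lemma inverse_clock_shift:
  assumes \<omega>: "\<omega> \<in> \<Lambda>" and t: "0 < t" "t < \<top>" and \<alpha>: "A t \<omega> = ennreal \<alpha>" "0 \<le> \<alpha>" and "0 < a"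
  shows "inverse_clock (\<alpha> + a) \<omega> = t + inverse_clock a (\<theta> t \<omega>)"
proof (rule ennreal_eqI_le)
  fix r :: ennreal assume r: "r < \<top>"
  have \<theta>: "\<theta> t \<omega> \<in> \<Lambda>" by (rule shift_\<Lambda>[OF t \<omega>])
  show "inverse_clock (\<alpha> + a) \<omega> \<le> r \<longleftrightarrow> t + inverse_clock a (\<theta> t \<omega>) \<le> r"
  proof (cases "t \<le> r")
    case True
    have rt: "r = t + (r - t)" using True by (metis add.commute diff_add_cancel_ennreal)
    have fin: "r - t < \<top>" using r diff_le_self_ennreal by (rule le_less_trans[rotated])
    have "inverse_clock (\<alpha> + a) \<omega> \<le> r \<longleftrightarrow> ennreal \<alpha> + ennreal a \<le> A r \<omega>"
      using inverse_clock_le_iff[OF \<omega> r, of "\<alpha> + a"] \<alpha>(2) \<open>0 < a\<close> by simp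
    also have "A r \<omega> = ennreal \<alpha> + A (r - t) (\<theta> t \<omega>)"
      using A_add[OF \<omega> t(2) fin] unfolding rt[symmetric] \<alpha>(1) .
    also have "ennreal \<alpha> + ennreal a \<le> \<dots> \<longleftrightarrow> ennreal a \<le> A (r - t) (\<theta> t \<omega>)"
      by (simp add: ennreal_add_left_cancel_le)
    also have "\<dots> \<longleftrightarrow> inverse_clock a (\<theta> t \<omega>) \<le> r - t"
      using inverse_clock_le_iff[OF \<theta> fin] by simp
    also have "\<dots> \<longleftrightarrow> t + inverse_clock a (\<theta> t \<omega>) \<le> t + (r - t)"
      using t(2) by (auto simp: ennreal_add_left_cancel_le)
    finally show ?thesis unfolding rt[symmetric] .
  next
    case False
    have "A r \<omega> \<le> ennreal \<alpha>" using A_mono[OF \<omega> _ t(2), of r] False \<alpha>(1) by simp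
    also have "\<dots> < ennreal (\<alpha> + a)" using \<alpha>(2) \<open>0 < a\<close> by (simp add: ennreal_less_iff del: ennreal_plus)
    finally have "\<not> inverse_clock (\<alpha> + a) \<omega> \<le> r"
      using inverse_clock_le_iff[OF \<omega> r, of "\<alpha> + a"] by simp
    moreover have "t \<le> t + inverse_clock a (\<theta> t \<omega>)" by (simp add: add_increasing2)
    then have "\<not> t + inverse_clock a (\<theta> t \<omega>) \<le> r" using False order_trans by blast
    ultimately show ?thesis by simp
  qed
qed

text \<open>Levels up to \<open>A\<^sub>t\<close> are reached before any time of \<open>t + S\<close> and do not contribute; the remaining levels are those
  of the shifted path, translated by \<open>A\<^sub>t\<close>. If \<open>A\<^sub>t\<close> is infinite then the path is dead at time \<open>t\<close>.\<close>

lemma clock_integral_after_shift: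
  assumes \<omega>: "\<omega> \<in> \<Lambda>" and "0 < t" and S: "S \<subseteq> {0..}" "countable S"
    and f [measurable]: "f \<in> borel_measurable borel" and B: "B \<in> sets borel"
  shows "clock_integral_after B ((\<lambda>s. t + s) ` S) f \<omega> = clock_integral_after B S f (\<theta> (ennreal t) \<omega>)"
proof -
  let ?\<omega> = "\<theta> (ennreal t) \<omega>" and ?S = "(\<lambda>s. t + s) ` S"
  have t: "0 < ennreal t" "ennreal t < \<top>" using \<open>0 < t\<close> by auto
  have early: "\<not> visited B ?S (inverse_clock a \<omega>) \<omega>" if "ennreal a \<le> A (ennreal t) \<omega>" for a
    using inverse_clock_le_iff[OF \<omega> t(2), of a] that by (intro not_visited_early[OF S(1)]) simp
  show ?thesis
  proof (cases "A (ennreal t) \<omega> < \<top>")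
    case False
    then have "A (ennreal t) \<omega> = \<top>" by (simp add: less_top[symmetric])
    then have "\<not> visited B ?S (inverse_clock a \<omega>) \<omega>" for a by (intro early) simp
    then have "clock_integral_after B ?S f \<omega> = 0" by (simp add: clock_integral_after_def)
    moreover have "lifetime X \<omega> \<le> ennreal t" using A_finite[OF \<omega>, of "ennreal t"] False by (meson not_le)
    then have "X s ?\<omega> = None" for s
      unfolding shift by (intro absorbing) (simp add: add_increasing2)
    then have "clock_integral_after B S f ?\<omega> = 0" by (simp add: clock_integral_after_def visited_def)
    ultimately show ?thesis by simp
  next
    case True
    define \<alpha> where "\<alpha> = enn2real (A (ennreal t) \<omega>)"
    have \<alpha>: "A (ennreal t) \<omega> = ennreal \<alpha>" "0 \<le> \<alpha>" using True by (auto simp: \<alpha>_def)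
    let ?g = "\<lambda>a. if visited B ?S (inverse_clock a \<omega>) \<omega> then clock_integrand f a \<omega> else 0"
    note [measurable] = countable_image[OF S(2), of "\<lambda>s. t + s"] B
    have g: "?g \<in> borel_measurable borel" by measurable
    have "clock_integral_after B ?S f \<omega> = (\<integral>\<^sup>+a. ?g (\<alpha> + a) \<partial>lborel)"
      unfolding clock_integral_after_def
      using nn_integral_real_affine[OF g one_neq_zero, of \<alpha>] by (simp only: abs_one ennreal_1 mult_1)
    also have "\<dots> = clock_integral_after B S f ?\<omega>"
      unfolding clock_integral_after_def
    proof (intro nn_integral_cong)
      fix a
      show "?g (\<alpha> + a) = (if visited B S (inverse_clock a ?\<omega>) ?\<omega> then clock_integrand f a ?\<omega> else 0)"
      proof (cases "0 < a")
        case True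
        have inv: "inverse_clock (\<alpha> + a) \<omega> = ennreal t + inverse_clock a ?\<omega>"
          by (rule inverse_clock_shift[OF \<omega> t \<alpha> True])
        show ?thesis
          using visited_shift[OF S(1), of t B "inverse_clock a ?\<omega>" \<omega>] \<open>0 < t\<close> True \<alpha>(2)
          unfolding clock_integrand_def inv shift by simp
      next
        case False
        then have "ennreal (\<alpha> + a) \<le> A (ennreal t) \<omega>" unfolding \<alpha>(1) by (intro ennreal_leI) simp
        then show ?thesis using early[of "\<alpha> + a"] False by (simp add: clock_integrand_def)
      qed
    qed
    finally show ?thesis .
  qed
qed

end

section \<open>Quasi-everywhere statements and comparison after a visit\<close>

lemma stieltjes_cong:
  assumes "\<And>s. 0 < s \<Longrightarrow> ennreal s < z \<Longrightarrow> k s = k' s"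
  shows "stieltjes a z k = stieltjes a z k'"
  unfolding stieltjes_def
proof (intro SUP_cong refl nn_integral_cong)
  fix r s assume r: "r \<in> {r. 0 \<le> r \<and> ennreal r < z}"
  show "k s * indicator {0<..r} s = k' s * indicator {0<..r} s"
  proof (cases "s \<in> {0<..r}")
    case True
    then have "ennreal s \<le> ennreal r" by (intro ennreal_leI) simp
    also have "ennreal r < z" using r by simp
    finally have "ennreal s < z" .
    then show ?thesis using assms True by simp
  qed simp
qed

context dirichlet_hunt
begin

text \<open>Quasi-everywhere statements are handled through sequences of open sets with vanishing capacity;
  the complements of a nest are an example.\<close>

definition vanishing :: "(nat \<Rightarrow> 'a set) \<Rightarrow> bool" where
  "vanishing V \<longleftrightarrow> (\<forall>n. open (V n)) \<and> decseq V \<and> (\<lambda>n. Cap_open (V n)) \<longlonglongrightarrow> 0"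

lemma vanishing_Un:
  assumes "vanishing V" "vanishing W"
  shows "vanishing (\<lambda>n. V n \<union> W n)"
proof -
  have "(\<lambda>n. 2 * Cap_open (V n) + 2 * Cap_open (W n)) \<longlonglongrightarrow> 2 * 0 + 2 * 0"
    using assms by (intro tendsto_intros) (auto simp: vanishing_def)
  then have lim: "(\<lambda>n. 2 * Cap_open (V n) + 2 * Cap_open (W n)) \<longlonglongrightarrow> 0" by simp
  have "(\<lambda>n. Cap_open (V n \<union> W n)) \<longlonglongrightarrow> 0"
  proof (rule tendsto_sandwich[OF _ _ tendsto_const lim])
    show "\<forall>\<^sub>F n in sequentially. 0 \<le> Cap_open (V n \<union> W n)"
      by (intro always_eventually allI Cap_open_nonneg)
    show "\<forall>\<^sub>F n in sequentially. Cap_open (V n \<union> W n) \<le> 2 * Cap_open (V n) + 2 * Cap_open (W n)"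
      by (intro always_eventually allI Cap_open_Un)
  qed
  moreover have "decseq (\<lambda>n. V n \<union> W n)"
    using assms unfolding vanishing_def decseq_def by blast
  ultimately show ?thesis using assms by (auto simp: vanishing_def)
qed

lemma qe_imp_vanishing:
  assumes "qe Q"
  obtains V where "vanishing V" "\<And>n x. x \<notin> V n \<Longrightarrow> Q x"
proof -
  obtain N where N: "Cap N = 0" "\<And>x. x \<notin> N \<Longrightarrow> Q x" using assms unfolding qe_def by blast
  have "\<exists>U. open U \<and> N \<subseteq> U \<and> Cap_open U < 1 / real (Suc n)" for n
  proof -
    have "Cap N < 1 / real (Suc n)" unfolding N(1) by simp
    then show ?thesis by (rule Cap_less_open) blast
  qed
  then obtain U where U: "\<And>n. open (U n)" "\<And>n. N \<subseteq> U n" "\<And>n. Cap_open (U n) < 1 / real (Suc n)" by metis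
  define V where "V = (\<lambda>n. \<Inter>k\<le>n. U k)"
  have "(\<lambda>n. Cap_open (V n)) \<longlonglongrightarrow> 0"
  proof (rule tendsto_sandwich[OF _ _ tendsto_const LIMSEQ_Suc[OF lim_inverse_n']])
    have "Cap_open (V n) \<le> 1 / real (Suc n)" for n
    proof -
      have "V n \<subseteq> U n" by (auto simp: V_def)
      then have "Cap_open (V n) \<le> Cap_open (U n)" by (rule Cap_open_mono)
      then show ?thesis using U(3)[of n] by linarith
    qed
    then show "\<forall>\<^sub>F n in sequentially. Cap_open (V n) \<le> 1 / real (Suc n)" by simp
  qed (simp add: Cap_open_nonneg)
  then have "vanishing V"
    using U(1) by (auto simp: vanishing_def V_def decseq_def)
  moreover have "x \<notin> V n \<Longrightarrow> Q x" for n x using U(2) N(2) by (auto simp: V_def)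
  ultimately show ?thesis by (rule that)
qed

lemma vanishing_imp_qe:
  assumes "\<And>n. open (V n)" "(\<lambda>n. Cap_open (V n)) \<longlonglongrightarrow> 0" "\<And>n x. x \<notin> V n \<Longrightarrow> Q x"
  shows "qe Q"
  unfolding qe_def
proof (intro exI conjI allI impI)
  have "Cap (\<Inter>n. V n) \<le> Cap_open (V n)" for n using assms(1) by (intro Cap_le) auto
  then have "Cap (\<Inter>n. V n) \<le> 0" by (intro LIMSEQ_le_const[OF assms(2)]) auto
  then show "Cap (\<Inter>n. V n) = 0" using Cap_nonneg by (rule antisym)
qed (use assms(3) in auto)

lemma quasi_continuous_imp_vanishing:
  assumes "quasi_continuous u"
  obtains V where "vanishing V" "\<And>n. continuous_on (- V n) u"
proof -
  obtain F where F: "nest F" "\<And>n. continuous_on (F n) u" using assms unfolding quasi_continuous_def by blast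
  have "vanishing (\<lambda>n. - F n)"
    using F(1) by (auto simp: vanishing_def nest_def decseq_def incseq_def open_Compl Cap_eq_Cap_open)
  then show ?thesis by (rule that) (simp add: F(2))
qed

text \<open>By \<open>path_avoids\<close> at time \<open>0\<close>: almost every starting point lies outside some set of a vanishing sequence.\<close>

lemma qe_imp_AE:
  assumes "qe Q"
  shows "AE x in m. Q x"
proof -
  obtain V where V: "vanishing V" "\<And>n x. x \<notin> V n \<Longrightarrow> Q x" using qe_imp_vanishing[OF assms] by blast
  have "AE x in m. AE \<omega> in P (Some x). \<forall>t<lifetime X \<omega>. \<exists>n. \<forall>s\<le>t. X s \<omega> \<notin> Some ` V n"
    using V(1) by (intro path_avoids) (auto simp: vanishing_def)
  then show ?thesis
  proof eventually_elim
    case (elim x)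
    interpret Px: prob_space "P (Some x)" by (rule prob_space_P)
    have "AE \<omega> in P (Some x). Q x"
      using elim normal[of "Some x"]
    proof eventually_elim
      case (elim \<omega>)
      have "0 < lifetime X \<omega>" using elim(2) by (intro lifetime_pos) simp
      then obtain n where "X 0 \<omega> \<notin> Some ` V n" using elim(1) by blast
      then show "Q x" using elim(2) V(2) by auto
    qed
    then show "Q x" by simp
  qed
qed

text \<open>Quasi-continuous functions that agree almost everywhere agree quasi-everywhere. The exceptional
  open sets may be enlarged by the open part of the complement that \<open>m\<close> does not charge: this does not
  change their capacity, which only sees \<open>m\<close>-classes.\<close>

lemma AE_eq_imp_qe_eq:
  assumes V: "vanishing V" and u: "\<And>n. continuous_on (- V n) u" and v: "\<And>n. continuous_on (- V n) v"
    and eq: "AE x in m. u x = (v x :: real)"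
  shows "qe (\<lambda>x. u x = v x)"
proof -
  obtain \<B> :: "'a set set" where B: "countable \<B>" "topological_basis \<B>" using ex_countable_basis by blast
  have oV: "open (V n)" for n using V by (simp add: vanishing_def)
  define G where "G = (\<lambda>n. \<Union>{b\<in>\<B>. AE x in m. x \<in> b \<longrightarrow> x \<in> V n})"
  have oG: "open (G n)" for n
    unfolding G_def using topological_basis_open[OF B(2)] by (intro open_Union) auto
  have cap: "Cap_open (V n \<union> G n) = Cap_open (V n)" for n
  proof (rule antisym)
    have "AE x in m. \<forall>b\<in>{b\<in>\<B>. AE x in m. x \<in> b \<longrightarrow> x \<in> V n}. x \<in> b \<longrightarrow> x \<in> V n"
    proof -
      have c: "countable {b\<in>\<B>. AE x in m. x \<in> b \<longrightarrow> x \<in> V n}"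
        by (rule countable_subset[OF _ B(1)]) blast
      show ?thesis by (rule AE_ball_countable[OF c, THEN iffD2]) blast
    qed
    then have "AE x in m. x \<in> V n \<union> G n \<longrightarrow> x \<in> V n" by eventually_elim (auto simp: G_def)
    then show "Cap_open (V n \<union> G n) \<le> Cap_open (V n)" by (rule Cap_open_mono_AE)
  qed (simp add: Cap_open_mono)
  show ?thesis
  proof (rule vanishing_imp_qe[of "\<lambda>n. V n \<union> G n"])
    show "(\<lambda>n. Cap_open (V n \<union> G n)) \<longlonglongrightarrow> 0" using V unfolding cap vanishing_def by blast
    fix n x assume x: "x \<notin> V n \<union> G n"
    show "u x = v x"
    proof (rule ccontr)
      assume ne: "u x \<noteq> v x"
      have cont: "continuous_on (- V n) (\<lambda>x. u x - v x)" by (intro continuous_on_diff u v)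
      have op: "open (- {0::real})" by (rule open_Compl) simp
      obtain W where W: "open W" "W \<inter> (- V n) = (\<lambda>x. u x - v x) -` (- {0}) \<inter> (- V n)"
        using continuous_on_open_invariant[THEN iffD1, rule_format, OF cont op] by blast
      have "x \<in> (\<lambda>x. u x - v x) -` (- {0}) \<inter> (- V n)" using x ne by simp
      then have "x \<in> W" unfolding W(2)[symmetric] by (rule IntD1)
      then obtain b where b: "b \<in> \<B>" "x \<in> b" "b \<subseteq> W" by (rule topological_basisE[OF B(2) W(1)])
      have "AE x in m. x \<in> b \<longrightarrow> x \<in> V n"
        using eq
      proof eventually_elim
        case (elim y)
        show ?case
        proof (intro impI, rule ccontr)
          assume "y \<in> b" "y \<notin> V n"
          then have "y \<in> W \<inter> (- V n)" using b(3) by blast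
          then have "y \<in> (\<lambda>x. u x - v x) -` (- {0})" unfolding W(2) by (rule IntD1)
          then show False using elim by simp
        qed
      qed
      then show False using b x by (auto simp: G_def)
    qed
  qed (intro open_Un oV oG)
qed

text \<open>A quasi-continuous function is Borel after it is set to \<open>0\<close> on an exceptional set.\<close>

definition borel_version :: "(nat \<Rightarrow> 'a set) \<Rightarrow> ('a \<Rightarrow> real) \<Rightarrow> 'a \<Rightarrow> real" where
  "borel_version V u x = (if \<exists>n. x \<notin> V n then u x else 0)"

lemma measurable_borel_version:
  assumes V: "vanishing V" and u: "\<And>n. continuous_on (- V n) u"
  shows "borel_version V u \<in> borel_measurable borel"
proof (rule borel_measurable_LIMSEQ_real)
  show "(\<lambda>x. indicator (- V n) x *\<^sub>R u x) \<in> borel_measurable borel" for n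
    using V by (intro borel_measurable_continuous_on_indicator u) (auto simp: vanishing_def)
  fix x
  show "(\<lambda>n. indicator (- V n) x *\<^sub>R u x) \<longlonglongrightarrow> borel_version V u x"
  proof (cases "\<exists>n. x \<notin> V n")
    case True
    then obtain N where "x \<notin> V N" by blast
    then have "x \<notin> V n" if "N \<le> n" for n
      using V that by (auto simp: vanishing_def decseq_def)
    then have "indicator (- V n) x *\<^sub>R u x = borel_version V u x" if "N \<le> n" for n
      using True that by (simp add: borel_version_def)
    then have "\<forall>\<^sub>F n in sequentially. indicator (- V n) x *\<^sub>R u x = borel_version V u x"
      unfolding eventually_sequentially by blast
    then show ?thesis by (rule tendsto_eventually)
  next
    case False
    then show ?thesis by (simp add: borel_version_def)
  qed
qed

lemma measurable_g_ext:
  assumes "continuous_on {0<..} g" and [measurable]: "u \<in> borel_measurable borel"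
  shows "(\<lambda>x. g_ext g (ennreal (u x))) \<in> borel_measurable borel"
proof -
  have [measurable]: "(\<lambda>y. indicator {0<..} y *\<^sub>R g y) \<in> borel_measurable borel"
    by (rule borel_measurable_continuous_on_indicator[OF _ assms(1)]) simp
  have "(\<lambda>x. if u x \<le> 0 then \<infinity> else ennreal (indicator {0<..} (u x) *\<^sub>R g (u x))) \<in> borel_measurable borel"
    by measurable
  also have "(\<lambda>x. if u x \<le> 0 then \<infinity> else ennreal (indicator {0<..} (u x) *\<^sub>R g (u x))) = (\<lambda>x. g_ext g (ennreal (u x)))"
    by (auto simp: fun_eq_iff g_ext_def ennreal_eq_0_iff)
  finally show ?thesis .
qed

end

context additive_functional
begin

lemma AE_\<Lambda>: "AE x in m. AE \<omega> in P (Some x). \<omega> \<in> \<Lambda>"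
  using qe_imp_AE[OF full_\<Lambda>]
proof eventually_elim
  case (elim x)
  interpret C: prob_space "completion (P (Some x))"
    using prob_space_P by (simp add: prob_space.prob_space_completion)
  have "\<Lambda> \<in> sets (completion (P (Some x)))"
    using sets_\<Lambda> completed_le_completion[OF point_mass_law, of "\<top>" "Some x"] by (auto simp: bind_point_mass)
  then have "AE \<omega> in completion (P (Some x)). \<omega> \<in> \<Lambda>"
    using elim by (intro C.AE_prob_1) (simp add: measure_def)
  then show ?case by (simp add: AE_completion_iff)
qed

text \<open>If one potential is smaller on \<open>B\<close>, then so is its part accumulated after a visit of \<open>B\<close>, by the Markov property
  at the first visit.\<close>

lemma clock_integral_after_mono_finite:
  assumes B: "B \<in> sets borel" and f1: "f1 \<in> borel_measurable borel" and f2: "f2 \<in> borel_measurable borel"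
    and le: "AE x in m. x \<in> B \<longrightarrow>
      (\<integral>\<^sup>+\<omega>. clock_integral f1 \<omega> \<partial>P (Some x)) \<le> (\<integral>\<^sup>+\<omega>. clock_integral f2 \<omega> \<partial>P (Some x))"
    and "finite S" "S \<subseteq> {0..}"
  shows "AE x in m. (\<integral>\<^sup>+\<omega>. clock_integral_after B S f1 \<omega> \<partial>P (Some x))
      \<le> (\<integral>\<^sup>+\<omega>. clock_integral_after B S f2 \<omega> \<partial>P (Some x))"
  using assms(5,6)
proof (induction rule: finite_times_induct)
  case empty
  then show ?case by (simp add: clock_integral_after_def)
next
  case (now S)
  show ?case
    using now.IH le AE_\<Lambda>
  proof eventually_elim
    case (elim x)
    show ?case
    proof (cases "x \<in> B")
      case True
      have "(\<integral>\<^sup>+\<omega>. clock_integral_after B (insert 0 S) f \<omega> \<partial>P (Some x)) = (\<integral>\<^sup>+\<omega>. clock_integral f \<omega> \<partial>P (Some x))" for f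
      proof (intro nn_integral_cong_AE, use normal[of "Some x"] elim(3) in eventually_elim)
        fix \<omega> assume \<omega>: "X 0 \<omega> = Some x" "\<omega> \<in> \<Lambda>"
        have "(if visited B (insert 0 S) (inverse_clock a \<omega>) \<omega> then clock_integrand f a \<omega> else 0) = clock_integrand f a \<omega>" for a
          using inverse_clock_pos[OF \<omega>(2), of a] True visited_insert_0[OF \<omega>(1)]
          by (cases "0 < a") (simp_all add: clock_integrand_def)
        then show "clock_integral_after B (insert 0 S) f \<omega> = clock_integral f \<omega>"
          by (simp only: clock_integral_after_def clock_integral_def)
      qed
      then show ?thesis using elim(2) True by simp
    next
      case False
      have "(\<integral>\<^sup>+\<omega>. clock_integral_after B (insert 0 S) f \<omega> \<partial>P (Some x)) = (\<integral>\<^sup>+\<omega>. clock_integral_after B S f \<omega> \<partial>P (Some x))" for f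
      proof (intro nn_integral_cong_AE, use normal[of "Some x"] in eventually_elim)
        fix \<omega> assume "X 0 \<omega> = Some x"
        then show "clock_integral_after B (insert 0 S) f \<omega> = clock_integral_after B S f \<omega>"
          using False by (simp add: clock_integral_after_def visited_insert_0)
      qed
      then show ?thesis using elim(1) by simp
    qed
  qed
next
  case (shift S t)
  have c: "countable S" using shift(1) by (rule countable_finite)
  have eq: "(\<integral>\<^sup>+\<omega>. clock_integral_after B ((\<lambda>s. t + s) ` S) f \<omega> \<partial>P (Some x))
     = (\<integral>\<^sup>+y. case_option 0 (\<lambda>z. \<integral>\<^sup>+\<omega>. clock_integral_after B S f \<omega> \<partial>P (Some z)) y \<partial>law (Some x) (ennreal t))"
    if "AE \<omega> in P (Some x). \<omega> \<in> \<Lambda>" and f: "f \<in> borel_measurable borel" for x f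
  proof -
    have "(\<integral>\<^sup>+\<omega>. clock_integral_after B ((\<lambda>s. t + s) ` S) f \<omega> \<partial>P (Some x))
       = (\<integral>\<^sup>+\<omega>. clock_integral_after B S f (\<theta> (ennreal t) \<omega>) \<partial>P (Some x))"
      using that(1) by (intro nn_integral_cong_AE) (auto elim!: eventually_mono simp: clock_integral_after_shift[OF _ shift(3,2) c f B])
    also have "\<dots> = (\<integral>\<^sup>+y. case_option 0 (\<lambda>z. \<integral>\<^sup>+\<omega>. clock_integral_after B S f \<omega> \<partial>P (Some z)) y \<partial>law (Some x) (ennreal t))"
    proof (rule nn_integral_shift_alive)
      show "clock_integral_after B S f \<in> borel_measurable (completion (law (Some x) (ennreal t) \<bind> P))"
        by (rule measurable_clock_integral_parts(1)[OF law_space f B c])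
      show "clock_integral_after B S f \<omega> = 0" if "\<And>t. X t \<omega> = None" for \<omega>
        by (simp add: clock_integral_after_def visited_def that)
    qed
    finally show ?thesis .
  qed
  show ?case
    using AE_\<Lambda> AE_law[OF shift.IH shift(3)]
  proof eventually_elim
    case (elim x)
    show ?case
      unfolding eq[OF elim(1) f1] eq[OF elim(1) f2]
      using elim(2) by (intro nn_integral_mono_AE) (auto elim!: eventually_mono split: option.split)
  qed
qed

lemma clock_integral_after_mono:
  assumes B: "B \<in> sets borel" and f1: "f1 \<in> borel_measurable borel" and f2: "f2 \<in> borel_measurable borel"
    and le: "AE x in m. x \<in> B \<longrightarrow>
      (\<integral>\<^sup>+\<omega>. clock_integral f1 \<omega> \<partial>P (Some x)) \<le> (\<integral>\<^sup>+\<omega>. clock_integral f2 \<omega> \<partial>P (Some x))"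
  shows "AE x in m. (\<integral>\<^sup>+\<omega>. clock_integral_after B rational_times f1 \<omega> \<partial>P (Some x))
      \<le> (\<integral>\<^sup>+\<omega>. clock_integral_after B rational_times f2 \<omega> \<partial>P (Some x))"
proof -
  obtain S :: "nat \<Rightarrow> real set" where S: "\<And>n. finite (S n)" "incseq S" "(\<Union>n. S n) = rational_times"
    using countable_finite_chain[OF countable_rational_times] by blast
  have c: "countable (S n)" for n using S(1) by (rule countable_finite)
  have sup: "(\<integral>\<^sup>+\<omega>. clock_integral_after B rational_times f \<omega> \<partial>P (Some x))
     = (SUP n. \<integral>\<^sup>+\<omega>. clock_integral_after B (S n) f \<omega> \<partial>P (Some x))"
    if [measurable]: "f \<in> borel_measurable borel" for f x
  proof -
    note [measurable] = B c
    have "(\<integral>\<^sup>+\<omega>. clock_integral_after B rational_times f \<omega> \<partial>completion (P (Some x)))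
       = (SUP n. \<integral>\<^sup>+\<omega>. clock_integral_after B (S n) f \<omega> \<partial>completion (P (Some x)))"
      unfolding S(3)[symmetric] clock_integral_after_def
    proof (rule nn_integral_visited_SUP[OF S(2)])
      show "(\<lambda>a. if visited B (S n) (inverse_clock a \<omega>) \<omega> then clock_integrand f a \<omega> else 0) \<in> borel_measurable lborel" for n \<omega>
        by measurable
      show "(\<lambda>\<omega>. \<integral>\<^sup>+a. (if visited B (S n) (inverse_clock a \<omega>) \<omega> then clock_integrand f a \<omega> else 0) \<partial>lborel)
          \<in> borel_measurable (completion (P (Some x)))" for n
        using measurable_clock_integral_parts(1)[OF point_mass_law[of "Some x"] that B c, of n]
        unfolding clock_integral_after_def bind_point_mass .
    qed
    then show ?thesis unfolding nn_integral_completion .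
  qed
  have "S n \<subseteq> {0..}" for n using S(3) by blast
  then have "AE x in m. \<forall>n. (\<integral>\<^sup>+\<omega>. clock_integral_after B (S n) f1 \<omega> \<partial>P (Some x))
      \<le> (\<integral>\<^sup>+\<omega>. clock_integral_after B (S n) f2 \<omega> \<partial>P (Some x))"
    unfolding AE_all_countable by (intro allI clock_integral_after_mono_finite assms S)
  then show ?thesis
    unfolding sup[OF f1] sup[OF f2] by eventually_elim (intro SUP_mono, auto)
qed

lemma expect_clock_integral_split:
  assumes f [measurable]: "f \<in> borel_measurable borel" and B [measurable]: "B \<in> sets borel" and S [measurable]: "countable S"
  shows "(\<integral>\<^sup>+\<omega>. clock_integral f \<omega> \<partial>P (Some x))
     = (\<integral>\<^sup>+\<omega>. clock_integral_after B S f \<omega> \<partial>P (Some x)) + (\<integral>\<^sup>+\<omega>. clock_integral_before B S f \<omega> \<partial>P (Some x))"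
proof -
  have split: "clock_integral f \<omega> = clock_integral_after B S f \<omega> + clock_integral_before B S f \<omega>" for \<omega>
  proof -
    let ?V = "\<lambda>a. visited B S (inverse_clock a \<omega>) \<omega>"
    have "clock_integral f \<omega>
        = (\<integral>\<^sup>+a. ((if ?V a then clock_integrand f a \<omega> else 0) + (if ?V a then 0 else clock_integrand f a \<omega>)) \<partial>lborel)"
      unfolding clock_integral_def by (intro nn_integral_cong) simp
    also have "\<dots> = clock_integral_after B S f \<omega> + clock_integral_before B S f \<omega>"
      unfolding clock_integral_after_def clock_integral_before_def by (rule nn_integral_add) measurable
    finally show ?thesis .
  qed
  have "(\<integral>\<^sup>+\<omega>. clock_integral f \<omega> \<partial>completion (P (Some x)))
     = (\<integral>\<^sup>+\<omega>. clock_integral_after B S f \<omega> \<partial>completion (P (Some x)))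
     + (\<integral>\<^sup>+\<omega>. clock_integral_before B S f \<omega> \<partial>completion (P (Some x)))"
    unfolding split using measurable_clock_integral_parts[OF point_mass_law[of "Some x"] f B S]
    unfolding bind_point_mass by (rule nn_integral_add)
  then show ?thesis unfolding nn_integral_completion .
qed

end

section \<open>Uniqueness\<close>

context additive_functional
begin

text \<open>On a path that stays off the exceptional sets, \<open>u\<close> and \<open>v\<close> are right continuous along the path.
  Before the first rational time at which \<open>u \<le> v\<close>, this gives \<open>u \<ge> v\<close>, hence \<open>g(u) \<le> g(v)\<close>.\<close>

lemma clock_integral_before_mono:
  fixes V :: "nat \<Rightarrow> 'a set" and u v :: "'a \<Rightarrow> real" and g :: "real \<Rightarrow> real"
  defines "f \<equiv> \<lambda>u x. g_ext g (ennreal (borel_version V u x))"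
  defines "B \<equiv> {x. borel_version V u x \<le> borel_version V v x}"
  assumes V: "vanishing V" and u: "\<And>n. continuous_on (- V n) u" and v: "\<And>n. continuous_on (- V n) v"
    and u_pos: "\<And>n x. x \<notin> V n \<Longrightarrow> 0 < u x" and v_pos: "\<And>n x. x \<notin> V n \<Longrightarrow> 0 < v x"
    and g: "antimono_on {0<..} g"
    and \<omega>: "\<omega> \<in> \<Lambda>" and path: "\<forall>t<lifetime X \<omega>. \<exists>n. \<forall>s\<le>t. X s \<omega> \<notin> Some ` V n"
  shows "clock_integral_before B rational_times (f u) \<omega> \<le> clock_integral_before B rational_times (f v) \<omega>"
proof -
  define T where "T = (INF q\<in>{q\<in>rational_times. X (ennreal q) \<omega> \<in> Some ` B}. ennreal q)"
  let ?V = "\<lambda>a. visited B rational_times (inverse_clock a \<omega>) \<omega>"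
  have bv: "borel_version V w x = w x" if "x \<notin> V n" for w n x using that by (auto simp: borel_version_def)
  have main: "case_option 0 (f u) (X (inverse_clock a \<omega>) \<omega>) \<le> case_option 0 (f v) (X (inverse_clock a \<omega>) \<omega>)"
    if a: "0 < a" "a \<noteq> enn2real (A T \<omega>)" and nv: "\<not> ?V a" for a
  proof (cases "X (inverse_clock a \<omega>) \<omega>")
    case (Some y)
    let ?\<sigma> = "inverse_clock a \<omega>"
    have "?\<sigma> < lifetime X \<omega>" using dead_iff[of ?\<sigma> \<omega>] Some by (simp add: not_le[symmetric])
    then obtain t where t: "?\<sigma> < t" "t < lifetime X \<omega>" using dense by blast
    have "t < \<top>" using t(2) by (rule less_le_trans) simp
    then have \<sigma>fin: "?\<sigma> < \<top>" using t(1) by (rule less_trans[rotated])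
    obtain n where n: "\<And>s. s \<le> t \<Longrightarrow> X s \<omega> \<notin> Some ` V n" using path t(2) by blast
    have y: "y \<notin> V n" using n[OF less_imp_le[OF t(1)]] Some by auto
    \<comment> \<open>Otherwise \<open>u < v\<close> also shortly after \<open>\<sigma>\<close>, and a rational time there is a visit of \<open>B\<close> before \<open>T\<close>.
      The level \<open>A\<^sub>T\<close> is excluded because it alone could be reached exactly at \<open>T\<close>.\<close>
    have "v y \<le> u y"
    proof (rule ccontr)
      assume "\<not> v y \<le> u y"
      then have lt: "u y < v y" by simp
      have "?\<sigma> \<le> T" unfolding T_def using nv by (intro INF_greatest) (auto simp: visited_def not_less)
      moreover have "?\<sigma> \<noteq> T"
      proof
        assume "?\<sigma> = T"
        then have "A T \<omega> = ennreal a" using A_inverse_clock[OF \<omega> a(1) \<sigma>fin] by simp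
        then show False using a by simp
      qed
      ultimately have "?\<sigma> < T" by simp
      have cont: "continuous_on (- V n) (\<lambda>x. v x - u x)" by (intro continuous_on_diff u v)
      obtain W where W: "open W" "W \<inter> (- V n) = (\<lambda>x. v x - u x) -` {0<..} \<inter> (- V n)"
        using continuous_on_open_invariant[THEN iffD1, rule_format, OF cont open_greaterThan[of 0]] by blast
      have "y \<in> (\<lambda>x. v x - u x) -` {0<..} \<inter> (- V n)" using lt y by simp
      then have "y \<in> W" unfolding W(2)[symmetric] by (rule IntD1)
      then have "\<forall>\<^sub>F s in at_right ?\<sigma>. X s \<omega> \<in> Some ` W"
        using right_continuous[of ?\<sigma> \<omega>] \<sigma>fin Some W(1) by (intro limit_in_openI) auto
      then obtain p where p: "?\<sigma> < p" "\<And>s. ?\<sigma> < s \<Longrightarrow> s < p \<Longrightarrow> X s \<omega> \<in> Some ` W"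
        unfolding eventually_at_right[OF \<sigma>fin] by blast
      have "?\<sigma> < min p (min t T)" using p(1) t(1) \<open>?\<sigma> < T\<close> by simp
      then obtain q where q: "q \<in> rational_times" "?\<sigma> < ennreal q" "ennreal q < min p (min t T)"
        by (rule rational_time_between_ennreal)
      have "X (ennreal q) \<omega> \<in> Some ` W" using p(2) q by simp
      then obtain z where z: "X (ennreal q) \<omega> = Some z" "z \<in> W" by auto
      have zV: "z \<notin> V n" using n[OF less_imp_le, of "ennreal q"] q(3) z(1) by auto
      have "z \<in> W \<inter> (- V n)" using z(2) zV by blast
      then have "z \<in> (\<lambda>x. v x - u x) -` {0<..}" unfolding W(2) by (rule IntD1)
      then have "z \<in> B" using bv[OF zV] by (simp add: B_def)
      then have "T \<le> ennreal q" unfolding T_def using q(1) z(1) by (intro INF_lower) simp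
      moreover have "ennreal q < T" using q(3) by simp
      ultimately show False using leD by blast
    qed
    then have "g (u y) \<le> g (v y)" using g u_pos[OF y] v_pos[OF y] by (intro monotone_onD[OF g]) auto
    then have "f u y \<le> f v y"
      using u_pos[OF y] v_pos[OF y] by (auto simp: f_def bv[OF y] g_ext_def ennreal_eq_0_iff intro: ennreal_leI)
    then show ?thesis using Some by simp
  qed simp
  show ?thesis
    unfolding clock_integral_before_def
  proof (intro nn_integral_mono_AE, use AE_lborel_singleton[of "enn2real (A T \<omega>)"] in eventually_elim)
    fix a assume "a \<noteq> enn2real (A T \<omega>)"
    then show "(if ?V a then 0 else clock_integrand (f u) a \<omega>) \<le> (if ?V a then 0 else clock_integrand (f v) a \<omega>)"
      using main[of a] by (cases "0 < a") (auto simp: clock_integrand_def)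
  qed
qed

text \<open>Almost every path stays where \<open>u\<close> and its Borel version agree, so the right-hand side of the equation may be
  computed with the latter.\<close>

lemma expect_stieltjes:
  assumes V: "vanishing V" and u: "\<And>n. continuous_on (- V n) u" and g: "continuous_on {0<..} g"
  shows "AE x in m. expect x (\<lambda>\<omega>. stieltjes (\<lambda>s. A s \<omega>) (lifetime X \<omega>)
             (\<lambda>s. g_ext g (ennreal (case_option 0 u (X (ennreal s) \<omega>)))))
      = (\<integral>\<^sup>+\<omega>. clock_integral (\<lambda>x. g_ext g (ennreal (borel_version V u x))) \<omega> \<partial>P (Some x))"
proof -
  let ?f = "\<lambda>x. g_ext g (ennreal (borel_version V u x))"
  have f: "?f \<in> borel_measurable borel" by (intro measurable_g_ext g measurable_borel_version V u)
  have "AE x in m. AE \<omega> in P (Some x). \<forall>t<lifetime X \<omega>. \<exists>n. \<forall>s\<le>t. X s \<omega> \<notin> Some ` V n"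
    using V by (intro path_avoids) (auto simp: vanishing_def)
  with AE_\<Lambda> show ?thesis
  proof eventually_elim
    case (elim x)
    show ?case
      unfolding expect_def nn_integral_completion
    proof (intro nn_integral_cong_AE, use elim in eventually_elim)
      case (elim \<omega>)
      have "stieltjes (\<lambda>s. A s \<omega>) (lifetime X \<omega>) (\<lambda>s. g_ext g (ennreal (case_option 0 u (X (ennreal s) \<omega>))))
          = stieltjes (\<lambda>s. A s \<omega>) (lifetime X \<omega>) (\<lambda>s. case_option 0 ?f (X (ennreal s) \<omega>))"
      proof (rule stieltjes_cong)
        fix s assume "ennreal s < lifetime X \<omega>"
        then obtain n where n: "\<And>r. r \<le> ennreal s \<Longrightarrow> X r \<omega> \<notin> Some ` V n" using elim(2) by blast
        have "X (ennreal s) \<omega> \<noteq> None" using \<open>ennreal s < lifetime X \<omega>\<close> by (simp add: dead_iff)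
        then obtain y where y: "X (ennreal s) \<omega> = Some y" by blast
        have "y \<notin> V n" using n[of "ennreal s"] y by auto
        then have "borel_version V u y = u y" by (auto simp: borel_version_def)
        then show "g_ext g (ennreal (case_option 0 u (X (ennreal s) \<omega>))) = case_option 0 ?f (X (ennreal s) \<omega>)"
          by (simp add: y)
      qed
      also have "\<dots> = clock_integral ?f \<omega>" by (rule stieltjes_eq_clock_integral[OF elim(1) f])
      finally show ?case .
    qed
  qed
qed

text \<open>One inequality; the roles of \<open>u\<close> and \<open>v\<close> are exchanged for the other.\<close>

lemma solution_le:
  assumes V: "vanishing V" and u: "\<And>n. continuous_on (- V n) u" and v: "\<And>n. continuous_on (- V n) v"
    and u_pos: "\<And>n x. x \<notin> V n \<Longrightarrow> 0 < u x" and v_pos: "\<And>n x. x \<notin> V n \<Longrightarrow> 0 < v x"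
    and g: "continuous_on {0<..} g" "antimono_on {0<..} g"
    and sol: "solution A g u" "solution A g v"
  shows "AE x in m. u x \<le> v x"
proof -
  define f where "f = (\<lambda>u x. g_ext g (ennreal (borel_version V u x)))"
  define B where "B = {x. borel_version V u x \<le> borel_version V v x}"
  note bu [measurable] = measurable_borel_version[OF V u] and bv [measurable] = measurable_borel_version[OF V v]
  have fu: "f u \<in> borel_measurable borel" and fv: "f v \<in> borel_measurable borel"
    unfolding f_def by (intro measurable_g_ext g bu bv)+
  have B: "B \<in> sets borel" unfolding B_def by measurable
  have eq: "AE x in m. ennreal (w x) = (\<integral>\<^sup>+\<omega>. clock_integral (f w) \<omega> \<partial>P (Some x))"
    if "solution A g w" "\<And>n. continuous_on (- V n) w" for w
  proof -
    have "qe (\<lambda>x. ennreal (w x) = expect x (\<lambda>\<omega>. stieltjes (\<lambda>s. A s \<omega>) (lifetime X \<omega>)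
             (\<lambda>s. g_ext g (ennreal (case_option 0 w (X (ennreal s) \<omega>))))))"
      using that(1) unfolding solution_def by blast
    from qe_imp_AE[OF this] expect_stieltjes[OF V that(2) g(1)] show ?thesis
      unfolding f_def by eventually_elim simp
  qed
  have off: "AE x in m. \<exists>n. x \<notin> V n"
    by (rule qe_imp_AE[OF vanishing_imp_qe[of V]]) (use V in \<open>auto simp: vanishing_def\<close>)
  have "AE x in m. x \<in> B \<longrightarrow>
      (\<integral>\<^sup>+\<omega>. clock_integral (f u) \<omega> \<partial>P (Some x)) \<le> (\<integral>\<^sup>+\<omega>. clock_integral (f v) \<omega> \<partial>P (Some x))"
    using eq[OF sol(1) u] eq[OF sol(2) v] off
  proof eventually_elim
    case (elim x)
    show ?case
    proof
      assume "x \<in> B"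
      then have "u x \<le> v x" using elim(3) by (simp add: B_def borel_version_def)
      then show "(\<integral>\<^sup>+\<omega>. clock_integral (f u) \<omega> \<partial>P (Some x)) \<le> (\<integral>\<^sup>+\<omega>. clock_integral (f v) \<omega> \<partial>P (Some x))"
        unfolding elim(1,2)[symmetric] by (rule ennreal_leI)
    qed
  qed
  note after = clock_integral_after_mono[OF B fu fv this]
  have "AE x in m. AE \<omega> in P (Some x). \<forall>t<lifetime X \<omega>. \<exists>n. \<forall>s\<le>t. X s \<omega> \<notin> Some ` V n"
    using V by (intro path_avoids) (auto simp: vanishing_def)
  with AE_\<Lambda> have before: "AE x in m. (\<integral>\<^sup>+\<omega>. clock_integral_before B rational_times (f u) \<omega> \<partial>P (Some x))
      \<le> (\<integral>\<^sup>+\<omega>. clock_integral_before B rational_times (f v) \<omega> \<partial>P (Some x))"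
  proof eventually_elim
    case (elim x)
    show ?case
    proof (intro nn_integral_mono_AE, use elim in eventually_elim)
      case (elim \<omega>)
      show ?case unfolding f_def B_def
        by (rule clock_integral_before_mono[OF V u v u_pos v_pos g(2) elim])
    qed
  qed
  show ?thesis
    using after before eq[OF sol(1) u] eq[OF sol(2) v]
  proof eventually_elim
    case (elim x)
    have "ennreal (u x) = (\<integral>\<^sup>+\<omega>. clock_integral_after B rational_times (f u) \<omega> \<partial>P (Some x))
        + (\<integral>\<^sup>+\<omega>. clock_integral_before B rational_times (f u) \<omega> \<partial>P (Some x))"
      unfolding elim(3) by (rule expect_clock_integral_split[OF fu B countable_rational_times])
    also have "\<dots> \<le> (\<integral>\<^sup>+\<omega>. clock_integral_after B rational_times (f v) \<omega> \<partial>P (Some x))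
        + (\<integral>\<^sup>+\<omega>. clock_integral_before B rational_times (f v) \<omega> \<partial>P (Some x))"
      using elim(1,2) by (rule add_mono)
    also have "\<dots> = ennreal (v x)"
      unfolding elim(4) by (rule expect_clock_integral_split[OF fv B countable_rational_times, symmetric])
    finally show "u x \<le> v x"
      using sol(2) by (subst (asm) ennreal_le_iff) (auto simp: solution_def)
  qed
qed

theorem solution_unique:
  assumes g: "continuous_on {0<..} g" "antimono_on {0<..} g"
    and sol: "solution A g u" "solution A g v"
  shows "qe (\<lambda>x. u x = v x)"
proof -
  have props: "quasi_continuous w" "qe (\<lambda>x. 0 < w x)" if "solution A g w" for w
    using that unfolding solution_def by blast+
  obtain V1 where V1: "vanishing V1" "\<And>n. continuous_on (- V1 n) u"
    by (rule quasi_continuous_imp_vanishing[OF props(1)[OF sol(1)]]) blast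
  obtain V2 where V2: "vanishing V2" "\<And>n. continuous_on (- V2 n) v"
    by (rule quasi_continuous_imp_vanishing[OF props(1)[OF sol(2)]]) blast
  obtain V3 where V3: "vanishing V3" "\<And>n x. x \<notin> V3 n \<Longrightarrow> 0 < u x"
    by (rule qe_imp_vanishing[OF props(2)[OF sol(1)]]) blast
  obtain V4 where V4: "vanishing V4" "\<And>n x. x \<notin> V4 n \<Longrightarrow> 0 < v x"
    by (rule qe_imp_vanishing[OF props(2)[OF sol(2)]]) blast
  define V where "V = (\<lambda>n. (V1 n \<union> V2 n) \<union> (V3 n \<union> V4 n))"
  have V: "vanishing V" unfolding V_def by (intro vanishing_Un V1(1) V2(1) V3(1) V4(1))
  have u: "continuous_on (- V n) u" for n by (rule continuous_on_subset[OF V1(2)[of n]]) (auto simp: V_def)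
  have v: "continuous_on (- V n) v" for n by (rule continuous_on_subset[OF V2(2)[of n]]) (auto simp: V_def)
  have u_pos: "0 < u x" if "x \<notin> V n" for n x by (rule V3(2)[of x n]) (use that in \<open>auto simp: V_def\<close>)
  have v_pos: "0 < v x" if "x \<notin> V n" for n x by (rule V4(2)[of x n]) (use that in \<open>auto simp: V_def\<close>)
  have "AE x in m. u x \<le> v x" by (rule solution_le[OF V u v u_pos v_pos g sol])
  moreover have "AE x in m. v x \<le> u x" by (rule solution_le[OF V v u v_pos u_pos g sol(2,1)])
  ultimately have "AE x in m. u x = v x" by eventually_elim simp
  then show ?thesis by (rule AE_eq_imp_qe_eq[OF V u v])
qed

end

theorem corollary3p3:
  fixes m \<mu> :: "'a::{metric_space, second_countable_topology} measure"
    and D :: "('a \<Rightarrow> real) set"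
    and \<E> :: "('a \<Rightarrow> real) \<Rightarrow> ('a \<Rightarrow> real) \<Rightarrow> real"
    and \<phi> :: "'a \<Rightarrow> real"
    and X :: "ennreal \<Rightarrow> 'w \<Rightarrow> 'a option"
    and \<theta> :: "ennreal \<Rightarrow> 'w \<Rightarrow> 'w"
    and P :: "'a option \<Rightarrow> 'w measure"
    and A :: "ennreal \<Rightarrow> 'w \<Rightarrow> ennreal"
    and g :: "real \<Rightarrow> real"
    and c1 c2 \<gamma> :: real
    and u v :: "'a \<Rightarrow> real"
  assumes "dirichlet_hunt m D \<E> \<phi> X \<theta> P"
    and "dirichlet_space.positive_smooth m D \<E> \<phi> \<mu>"
    and "dirichlet_hunt.pcaf m D \<E> \<phi> X \<theta> P A"
    and "dirichlet_hunt.revuz m X P A \<mu>"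
    and "continuous_on {0<..} g"
    and "antimono_on {0<..} g"
    and "\<And>y. 0 < y \<Longrightarrow> 0 \<le> g y"
    and "0 < c1" and "0 < c2" and "0 < \<gamma>"
    and "\<And>y. 0 < y \<Longrightarrow> c1 \<le> g y * y powr \<gamma> \<and> g y * y powr \<gamma> \<le> c2"
    and "dirichlet_hunt.solution m D \<E> \<phi> X P A g u"
    and "dirichlet_hunt.solution m D \<E> \<phi> X P A g v"
  shows "dirichlet_space.qe m D \<E> \<phi> (\<lambda>x. u x = v x)"
proof -
  interpret dirichlet_hunt m D \<E> \<phi> X \<theta> P by (rule assms(1))
  obtain \<Lambda> where "additive_functional m D \<E> \<phi> X \<theta> P A \<Lambda>"
    by (rule pcaf_additive_functional[OF assms(3)])
  then show ?thesis
    using assms(5,6,12,13) by (rule additive_functional.solution_unique)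
qed

end
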